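(* For every $\epsilon>0$ there exists $d_0$ such that for all integers $d\ge d_0$, \[ \max_{\rho\in\mathcal{PPT}_d}\ {\rm dist}(\rho,\mathcal{SEP}_d)\ \ge\ \frac14-\epsilon . \] Moreover, the distance is witnessed in most directions: for every $\epsilon>0$, the normalized invariant (uniform) measure of the set of directions $u\in S_d$ with the following property tends to $1$ as $d\to\infty$: every $\rho\in\mathcal{PPT}_d$ with $\langle\rho,u\rangle=\max_{\tau\in\mathcal{PPT}_d}\langle\tau,u\rangle$ satisfies ${\rm dist}(\rho,\mathcal{SEP}_d)\ge\frac14-\epsilon$.
   Context: Consider the bipartite system $\mathbb{C}^d\otimes\mathbb{C}^d$. A state is a positive semidefinite operator of trace one on $\mathbb{C}^d\otimes\mathbb{C}^d$. $\mathcal{SEP}_d$ is the set of separable states (convex hull of product states $\rho_A\otimes\rho_B$). The partial transpose of an operator is $\rho^\Gamma=({\rm Id}\otimes T)(\rho)$, with $T$ the transpose on the second factor; $\mathcal{PPT}_d$ is the set of states $\rho$ with $\rho^\Gamma\ge 0$. The trace norm is $\|X\|_1={\rm Tr}\sqrt{XX^\dagger}$ and ${\rm dist}(\rho,\mathcal{SEP}_d)=\min_{\sigma\in\mathcal{SEP}_d}\|\rho-\sigma\|_1$. The real inner product on Hermitian matrices is $\langle x,u\rangle={\rm Tr}(xu)$ (Hilbert–Schmidt), and $S_d$ is the unit sphere (in Hilbert–Schmidt norm) of the real space of traceless Hermitian $d^2\times d^2$ matrices, equipped with its normalized rotation-invariant measure. *)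

theory Defs
  imports "HOL-Probability.Probability"
begin

text \<open>Matrices (operators) indexed by a finite index set I are represented as functions
  I-index to I-index to complex that vanish outside I x I.  For the bipartite system
  C^d (x) C^d the index set is {..<d} x {..<d}; a local system C^d uses {..<d}.\<close>

type_synonym 'a cmat = "'a \<Rightarrow> 'a \<Rightarrow> complex"

definition ops_on :: "'a set \<Rightarrow> 'a cmat set" where
  "ops_on I = {X. \<forall>i j. (i \<notin> I \<or> j \<notin> I) \<longrightarrow> X i j = 0}"

definition mtrace :: "'a set \<Rightarrow> 'a cmat \<Rightarrow> complex" where
  "mtrace I X = (\<Sum>i\<in>I. X i i)"

definition mmul :: "'a set \<Rightarrow> 'a cmat \<Rightarrow> 'a cmat \<Rightarrow> 'a cmat" where
  "mmul I A B = (\<lambda>i j. if i \<in> I \<and> j \<in> I then (\<Sum>k\<in>I. A i k * B k j) else 0)"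

definition madj :: "'a cmat \<Rightarrow> 'a cmat" where
  "madj X = (\<lambda>i j. cnj (X j i))"

definition hermitian_on :: "'a set \<Rightarrow> 'a cmat \<Rightarrow> bool" where
  "hermitian_on I X \<longleftrightarrow> X \<in> ops_on I \<and> madj X = X"

definition psd_on :: "'a set \<Rightarrow> 'a cmat \<Rightarrow> bool" where
  "psd_on I X \<longleftrightarrow> X \<in> ops_on I \<and>
     (\<forall>v :: 'a \<Rightarrow> complex. (\<Sum>i\<in>I. \<Sum>j\<in>I. cnj (v i) * X i j * v j) \<in> \<real> \<and>
        0 \<le> Re (\<Sum>i\<in>I. \<Sum>j\<in>I. cnj (v i) * X i j * v j))"

definition state_on :: "'a set \<Rightarrow> 'a cmat \<Rightarrow> bool" where
  "state_on I X \<longleftrightarrow> psd_on I X \<and> mtrace I X = 1"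

definition trace_norm :: "'a set \<Rightarrow> 'a cmat \<Rightarrow> real" where
  "trace_norm I X = Re (mtrace I (THE S. psd_on I S \<and> mmul I S S = mmul I X (madj X)))"

abbreviation bip :: "nat \<Rightarrow> (nat \<times> nat) set" where
  "bip d \<equiv> {..<d} \<times> {..<d}"

definition states :: "nat \<Rightarrow> (nat \<times> nat) cmat set" where
  "states d = {\<rho>. state_on (bip d) \<rho>}"

definition ptrans :: "(nat \<times> nat) cmat \<Rightarrow> (nat \<times> nat) cmat" where
  "ptrans X = (\<lambda>i j. X (fst i, snd j) (fst j, snd i))"

definition PPT :: "nat \<Rightarrow> (nat \<times> nat) cmat set" where
  "PPT d = {\<rho>. state_on (bip d) \<rho> \<and> psd_on (bip d) (ptrans \<rho>)}"

definition tensor :: "nat cmat \<Rightarrow> nat cmat \<Rightarrow> (nat \<times> nat) cmat" where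
  "tensor A B = (\<lambda>i j. A (fst i) (fst j) * B (snd i) (snd j))"

definition mixture :: "nat \<Rightarrow> (nat \<Rightarrow> real) \<Rightarrow> (nat \<Rightarrow> nat cmat) \<Rightarrow> (nat \<Rightarrow> nat cmat)
    \<Rightarrow> (nat \<times> nat) cmat" where
  "mixture k p A B = (\<lambda>x y. \<Sum>i<k. complex_of_real (p i) * tensor (A i) (B i) x y)"

definition SEP :: "nat \<Rightarrow> (nat \<times> nat) cmat set" where
  "SEP d = {mixture k p A B | k p A B.
      (\<forall>i<k. 0 \<le> p i \<and> state_on {..<d} (A i) \<and> state_on {..<d} (B i)) \<and>
      (\<Sum>i<k. p i) = 1}"

definition dist_SEP :: "nat \<Rightarrow> (nat \<times> nat) cmat \<Rightarrow> real" where
  "dist_SEP d \<rho> = Inf ((\<lambda>\<sigma>. trace_norm (bip d) (\<rho> - \<sigma>)) ` SEP d)"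

definition hs_inner :: "nat \<Rightarrow> (nat \<times> nat) cmat \<Rightarrow> (nat \<times> nat) cmat \<Rightarrow> real" where
  "hs_inner d x u = Re (mtrace (bip d) (mmul (bip d) x u))"

definition sphere_S :: "nat \<Rightarrow> (nat \<times> nat) cmat set" where
  "sphere_S d = {u. hermitian_on (bip d) u \<and> mtrace (bip d) u = 0 \<and> hs_inner d u u = 1}"

text \<open>Uniform (normalized rotation-invariant) measure on S_d, realized as the law of
  P(G)/||P(G)||, where G is a standard Gaussian vector in the Euclidean space of Hermitian
  matrices (HS inner product) and P the orthogonal projection onto the traceless subspace.
  Coordinates: herm_of is a linear isometry from R^(I x I) onto Hermitian matrices on I.\<close>

definition flat :: "nat \<Rightarrow> nat \<times> nat \<Rightarrow> nat" where
  "flat d i = fst i * d + snd i"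

definition herm_of :: "nat \<Rightarrow> ((nat \<times> nat) \<times> (nat \<times> nat) \<Rightarrow> real) \<Rightarrow> (nat \<times> nat) cmat" where
  "herm_of d x = (\<lambda>i j.
     if i \<in> bip d \<and> j \<in> bip d then
       (if i = j then complex_of_real (x (i, i))
        else if flat d i < flat d j then
          (complex_of_real (x (i, j)) + \<i> * complex_of_real (x (j, i))) / complex_of_real (sqrt 2)
        else (complex_of_real (x (j, i)) - \<i> * complex_of_real (x (i, j))) / complex_of_real (sqrt 2))
     else 0)"

definition traceless_part :: "nat \<Rightarrow> (nat \<times> nat) cmat \<Rightarrow> (nat \<times> nat) cmat" where
  "traceless_part d X = (\<lambda>i j. if i \<in> bip d \<and> j \<in> bip d then
      X i j - (if i = j then mtrace (bip d) X / of_nat (d * d) else 0) else 0)"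

definition gauss_coords :: "nat \<Rightarrow> ((nat \<times> nat) \<times> (nat \<times> nat) \<Rightarrow> real) measure" where
  "gauss_coords d = PiM (bip d \<times> bip d) (\<lambda>_. density lborel std_normal_density)"

definition direction :: "nat \<Rightarrow> ((nat \<times> nat) \<times> (nat \<times> nat) \<Rightarrow> real) \<Rightarrow> (nat \<times> nat) cmat" where
  "direction d x = (let Y = traceless_part d (herm_of d x)
                    in (\<lambda>i j. Y i j / complex_of_real (sqrt (hs_inner d Y Y))))"

definition sphere_measure :: "nat \<Rightarrow> (nat \<times> nat) cmat set \<Rightarrow> real" where
  "sphere_measure d A = measure (gauss_coords d) {x \<in> space (gauss_coords d). direction d x \<in> A}"

end

theory Submission
  imports Defs "HOL-Real_Asymp.Real_Asymp"
begin

text \<open>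
  Put $n = d^2$ and let $G$ be a Gaussian Hermitian matrix on $C^d \otimes C^d$ with traceless part $Y$.
  With high probability $Y$ and $Y^\Gamma$ lie between $-M$ and $M$ for $M = (2 + o(1)) \sqrt n$,
  the norm $\|Y\|^2$ is $(1 + o(1)) n^2$, and $\langle\sigma, Y\rangle = o(d)$ for all separable $\sigma$.
  Then $(1 + Y/M)/n$ is a PPT state, so a PPT state $\rho$ maximising the functional $Y$ satisfies
  $\langle\rho, Y\rangle \ge \|Y\|^2/(nM)$, and duality gives
  $\|\rho - \sigma\|_1 \ge \langle\rho - \sigma, Y\rangle / M \ge n/M^2 - o(1) = 1/4 - o(1)$.

  The suprema of quadratic forms are controlled by Slepian's inequality. The forms
  $\langle v, Gv\rangle$, $-\langle v, Gv\rangle$ and $-\langle v, G^\Gamma v\rangle$ all have covariance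
  $|\langle v, w\rangle|^2 \ge 2 Re \langle v, w\rangle - 1$; they are compared with the linear process
  $\sqrt 2\, Re \langle g, v\rangle$, whose supremum $\sqrt 2\,\|g\|$ is close to $2 \sqrt n$.
\<close>

section \<open>Spectral decomposition and the trace norm\<close>

text \<open>The limit 1/4 is 1/2^2, so the constant 2 in the norm bound has to be sharp. A net on
  the unit sphere with a union bound would lose a constant factor, whereas Gaussian comparison is
  exact to leading order. The quadratic forms have variance 1 and the linear process has variance 2;
  the surplus 1 in the covariance inequality is the variance of an auxiliary scalar Gaussian. The
  partial transpose is an isometry for the Hilbert-Schmidt product, which is why the transposed form
  has the same covariance as the original one. Product vectors are compared with a process in only
  4d real dimensions, so their supremum is of order sqrt d. Maximisers for Y and for its
  normalisation coincide, so passing to the sphere only excludes Y = 0. Since \<open>measure\<close>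
  gives 0 to a set that is not measurable, the set of good directions must be shown measurable; the
  compactness of \<open>PPT d\<close> and the continuity of \<open>dist_SEP\<close> serve this
  purpose, and compactness also supplies the maximisers.\<close>

definition cinner :: "'a set \<Rightarrow> ('a \<Rightarrow> complex) \<Rightarrow> ('a \<Rightarrow> complex) \<Rightarrow> complex" where
  "cinner I v w = (\<Sum>i\<in>I. cnj (v i) * w i)"

definition mvec :: "'a set \<Rightarrow> 'a cmat \<Rightarrow> ('a \<Rightarrow> complex) \<Rightarrow> 'a \<Rightarrow> complex" where
  "mvec I X v = (\<lambda>i. \<Sum>j\<in>I. X i j * v j)"

definition qform :: "'a set \<Rightarrow> 'a cmat \<Rightarrow> ('a \<Rightarrow> complex) \<Rightarrow> complex" where
  "qform I X v = (\<Sum>i\<in>I. \<Sum>j\<in>I. cnj (v i) * X i j * v j)"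

definition orthonormal :: "'a set \<Rightarrow> nat \<Rightarrow> (nat \<Rightarrow> 'a \<Rightarrow> complex) \<Rightarrow> bool" where
  "orthonormal I m e \<longleftrightarrow> (\<forall>k<m. \<forall>l<m. cinner I (e k) (e l) = (if k = l then 1 else 0))"

lemma qform_eq_cinner: "qform I X v = cinner I v (mvec I X v)"
  by (simp add: qform_def cinner_def mvec_def sum_distrib_left mult.assoc)

lemma cinner_add_right: "cinner I v (\<lambda>i. w i + w' i) = cinner I v w + cinner I v w'"
  and cinner_diff_right: "cinner I v (\<lambda>i. w i - w' i) = cinner I v w - cinner I v w'"
  and cinner_scale_right: "cinner I v (\<lambda>i. c * w i) = c * cinner I v w"
  and cinner_add_left: "cinner I (\<lambda>i. w i + w' i) v = cinner I w v + cinner I w' v"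
  and cinner_diff_left: "cinner I (\<lambda>i. w i - w' i) v = cinner I w v - cinner I w' v"
  and cinner_scale_left: "cinner I (\<lambda>i. c * w i) v = cnj c * cinner I w v"
  by (simp_all add: cinner_def algebra_simps sum.distrib sum_subtractf sum_distrib_left)

lemma cinner_sum_right: "cinner I v (\<lambda>i. \<Sum>k\<in>K. f k i) = (\<Sum>k\<in>K. cinner I v (f k))"
  unfolding cinner_def sum_distrib_left by (rule sum.swap)

lemma cinner_sum_left: "cinner I (\<lambda>i. \<Sum>k\<in>K. f k i) v = (\<Sum>k\<in>K. cinner I (f k) v)"
  unfolding cinner_def cnj_sum sum_distrib_right by (rule sum.swap)

lemma cinner_cnj: "cnj (cinner I v w) = cinner I w v"
  by (simp add: cinner_def mult.commute)

lemma cmod_cinner_commute: "cmod (cinner I v w) = cmod (cinner I w v)"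
  by (metis cinner_cnj complex_mod_cnj)

lemma cinner_self: "cinner I v v = complex_of_real (\<Sum>i\<in>I. (cmod (v i))\<^sup>2)"
  unfolding cinner_def of_real_sum
  by (intro sum.cong refl) (metis complex_norm_square mult.commute)

lemma cinner_self_eq_0: "finite I \<Longrightarrow> cinner I v v = 0 \<Longrightarrow> i \<in> I \<Longrightarrow> v i = 0"
  unfolding cinner_self of_real_eq_0_iff by (subst (asm) sum_nonneg_eq_0_iff) auto

lemma mvec_selfadjoint:
  assumes "hermitian_on I X"
  shows "cinner I (mvec I X v) w = cinner I v (mvec I X w)"
proof -
  have h: "cnj (X i j) = X j i" for i j
    using assms unfolding hermitian_on_def madj_def by (metis (no_types))
  have "cinner I (mvec I X v) w = (\<Sum>i\<in>I. \<Sum>j\<in>I. X j i * cnj (v j) * w i)"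
    by (simp add: cinner_def mvec_def sum_distrib_right h)
  also have "\<dots> = (\<Sum>j\<in>I. \<Sum>i\<in>I. X j i * cnj (v j) * w i)"
    by (rule sum.swap)
  also have "\<dots> = cinner I v (mvec I X w)"
    by (simp add: cinner_def mvec_def sum_distrib_left algebra_simps)
  finally show ?thesis .
qed

lemma qform_hermitian_real: "hermitian_on I X \<Longrightarrow> qform I X v \<in> \<real>"
  unfolding qform_eq_cinner
  by (metis Reals_cnj_iff cinner_cnj mvec_selfadjoint)

section \<open>Orthonormal families: projection, Bessel's inequality, completeness,
  extension\<close>

lemma orthonormal_residual:
  assumes "finite I" "orthonormal I m e"
  shows "k < m \<Longrightarrow> cinner I (e k) (\<lambda>i. v i - (\<Sum>l<m. cinner I (e l) v * e l i)) = 0"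
    and "cinner I (\<lambda>i. v i - (\<Sum>l<m. cinner I (e l) v * e l i)) (\<lambda>i. v i - (\<Sum>l<m. cinner I (e l) v * e l i))
       = cinner I v v - of_real (\<Sum>l<m. (cmod (cinner I (e l) v))\<^sup>2)"
proof -
  let ?r = "\<lambda>i. v i - (\<Sum>l<m. cinner I (e l) v * e l i)"
  have orth: "cinner I (e k) ?r = 0" if "k < m" for k
  proof -
    have "(\<Sum>l<m. cinner I (e l) v * cinner I (e k) (e l)) = (\<Sum>l<m. if l = k then cinner I (e k) v else 0)"
      using assms(2) that by (intro sum.cong refl) (auto simp: orthonormal_def)
    then show ?thesis
      using that by (simp add: cinner_diff_right cinner_sum_right cinner_scale_right)
  qed
  then show "k < m \<Longrightarrow> cinner I (e k) ?r = 0" .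
  have "cinner I ?r ?r = cinner I v ?r - (\<Sum>l<m. cnj (cinner I (e l) v) * cinner I (e l) ?r)"
    by (subst cinner_diff_left) (simp add: cinner_sum_left cinner_scale_left)
  also have "\<dots> = cinner I v ?r"
    using orth by simp
  also have "\<dots> = cinner I v v - (\<Sum>l<m. cinner I (e l) v * cinner I v (e l))"
    by (simp add: cinner_diff_right cinner_sum_right cinner_scale_right)
  also have "(\<Sum>l<m. cinner I (e l) v * cinner I v (e l)) = of_real (\<Sum>l<m. (cmod (cinner I (e l) v))\<^sup>2)"
    unfolding of_real_sum by (intro sum.cong refl) (metis cinner_cnj complex_norm_square)
  finally show "cinner I ?r ?r = cinner I v v - of_real (\<Sum>l<m. (cmod (cinner I (e l) v))\<^sup>2)" .
qed

lemma cinner_delta: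
  assumes "finite I" "i \<in> I"
  shows "cinner I v (\<lambda>j. if j = i then 1 else 0) = cnj (v i)"
    and "cinner I (\<lambda>j. if j = i then 1 else 0) v = v i"
proof -
  have "cinner I v (\<lambda>j. if j = i then 1 else 0) = (\<Sum>j\<in>I. if j = i then cnj (v j) else 0)"
    unfolding cinner_def by (intro sum.cong) auto
  then show "cinner I v (\<lambda>j. if j = i then 1 else 0) = cnj (v i)" using assms by simp
  then show "cinner I (\<lambda>j. if j = i then 1 else 0) v = v i"
    by (metis cinner_cnj complex_cnj_cnj)
qed

text \<open>The residual of the coordinate vector at \<open>i\<close> has squared length 1 minus the
  sum of |e_k(i)|^2. Its nonnegativity is the bound. If it is 0, the coordinate vector equals its
  projection, which is the completeness relation for the column \<open>i\<close>.\<close>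

lemma orthonormal_bessel:
  assumes "finite I" "orthonormal I m e" "i \<in> I"
  shows "(\<Sum>k<m. (cmod (e k i))\<^sup>2) \<le> 1"
    and "(\<Sum>k<m. (cmod (e k i))\<^sup>2) = 1 \<Longrightarrow> j \<in> I \<Longrightarrow> (\<Sum>k<m. e k j * cnj (e k i)) = (if i = j then 1 else 0)"
proof -
  define \<delta> :: "'a \<Rightarrow> complex" where "\<delta> = (\<lambda>j. if j = i then 1 else 0)"
  let ?r = "\<lambda>i. \<delta> i - (\<Sum>l<m. cinner I (e l) \<delta> * e l i)"
  have c: "cinner I v \<delta> = cnj (v i)" for v
    unfolding \<delta>_def by (rule cinner_delta[OF assms(1,3)])
  have eq: "cinner I ?r ?r = of_real (1 - (\<Sum>k<m. (cmod (e k i))\<^sup>2))"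
    using orthonormal_residual(2)[OF assms(1,2), of \<delta>]
    by (simp add: c) (simp add: \<delta>_def)
  then have "1 - (\<Sum>k<m. (cmod (e k i))\<^sup>2) = (\<Sum>i\<in>I. (cmod (?r i))\<^sup>2)"
    unfolding cinner_self of_real_eq_iff by simp
  also have "\<dots> \<ge> 0" by (simp add: sum_nonneg)
  finally show "(\<Sum>k<m. (cmod (e k i))\<^sup>2) \<le> 1" by simp
  show "(\<Sum>k<m. e k j * cnj (e k i)) = (if i = j then 1 else 0)"
    if "(\<Sum>k<m. (cmod (e k i))\<^sup>2) = 1" "j \<in> I"
  proof -
    have "?r j = 0"
      by (rule cinner_self_eq_0[where v = ?r, OF assms(1) _ that(2)]) (use eq that in simp)
    then have "(\<Sum>k<m. e k j * cnj (e k i)) = \<delta> j" by (simp add: c mult.commute)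
    then show ?thesis by (auto simp: \<delta>_def)
  qed
qed

lemma orthonormal_sum:
  assumes "finite I" "orthonormal I m e"
  shows "(\<Sum>i\<in>I. \<Sum>k<m. (cmod (e k i))\<^sup>2) = real m"
proof -
  have "(\<Sum>i\<in>I. (cmod (e k i))\<^sup>2) = 1" if "k < m" for k
    using assms(2) that cinner_self[of I "e k"] unfolding orthonormal_def
    by (metis of_real_eq_1_iff)
  then show ?thesis by (subst sum.swap) simp
qed

text \<open>A dimension count: each of the \<open>card I\<close> defects in Bessel's inequality is
  nonnegative and their sum is \<open>card I - card I\<close>, so all of them vanish and the
  equality case applies.\<close>

lemma orthonormal_complete:
  assumes "finite I" "orthonormal I (card I) e" "i \<in> I" "j \<in> I"
  shows "(\<Sum>k<card I. e k i * cnj (e k j)) = (if i = j then 1 else 0)"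
proof -
  let ?f = "\<lambda>i. 1 - (\<Sum>k<card I. (cmod (e k i))\<^sup>2)"
  have "(\<Sum>i\<in>I. ?f i) = 0"
    using orthonormal_sum[OF assms(1,2)] by (simp add: sum_subtractf)
  then have "?f j = 0"
    using orthonormal_bessel(1)[OF assms(1,2)] assms(1,4) by (subst (asm) sum_nonneg_eq_0_iff) auto
  then show ?thesis using orthonormal_bessel(2)[OF assms(1,2,4) _ assms(3)] by auto
qed

text \<open>With m < \<open>card I\<close> the Bessel defects have the positive sum
  \<open>card I - m\<close>, so some coordinate vector has a nonzero residual, and this residual is
  normalised.\<close>

lemma orthonormal_extend:
  assumes "finite I" "orthonormal I m e" "m < card I"
  shows "\<exists>v. cinner I v v = 1 \<and> (\<forall>k<m. cinner I (e k) v = 0) \<and> (\<forall>i. i \<notin> I \<longrightarrow> v i = 0)"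
proof -
  have "\<exists>i\<in>I. (\<Sum>k<m. (cmod (e k i))\<^sup>2) < 1"
  proof (rule ccontr)
    assume "\<not> ?thesis"
    then have "(\<Sum>i\<in>I. 1) \<le> (\<Sum>i\<in>I. \<Sum>k<m. (cmod (e k i))\<^sup>2)" by (intro sum_mono) auto
    then show False using orthonormal_sum[OF assms(1,2)] assms(3) by simp
  qed
  then obtain i where i: "i \<in> I" "(\<Sum>k<m. (cmod (e k i))\<^sup>2) < 1" by auto
  define \<delta> :: "'a \<Rightarrow> complex" where "\<delta> = (\<lambda>j. if j = i then 1 else 0)"
  define r where "r = (\<lambda>i. \<delta> i - (\<Sum>l<m. cinner I (e l) \<delta> * e l i))"
  define s where "s = 1 - (\<Sum>k<m. (cmod (e k i))\<^sup>2)"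
  have c: "cinner I v \<delta> = cnj (v i)" for v
    unfolding \<delta>_def by (rule cinner_delta[OF assms(1) i(1)])
  have rr: "cinner I r r = of_real s"
    using orthonormal_residual(2)[OF assms(1,2), of \<delta>]
    unfolding r_def s_def by (simp add: c) (simp add: \<delta>_def)
  have s: "s > 0" using i by (simp add: s_def)
  \<comment> \<open>Cutting off outside \<open>I\<close> puts the vector into the compact box of
    \<open>eigenvector_step\<close>; inner products over \<open>I\<close> do not see the
    change.\<close>
  define v where "v = (\<lambda>j. if j \<in> I then of_real (1 / sqrt s) * r j else 0)"
  have vI: "cinner I w v = cinner I w (\<lambda>j. of_real (1 / sqrt s) * r j)"
    "cinner I v w = cinner I (\<lambda>j. of_real (1 / sqrt s) * r j) w" for w
    unfolding cinner_def v_def by (auto intro!: sum.cong)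
  have "cinner I v v = of_real (1 / sqrt s * (1 / sqrt s) * s)"
    unfolding vI cinner_scale_right cinner_scale_left rr of_real_mult complex_cnj_complex_of_real
    by (simp only: mult.assoc)
  also have "1 / sqrt s * (1 / sqrt s) * s = 1" using s by (simp add: field_simps)
  also have "complex_of_real 1 = 1" by simp
  finally have "cinner I v v = 1" .
  moreover have "cinner I (e k) v = 0" if "k < m" for k
    unfolding vI cinner_scale_right using orthonormal_residual(1)[OF assms(1,2) that, of \<delta>]
    by (simp add: r_def)
  moreover have "\<forall>i. i \<notin> I \<longrightarrow> v i = 0" by (simp add: v_def)
  ultimately show ?thesis by blast
qed

section \<open>Compactness of the unit sphere and the spectral theorem\<close>

lemma compact_function_box:
  assumes "\<And>i. compact (S i)"
  shows "compact {v :: 'a \<Rightarrow> 'b::topological_space. \<forall>i. v i \<in> S i}"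
proof -
  \<comment> \<open>Tychonoff. Vectors are functions on the whole index type; the choice
    \<open>{0}\<close> for every coordinate outside the finite index set makes the unit sphere a
    closed subset of such a box.\<close>
  have "compactin (product_topology (\<lambda>i. euclidean) (UNIV :: 'a set)) (PiE UNIV S)"
    using assms by (subst compactin_PiE) auto
  then have "compact (PiE UNIV S)"
    by (simp add: euclidean_product_topology flip: compactin_euclidean_iff)
  moreover have "PiE UNIV S = {v. \<forall>i. v i \<in> S i}" by (auto simp: PiE_def)
  ultimately show ?thesis by simp
qed

lemma continuous_on_coord:
  "continuous_on S f \<Longrightarrow> continuous_on S (\<lambda>x. f x i)"
  by (rule continuous_on_product_then_coordinatewise)

lemma continuous_on_cinner [continuous_intros]:
  assumes f: "continuous_on S f" and g: "continuous_on S g"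
  shows "continuous_on S (\<lambda>x. cinner I (f x) (g x))"
  unfolding cinner_def
  by (intro continuous_on_sum continuous_on_mult continuous_on_cnj continuous_on_coord[OF f] continuous_on_coord[OF g])

lemma continuous_on_qform [continuous_intros]:
  assumes f: "continuous_on S f" and g: "continuous_on S g"
  shows "continuous_on S (\<lambda>x. qform I (f x) (g x))"
  unfolding qform_def
  by (intro continuous_on_sum continuous_on_mult continuous_on_cnj
      continuous_on_coord[OF continuous_on_coord[OF f]] continuous_on_coord[OF g])

text \<open>Homogeneity of degree two. The hypothesis concerns real multiples of \<open>v\<close>
  alone, so a bound known only on a subspace through \<open>v\<close>, such as an orthogonal
  complement, can be used.\<close>

lemma qform_le_cinner:
  assumes fin: "finite I" and b: "\<And>c. cinner I (\<lambda>i. of_real c * v i) (\<lambda>i. of_real c * v i) = 1 \<Longrightarrow>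
      Re (qform I X (\<lambda>i. of_real c * v i)) \<le> M"
  shows "Re (qform I X v) \<le> M * Re (cinner I v v)"
proof (cases "cinner I v v = 0")
  case True
  have "v i = 0" if "i \<in> I" for i by (rule cinner_self_eq_0[OF fin True that])
  then have "qform I X v = 0" by (simp add: qform_def)
  then show ?thesis using True by simp
next
  case False
  define s where "s = (\<Sum>i\<in>I. (cmod (v i))\<^sup>2)"
  have vs: "cinner I v v = of_real s" by (simp add: cinner_self s_def)
  have "s \<noteq> 0" using False unfolding vs by simp
  then have s: "s > 0" using sum_nonneg[of I "\<lambda>i. (cmod (v i))\<^sup>2"] by (simp add: s_def)
  define c where "c = 1 / sqrt s"
  have cc: "c * c * s = 1" using s by (simp add: c_def)
  have "cinner I (\<lambda>i. of_real c * v i) (\<lambda>i. of_real c * v i) = of_real (c * c * s)"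
    unfolding cinner_scale_left cinner_scale_right vs by simp
  then have "Re (qform I X (\<lambda>i. of_real c * v i)) \<le> M" unfolding cc by (intro b) simp
  moreover have "qform I X (\<lambda>i. of_real c * v i) = of_real (c * c) * qform I X v"
    unfolding qform_def sum_distrib_left by (intro sum.cong refl) simp
  moreover have "c * c = 1 / s" using cc s by (simp add: field_simps)
  ultimately have "Re (qform I X v) / s \<le> M" by simp
  then show ?thesis using s vs by (simp add: field_simps)
qed

text \<open>A maximiser of the quadratic form on the unit sphere of the orthogonal complement is an eigenvector.\<close>

lemma eigenvector_step:
  assumes fin: "finite I" and herm: "hermitian_on I X" and on: "orthonormal I m e" and m: "m < card I"
    and eig: "\<And>k i. k < m \<Longrightarrow> i \<in> I \<Longrightarrow> mvec I X (e k) i = of_real (lam k) * e k i"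
  shows "\<exists>v \<mu>. cinner I v v = 1 \<and> (\<forall>k<m. cinner I (e k) v = 0) \<and>
           (\<forall>i\<in>I. mvec I X v i = complex_of_real \<mu> * v i)"
proof -
  define S where "S = {v. \<forall>i. v i \<in> (if i \<in> I then cball 0 1 else {0 :: complex})} \<inter>
     ({v. cinner I v v = 1} \<inter> (\<Inter>k\<in>{..<m}. {v. cinner I (e k) v = 0}))"
  have "closed ({v. cinner I v v = 1} \<inter> (\<Inter>k\<in>{..<m}. {v. cinner I (e k) v = 0}))"
    by (intro closed_Int closed_INT ballI closed_Collect_eq continuous_intros)
  then have compS: "compact S"
    unfolding S_def by (intro compact_Int_closed compact_function_box) auto
  obtain v0 where v0: "cinner I v0 v0 = 1" "\<forall>k<m. cinner I (e k) v0 = 0" "\<forall>i. i \<notin> I \<longrightarrow> v0 i = 0"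
    using orthonormal_extend[OF fin on m] by blast
  have inS: "v \<in> S" if "cinner I v v = 1" "\<forall>k<m. cinner I (e k) v = 0" "\<forall>i. i \<notin> I \<longrightarrow> v i = 0" for v
  proof -
    have "(\<Sum>i\<in>I. (cmod (v i))\<^sup>2) = 1" using that(1) unfolding cinner_self by (metis of_real_eq_1_iff)
    then have "(cmod (v i))\<^sup>2 \<le> 1" if "i \<in> I" for i
      using member_le_sum[of i I "\<lambda>i. (cmod (v i))\<^sup>2"] that fin by auto
    then have "cmod (v i) \<le> 1" if "i \<in> I" for i
      using that by (simp add: abs_square_le_1)
    with that show ?thesis by (auto simp: S_def)
  qed
  have "S \<noteq> {}" using inS v0 by blast
  moreover have "continuous_on S (\<lambda>v. Re (qform I X v))" by (intro continuous_intros)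
  ultimately obtain v where v: "v \<in> S" and vmax: "\<And>w. w \<in> S \<Longrightarrow> Re (qform I X w) \<le> Re (qform I X v)"
    using continuous_attains_sup[OF compS] by metis
  define \<mu> where "\<mu> = Re (qform I X v)"
  have vv: "cinner I v v = 1" and ve: "\<And>k. k < m \<Longrightarrow> cinner I (e k) v = 0" using v by (auto simp: S_def)
  have qv: "qform I X v = of_real \<mu>"
    using qform_hermitian_real[OF herm, of v] by (simp add: \<mu>_def)
  have bound: "Re (qform I X w) \<le> \<mu> * Re (cinner I w w)" if w: "\<And>k. k < m \<Longrightarrow> cinner I (e k) w = 0" for w
  proof (rule qform_le_cinner[OF fin])
    fix c :: real
    let ?w = "\<lambda>i. of_real c * w i"
    let ?u = "\<lambda>i. if i \<in> I then ?w i else 0"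
    have u: "cinner I z ?u = cinner I z ?w" "cinner I ?u z = cinner I ?w z" for z
      unfolding cinner_def by (auto intro!: sum.cong)
    assume "cinner I ?w ?w = 1"
    then have "?u \<in> S" using w by (intro inS) (simp_all add: u, simp_all add: cinner_scale_right)
    then have "Re (qform I X ?u) \<le> \<mu>" using vmax \<mu>_def by auto
    moreover have "qform I X ?u = qform I X ?w" unfolding qform_def by (intro sum.cong refl) simp
    ultimately show "Re (qform I X ?w) \<le> \<mu>" by simp
  qed
  \<comment> \<open>\<open>w\<close> is the vector that has to vanish for \<open>v\<close> to be an
    eigenvector. It is orthogonal to \<open>v\<close> and to every earlier \<open>e k\<close>, so
    each v + t w is an admissible competitor for the maximum.\<close>
  define w where "w = (\<lambda>i. mvec I X v i - of_real \<mu> * v i)"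
  have we: "cinner I (e k) w = 0" if k: "k < m" for k
  proof -
    have "cinner I (e k) (mvec I X v) = cinner I (mvec I X (e k)) v"
      by (simp add: mvec_selfadjoint[OF herm])
    also have "\<dots> = cinner I (\<lambda>i. of_real (lam k) * e k i) v"
      unfolding cinner_def using eig k by (auto intro!: sum.cong)
    finally show ?thesis using ve[OF k] by (simp add: w_def cinner_diff_right cinner_scale_right cinner_scale_left)
  qed
  have vw: "cinner I v w = 0"
    using qv vv by (simp add: w_def cinner_diff_right cinner_scale_right qform_eq_cinner)
  then have wv: "cinner I w v = 0" by (metis cinner_cnj complex_cnj_zero)
  have Xvw: "cinner I w (mvec I X v) = cinner I w w"
    using wv by (simp add: w_def cinner_diff_right cinner_scale_right)
  define N where "N = Re (cinner I w w)"
  define Q where "Q = Re (qform I X w)"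
  have N0: "N \<ge> 0" unfolding N_def cinner_self by (simp add: sum_nonneg)
  \<comment> \<open>The form at v + t w gains 2 t N to first order in \<open>t\<close>, while the
    remaining terms are quadratic; for small positive \<open>t\<close> this is compatible with
    maximality only if N = 0.\<close>
  have key: "2 * t * N + t\<^sup>2 * Q \<le> \<mu> * t\<^sup>2 * N" for t :: real
  proof -
    let ?z = "\<lambda>i. v i + of_real t * w i"
    have "Re (qform I X ?z) \<le> \<mu> * Re (cinner I ?z ?z)"
      using ve we by (intro bound) (simp add: cinner_add_right cinner_scale_right)
    moreover have mv: "mvec I X ?z = (\<lambda>i. mvec I X v i + of_real t * mvec I X w i)"
      by (simp add: mvec_def algebra_simps sum.distrib sum_distrib_left)
    have vXw: "cinner I v (mvec I X w) = cinner I w w"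
      by (metis Xvw cinner_cnj mvec_selfadjoint[OF herm])
    have "qform I X ?z = qform I X v + 2 * of_real t * cinner I w w + of_real (t\<^sup>2) * qform I X w"
      unfolding qform_eq_cinner mv
      by (simp add: cinner_add_right cinner_scale_right cinner_add_left cinner_scale_left vXw Xvw power2_eq_square algebra_simps)
    then have "Re (qform I X ?z) = \<mu> + 2 * t * N + t\<^sup>2 * Q"
      unfolding N_def Q_def qv by simp
    moreover have "cinner I ?z ?z = 1 + of_real (t\<^sup>2) * cinner I w w"
      by (simp add: cinner_add_right cinner_scale_right cinner_add_left cinner_scale_left vv vw wv power2_eq_square algebra_simps)
    then have "Re (cinner I ?z ?z) = 1 + t\<^sup>2 * N" unfolding N_def by simp
    ultimately show ?thesis by (simp add: algebra_simps)
  qed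
  have "N = 0"
  proof (rule ccontr)
    assume "N \<noteq> 0"
    then have N: "N > 0" using N0 by simp
    \<comment> \<open>\<open>C\<close> dominates the quadratic coefficient, and the summand 1 keeps
      it positive. With t = N / C the inequality becomes 2 N \<le> N.\<close>
    define C where "C = \<bar>\<mu> * N - Q\<bar> + 1"
    have C: "C > 0" by (simp add: C_def)
    define t where "t = N / C"
    have t: "t > 0" using N C by (simp add: t_def)
    have "t * (2 * N) \<le> t * (t * (\<mu> * N - Q))" using key[of t] by (simp add: power2_eq_square algebra_simps)
    then have "2 * N \<le> t * (\<mu> * N - Q)" using t by simp
    also have "\<dots> \<le> t * C" using t by (intro mult_left_mono) (auto simp: C_def)
    also have "\<dots> = N" using C by (simp add: t_def)
    finally show False using N by simp
  qed
  then have "cinner I w w = 0" unfolding N_def cinner_self by simp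
  then have "\<forall>i\<in>I. w i = 0" using cinner_self_eq_0[OF fin] by blast
  then show ?thesis using vv ve by (intro exI[of _ v] exI[of _ \<mu>]) (auto simp: w_def)
qed

definition spectral :: "'a set \<Rightarrow> 'a cmat \<Rightarrow> (nat \<Rightarrow> 'a \<Rightarrow> complex) \<Rightarrow> (nat \<Rightarrow> real) \<Rightarrow> bool" where
  "spectral I X e lam \<longleftrightarrow> orthonormal I (card I) e \<and>
     (\<forall>i\<in>I. \<forall>j\<in>I. X i j = (\<Sum>k<card I. of_real (lam k) * e k i * cnj (e k j)))"

lemma orthonormal_mat_expansion:
  assumes fin: "finite I" and e: "orthonormal I (card I) e" and ij: "i \<in> I" "j \<in> I"
  shows "X i j = (\<Sum>k<card I. mvec I X (e k) i * cnj (e k j))"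
proof -
  have "X i j = (\<Sum>l\<in>I. if l = j then X i l else 0)" using ij fin by simp
  also have "\<dots> = (\<Sum>l\<in>I. X i l * (\<Sum>k<card I. e k l * cnj (e k j)))"
    using orthonormal_complete[OF fin e _ ij(2)] by (intro sum.cong) auto
  also have "\<dots> = (\<Sum>k<card I. mvec I X (e k) i * cnj (e k j))"
    unfolding mvec_def sum_distrib_left sum_distrib_right mult.assoc by (rule sum.swap)
  finally show ?thesis .
qed

text \<open>Eigenvectors are split off one at a time. Once there are \<open>card I\<close> of them,
  the expansion of \<open>X\<close> in this basis combined with the eigenvalue equations is the
  decomposition.\<close>

lemma spectral_exists:
  assumes fin: "finite I" and herm: "hermitian_on I X"
  shows "\<exists>e lam. spectral I X e lam"
proof -
  have "\<exists>e lam. orthonormal I m e \<and> (\<forall>k<m. \<forall>i\<in>I. mvec I X (e k) i = of_real (lam k) * e k i)"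
    if "m \<le> card I" for m
    using that
  proof (induction m)
    case 0
    then show ?case by (simp add: orthonormal_def)
  next
    case (Suc m)
    then obtain e lam where e: "orthonormal I m e"
      and eig: "\<And>k i. k < m \<Longrightarrow> i \<in> I \<Longrightarrow> mvec I X (e k) i = of_real (lam k) * e k i"
      by auto
    obtain v \<mu> where v: "cinner I v v = 1" "\<forall>k<m. cinner I (e k) v = 0"
      "\<forall>i\<in>I. mvec I X v i = complex_of_real \<mu> * v i"
      using eigenvector_step[OF fin herm e _ eig] Suc.prems by auto
    have v': "\<forall>k<m. cinner I v (e k) = 0" using v(2) by (metis cinner_cnj complex_cnj_zero)
    have "orthonormal I (Suc m) (e(m := v))"
      using e v v' unfolding orthonormal_def by (auto simp: less_Suc_eq)
    moreover have "\<forall>k<Suc m. \<forall>i\<in>I. mvec I X ((e(m := v)) k) i = of_real ((lam(m := \<mu>)) k) * (e(m := v)) k i"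
      using v eig by (auto simp: less_Suc_eq)
    ultimately show ?case by blast
  qed
  from this[of "card I"] obtain e lam where e: "orthonormal I (card I) e"
    and eig: "\<And>k i. k < card I \<Longrightarrow> i \<in> I \<Longrightarrow> mvec I X (e k) i = of_real (lam k) * e k i"
    by auto
  have "X i j = (\<Sum>k<card I. of_real (lam k) * e k i * cnj (e k j))" if "i \<in> I" "j \<in> I" for i j
    using orthonormal_mat_expansion[OF fin e that, of X] eig that by simp
  then show ?thesis using e unfolding spectral_def by blast
qed

lemma spectral_complete:
  assumes "finite I" "orthonormal I (card I) e" "i \<in> I"
  shows "v i = (\<Sum>k<card I. cinner I (e k) v * e k i)"
proof -
  have "(\<Sum>k<card I. cinner I (e k) v * e k i) = (\<Sum>j\<in>I. (\<Sum>k<card I. e k i * cnj (e k j)) * v j)"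
    unfolding cinner_def sum_distrib_right by (subst sum.swap) (simp add: mult.commute mult.left_commute)
  also have "\<dots> = (\<Sum>j\<in>I. if i = j then v j else 0)"
    using orthonormal_complete[OF assms] by (intro sum.cong refl) simp
  finally show ?thesis using assms by simp
qed

section \<open>Functional calculus in a fixed eigenbasis and the unique positive square root\<close>

definition smat :: "'a set \<Rightarrow> (nat \<Rightarrow> 'a \<Rightarrow> complex) \<Rightarrow> (nat \<Rightarrow> real) \<Rightarrow> 'a cmat" where
  "smat I e f = (\<lambda>i j. if i \<in> I \<and> j \<in> I then \<Sum>k<card I. of_real (f k) * e k i * cnj (e k j) else 0)"

lemma spectral_smat: "X \<in> ops_on I \<Longrightarrow> spectral I X e lam \<Longrightarrow> X = smat I e lam"
  unfolding spectral_def smat_def ops_on_def by (auto intro!: ext)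

lemma mtrace_mmul: "mtrace I (mmul I X W) = (\<Sum>i\<in>I. \<Sum>j\<in>I. X i j * W j i)"
  by (simp add: mtrace_def mmul_def)

lemma mtrace_mmul_commute: "mtrace I (mmul I X W) = mtrace I (mmul I W X)"
  unfolding mtrace_mmul by (subst sum.swap) (simp add: mult.commute)

lemma mtrace_smat:
  assumes "finite I"
  shows "mtrace I (mmul I (smat I e f) W) = (\<Sum>k<card I. of_real (f k) * qform I W (e k))"
proof -
  have "mtrace I (mmul I (smat I e f) W) =
      (\<Sum>i\<in>I. \<Sum>j\<in>I. \<Sum>k<card I. of_real (f k) * (e k i * cnj (e k j) * W j i))"
    by (simp add: mtrace_mmul smat_def sum_distrib_right mult.assoc)
  also have "\<dots> = (\<Sum>k<card I. \<Sum>j\<in>I. \<Sum>i\<in>I. of_real (f k) * (e k i * cnj (e k j) * W j i))"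
    by (subst sum.swap) (simp only: sum.swap[of _ "{..<card I}" I])
  also have "\<dots> = (\<Sum>k<card I. of_real (f k) * qform I W (e k))"
    unfolding qform_def sum_distrib_left by (intro sum.cong refl) simp
  finally show ?thesis .
qed

lemma mvec_smat:
  assumes "i \<in> I"
  shows "mvec I (smat I e f) v i = (\<Sum>k<card I. of_real (f k) * cinner I (e k) v * e k i)"
  unfolding mvec_def cinner_def sum_distrib_left sum_distrib_right
  by (subst sum.swap) (use assms in \<open>simp add: smat_def sum_distrib_left sum_distrib_right algebra_simps\<close>)

lemma cinner_cong: "(\<And>i. i \<in> I \<Longrightarrow> v i = v' i) \<Longrightarrow> (\<And>i. i \<in> I \<Longrightarrow> w i = w' i) \<Longrightarrow> cinner I v w = cinner I v' w'"
  unfolding cinner_def by (intro sum.cong) auto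

lemma qform_smat:
  "qform I (smat I e f) v = of_real (\<Sum>k<card I. f k * (cmod (cinner I (e k) v))\<^sup>2)"
proof -
  have "qform I (smat I e f) v = cinner I v (\<lambda>i. \<Sum>k<card I. (of_real (f k) * cinner I (e k) v) * e k i)"
    unfolding qform_eq_cinner by (intro cinner_cong refl) (simp add: mvec_smat)
  also have "\<dots> = (\<Sum>k<card I. of_real (f k) * (cinner I (e k) v * cnj (cinner I (e k) v)))"
    by (simp add: cinner_sum_right cinner_scale_right cinner_cnj mult.assoc)
  also have "\<dots> = of_real (\<Sum>k<card I. f k * (cmod (cinner I (e k) v))\<^sup>2)"
    unfolding of_real_sum of_real_mult complex_norm_square ..
  finally show ?thesis .
qed

lemma psd_on_iff: "psd_on I X \<longleftrightarrow> X \<in> ops_on I \<and> (\<forall>v. qform I X v \<in> \<real> \<and> 0 \<le> Re (qform I X v))"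
  by (simp add: psd_on_def qform_def)

lemma psd_smat: "(\<And>k. k < card I \<Longrightarrow> 0 \<le> f k) \<Longrightarrow> psd_on I (smat I e f)"
  unfolding psd_on_iff qform_smat by (auto simp: ops_on_def smat_def intro!: sum_nonneg)

lemma hermitian_smat: "hermitian_on I (smat I e f)"
  unfolding hermitian_on_def ops_on_def madj_def smat_def by (auto simp: algebra_simps intro!: ext)

lemma mvec_mmul: "i \<in> I \<Longrightarrow> mvec I (mmul I A B) v i = mvec I A (mvec I B v) i"
  unfolding mvec_def mmul_def sum_distrib_left
  by (simp add: sum_distrib_right sum_distrib_left mult.assoc) (rule sum.swap)

lemma mvec_cong: "(\<And>i. i \<in> I \<Longrightarrow> v i = w i) \<Longrightarrow> mvec I X v = mvec I X w"
  unfolding mvec_def by (intro ext sum.cong) auto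

lemma mvec_scale: "mvec I X (\<lambda>i. c * v i) = (\<lambda>i. c * mvec I X v i)"
  unfolding mvec_def sum_distrib_left by (simp add: mult.left_commute)

lemma mvec_smat_eigen:
  assumes "orthonormal I (card I) e" "k < card I" "i \<in> I"
  shows "mvec I (smat I e f) (e k) i = of_real (f k) * e k i"
proof -
  have "mvec I (smat I e f) (e k) i = (\<Sum>l<card I. if l = k then of_real (f k) * e k i else 0)"
    unfolding mvec_smat[OF assms(3)] using assms by (intro sum.cong) (auto simp: orthonormal_def)
  then show ?thesis using assms(2) by simp
qed

lemma mmul_smat:
  assumes "finite I" "orthonormal I (card I) e"
  shows "mmul I (smat I e f) (smat I e g) = smat I e (\<lambda>k. f k * g k)"
proof (intro ext)
  fix i j
  show "mmul I (smat I e f) (smat I e g) i j = smat I e (\<lambda>k. f k * g k) i j"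
  proof (cases "i \<in> I \<and> j \<in> I")
    case True
    have "mmul I (smat I e f) (smat I e g) i j = (\<Sum>l\<in>I. smat I e f i l * (\<Sum>k<card I. of_real (g k) * e k l * cnj (e k j)))"
      using True by (simp add: mmul_def smat_def[of I e g])
    also have "\<dots> = (\<Sum>k<card I. of_real (g k) * mvec I (smat I e f) (e k) i * cnj (e k j))"
      unfolding mvec_def sum_distrib_left sum_distrib_right
      by (subst sum.swap) (simp add: mult.assoc mult.left_commute)
    also have "\<dots> = smat I e (\<lambda>k. f k * g k) i j"
      using True by (simp add: smat_def[of I e "\<lambda>k. f k * g k"] mvec_smat_eigen[OF assms(2)] mult.assoc mult.left_commute)
    finally show ?thesis .
  qed (auto simp: mmul_def smat_def)
qed

text \<open>Polarisation: the form is real at \<delta>_i + c \<delta>_j. The choice c = 0 makes the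
  diagonal real, c = 1 relates the imaginary parts of the entries (i, j) and (j, i), and c = \<i>
  relates their real parts.\<close>

lemma psd_on_imp_hermitian:
  assumes "finite I" "psd_on I X"
  shows "hermitian_on I X"
proof -
  define \<delta> :: "'a \<Rightarrow> 'a \<Rightarrow> complex" where "\<delta> = (\<lambda>i j. if j = i then 1 else 0)"
  have X: "X \<in> ops_on I" and re: "\<And>v. qform I X v \<in> \<real>"
    using assms(2) by (auto simp: psd_on_iff)
  have mv: "mvec I X (\<delta> j) i = X i j" if "j \<in> I" for i j
  proof -
    have "mvec I X (\<delta> j) i = (\<Sum>k\<in>I. if k = j then X i k else 0)"
      unfolding mvec_def \<delta>_def by (intro sum.cong) auto
    then show ?thesis using that assms(1) by simp
  qed
  have cd: "cinner I (\<delta> i) v = v i" if "i \<in> I" for i v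
    unfolding \<delta>_def by (rule cinner_delta(2)[OF assms(1) that])
  have q: "qform I X (\<lambda>k. \<delta> i k + c * \<delta> j k) = X i i + c * X i j + cnj c * X j i + cnj c * (c * X j j)"
    if "i \<in> I" "j \<in> I" for i j c
  proof -
    have "mvec I X (\<lambda>k. \<delta> i k + c * \<delta> j k) = (\<lambda>k. mvec I X (\<delta> i) k + c * mvec I X (\<delta> j) k)"
      by (simp add: mvec_def algebra_simps sum.distrib sum_distrib_left)
    then show ?thesis using that
      by (simp add: qform_eq_cinner cinner_add_left cinner_add_right cinner_scale_left cinner_scale_right cd mv algebra_simps)
  qed
  have "cnj (X j i) = X i j" for i j
  proof (cases "i \<in> I \<and> j \<in> I")
    case True
    then have ij: "i \<in> I" "j \<in> I" by auto
    have d: "Im (X k k) = 0" if "k \<in> I" for k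
      using re[of "\<lambda>l. \<delta> k l + 0 * \<delta> k l"] that by (subst (asm) q) (auto simp: complex_is_Real_iff)
    have "Im (X i j) + Im (X j i) = 0"
      using re[of "\<lambda>k. \<delta> i k + 1 * \<delta> j k"] d ij by (subst (asm) q) (auto simp: complex_is_Real_iff)
    moreover have "Re (X i j) - Re (X j i) = 0"
      using re[of "\<lambda>k. \<delta> i k + \<i> * \<delta> j k"] d ij by (subst (asm) q) (auto simp: complex_is_Real_iff)
    ultimately show ?thesis by (simp add: complex_eq_iff)
  qed (use X in \<open>auto simp: ops_on_def\<close>)
  then show ?thesis using X by (auto simp: hermitian_on_def madj_def intro!: ext)
qed

lemma cinner_basis_eq_0:
  assumes "finite I" "orthonormal I (card I) e" "\<And>k. k < card I \<Longrightarrow> cinner I (e k) v = 0" "i \<in> I"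
  shows "v i = 0"
  using spectral_complete[OF assms(1,2,4), of v] assms(3) by simp

lemma qform_eigen:
  assumes "orthonormal I (card I) e" "k < card I"
  shows "qform I (smat I e f) (e k) = of_real (f k)"
proof -
  have "(\<Sum>l<card I. f l * (cmod (cinner I (e l) (e k)))\<^sup>2) = (\<Sum>l<card I. if l = k then f l else 0)"
    using assms by (intro sum.cong refl) (auto simp: orthonormal_def)
  then show ?thesis using assms by (simp add: qform_smat)
qed

text \<open>Let e_k, s_k diagonalise \<open>S\<close> and f_l, t_l diagonalise \<open>T\<close>.
  Evaluating the common square between e_k and f_l gives s_k^2 <e_k, f_l> = t_l^2 <e_k, f_l>. By
  nonnegativity s_k = t_l whenever the overlap is nonzero, hence S f_l = t_l f_l = T f_l for every
  l.\<close>

lemma psd_sqrt_unique: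
  assumes fin: "finite I" and S: "psd_on I S" and T: "psd_on I T" and eq: "mmul I S S = mmul I T T"
  shows "S = T"
proof -
  obtain e s where es: "spectral I S e s" using spectral_exists[OF fin psd_on_imp_hermitian[OF fin S]] by blast
  obtain f t where ft: "spectral I T f t" using spectral_exists[OF fin psd_on_imp_hermitian[OF fin T]] by blast
  have e: "orthonormal I (card I) e" and f: "orthonormal I (card I) f"
    using es ft by (auto simp: spectral_def)
  have Sm: "S = smat I e s" and Tm: "T = smat I f t"
    using spectral_smat es ft S T by (auto simp: psd_on_def)
  have s0: "s k \<ge> 0" if "k < card I" for k
    using S qform_eigen[OF e that, of s] unfolding psd_on_iff Sm by (metis Re_complex_of_real)
  have t0: "t k \<ge> 0" if "k < card I" for k
    using T qform_eigen[OF f that, of t] unfolding psd_on_iff Tm by (metis Re_complex_of_real)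
  have Sherm: "hermitian_on I S" unfolding Sm by (rule hermitian_smat)
  have eS: "cinner I (e k) (mvec I S v) = of_real (s k) * cinner I (e k) v" if "k < card I" for k v
  proof -
    have "cinner I (e k) (mvec I S v) = cinner I (mvec I S (e k)) v"
      by (simp add: mvec_selfadjoint[OF Sherm])
    also have "\<dots> = cinner I (\<lambda>i. of_real (s k) * e k i) v"
      unfolding Sm by (intro cinner_cong refl) (simp add: mvec_smat_eigen[OF e that])
    finally show ?thesis by (simp add: cinner_scale_left)
  qed
  have Tf: "mvec I T (f l) i = of_real (t l) * f l i" if "l < card I" "i \<in> I" for l i
    unfolding Tm by (rule mvec_smat_eigen[OF f that])
  have Sf: "mvec I S (f l) i = mvec I T (f l) i" if l: "l < card I" and i: "i \<in> I" for l i
  proof -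
    have "cinner I (e k) (\<lambda>i. mvec I S (f l) i - of_real (t l) * f l i) = 0" if k: "k < card I" for k
    proof -
      have "cinner I (e k) (mvec I (mmul I S S) (f l)) = cinner I (e k) (mvec I S (mvec I S (f l)))"
        by (intro cinner_cong refl) (simp add: mvec_mmul)
      also have "\<dots> = of_real (s k * s k) * cinner I (e k) (f l)"
        by (simp add: eS[OF k])
      finally have 1: "cinner I (e k) (mvec I (mmul I S S) (f l)) = of_real (s k * s k) * cinner I (e k) (f l)" .
      have "cinner I (e k) (mvec I (mmul I T T) (f l)) = cinner I (e k) (mvec I T (mvec I T (f l)))"
        by (intro cinner_cong refl) (simp add: mvec_mmul)
      also have "mvec I T (mvec I T (f l)) = mvec I T (\<lambda>i. of_real (t l) * f l i)"
        by (intro mvec_cong) (simp add: Tf[OF l])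
      also have "cinner I (e k) \<dots> = cinner I (e k) (\<lambda>i. of_real (t l) * (of_real (t l) * f l i))"
        unfolding mvec_scale by (intro cinner_cong refl) (simp add: Tf[OF l])
      finally have "of_real (s k * s k) * cinner I (e k) (f l) = of_real (t l * t l) * cinner I (e k) (f l)"
        using 1 unfolding eq by (simp add: cinner_scale_right)
      then have "cinner I (e k) (f l) = 0 \<or> s k * s k = t l * t l"
        by (metis mult_right_cancel of_real_eq_iff)
      then have "cinner I (e k) (f l) = 0 \<or> s k = t l"
        using s0[OF k] t0[OF l] by (auto simp: power2_eq_iff_nonneg simp flip: power2_eq_square)
      then show ?thesis
        by (auto simp: cinner_diff_right cinner_scale_right eS[OF k])
    qed
    from cinner_basis_eq_0[where v = "\<lambda>i. mvec I S (f l) i - of_real (t l) * f l i", OF fin e this i]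
    show ?thesis using Tf[OF l i] by simp
  qed
  show "S = T"
  proof (intro ext)
    fix i j
    show "S i j = T i j"
    proof (cases "i \<in> I \<and> j \<in> I")
      case True
      then show ?thesis using Sf by (simp add: orthonormal_mat_expansion[OF fin f, of i j])
    next
      case False
      then show ?thesis using S T by (auto simp: psd_on_def ops_on_def)
    qed
  qed
qed

section \<open>The trace norm: eigenvalue formula, duality, triangle inequality\<close>

lemma mtrace_smat_id:
  assumes "finite I" "orthonormal I (card I) e"
  shows "mtrace I (smat I e f) = of_real (\<Sum>k<card I. f k)"
proof -
  have "mtrace I (smat I e f) = (\<Sum>i\<in>I. \<Sum>k<card I. of_real (f k) * (cnj (e k i) * e k i))"
    by (simp add: mtrace_def smat_def algebra_simps)
  also have "\<dots> = (\<Sum>k<card I. of_real (f k) * cinner I (e k) (e k))"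
    unfolding cinner_def sum_distrib_left by (rule sum.swap)
  finally show ?thesis using assms(2) by (simp add: orthonormal_def)
qed

text \<open>The moduli of the eigenvalues in the same basis define a positive square root of X X^*;
  uniqueness identifies it with the definite description inside \<open>trace_norm\<close>.\<close>

lemma trace_norm_spectral:
  assumes fin: "finite I" and X: "hermitian_on I X" and sp: "spectral I X e lam"
  shows "trace_norm I X = (\<Sum>k<card I. \<bar>lam k\<bar>)"
proof -
  have e: "orthonormal I (card I) e" using sp by (simp add: spectral_def)
  have Xm: "X = smat I e lam" using spectral_smat sp X by (auto simp: hermitian_on_def)
  let ?S = "smat I e (\<lambda>k. \<bar>lam k\<bar>)"
  have S: "psd_on I ?S" by (rule psd_smat) simp
  have "mmul I ?S ?S = mmul I X X" unfolding Xm mmul_smat[OF fin e] by simp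
  then have SS: "mmul I ?S ?S = mmul I X (madj X)" using X by (simp add: hermitian_on_def)
  have "(THE S. psd_on I S \<and> mmul I S S = mmul I X (madj X)) = ?S"
    using S SS psd_sqrt_unique[OF fin] by (intro the_equality) auto
  then show ?thesis by (simp add: trace_norm_def mtrace_smat_id[OF fin e])
qed

lemma trace_norm_nonneg: "finite I \<Longrightarrow> hermitian_on I X \<Longrightarrow> 0 \<le> trace_norm I X"
  using spectral_exists[of I X] by (auto simp: trace_norm_spectral sum_nonneg)

text \<open>In an eigenbasis of \<open>X\<close> the trace is the sum of the eigenvalues weighted by
  the form values of \<open>W\<close>, each of modulus at most \<open>M\<close>.\<close>

lemma trace_norm_duality:
  assumes fin: "finite I" and X: "hermitian_on I X"
    and W: "\<And>v. cinner I v v = 1 \<Longrightarrow> \<bar>Re (qform I W v)\<bar> \<le> M"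
  shows "Re (mtrace I (mmul I X W)) \<le> M * trace_norm I X"
proof -
  obtain e lam where sp: "spectral I X e lam" using spectral_exists[OF fin X] by blast
  have Xm: "X = smat I e lam" using spectral_smat sp X by (auto simp: hermitian_on_def)
  have "Re (mtrace I (mmul I X W)) = (\<Sum>k<card I. lam k * Re (qform I W (e k)))"
    unfolding Xm mtrace_smat[OF fin] by simp
  also have "\<dots> \<le> (\<Sum>k<card I. M * \<bar>lam k\<bar>)"
  proof (rule sum_mono)
    fix k assume "k \<in> {..<card I}"
    then have "\<bar>Re (qform I W (e k))\<bar> \<le> M" using sp W by (auto simp: spectral_def orthonormal_def)
    then have "\<bar>lam k * Re (qform I W (e k))\<bar> \<le> \<bar>lam k\<bar> * M"
      unfolding abs_mult by (intro mult_left_mono) auto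
    then show "lam k * Re (qform I W (e k)) \<le> M * \<bar>lam k\<bar>" by (simp add: mult.commute)
  qed
  finally show ?thesis by (simp add: trace_norm_spectral[OF fin X sp] sum_distrib_left)
qed

lemma bessel_ineq:
  assumes "finite I" "orthonormal I m e"
  shows "(\<Sum>k<m. (cmod (cinner I (e k) v))\<^sup>2) \<le> (\<Sum>i\<in>I. (cmod (v i))\<^sup>2)"
proof -
  let ?r = "\<lambda>i. v i - (\<Sum>l<m. cinner I (e l) v * e l i)"
  have "of_real ((\<Sum>i\<in>I. (cmod (v i))\<^sup>2) - (\<Sum>k<m. (cmod (cinner I (e k) v))\<^sup>2)) = cinner I ?r ?r"
    using orthonormal_residual(2)[OF assms, of v] by (simp add: cinner_self)
  also have "\<dots> = complex_of_real (\<Sum>i\<in>I. (cmod (?r i))\<^sup>2)" by (rule cinner_self)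
  finally show ?thesis unfolding of_real_eq_iff using sum_nonneg[of I "\<lambda>i. (cmod (?r i))\<^sup>2"] by simp
qed

text \<open>The diagonal of \<open>X\<close> in the basis \<open>e\<close> combines the eigenvalues
  with the weights |<f_l, e_k>|^2, and for each l these weights sum to at most 1 over k by
  Bessel.\<close>

lemma sum_qform_le_trace_norm:
  assumes fin: "finite I" and X: "hermitian_on I X" and e: "orthonormal I (card I) e"
  shows "(\<Sum>k<card I. \<bar>Re (qform I X (e k))\<bar>) \<le> trace_norm I X"
proof -
  obtain f t where sp: "spectral I X f t" using spectral_exists[OF fin X] by blast
  have Xm: "X = smat I f t" using spectral_smat sp X by (auto simp: hermitian_on_def)
  have f: "orthonormal I (card I) f" using sp by (simp add: spectral_def)
  have "(\<Sum>k<card I. \<bar>Re (qform I X (e k))\<bar>) \<le> (\<Sum>k<card I. \<Sum>l<card I. \<bar>t l\<bar> * (cmod (cinner I (f l) (e k)))\<^sup>2)"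
    unfolding Xm qform_smat Re_complex_of_real
    by (intro sum_mono order_trans[OF sum_abs]) (simp add: abs_mult)
  also have "\<dots> = (\<Sum>l<card I. \<bar>t l\<bar> * (\<Sum>k<card I. (cmod (cinner I (e k) (f l)))\<^sup>2))"
    unfolding sum_distrib_left cmod_cinner_commute[of I "f _"] by (rule sum.swap)
  also have "\<dots> \<le> (\<Sum>l<card I. \<bar>t l\<bar> * 1)"
  proof (intro sum_mono mult_left_mono)
    fix l assume "l \<in> {..<card I}"
    then have "cinner I (f l) (f l) = 1" using f by (simp add: orthonormal_def)
    then have "(\<Sum>i\<in>I. (cmod (f l i))\<^sup>2) = 1" unfolding cinner_self by (metis of_real_eq_1_iff)
    then show "(\<Sum>k<card I. (cmod (cinner I (e k) (f l)))\<^sup>2) \<le> 1" using bessel_ineq[OF fin e, of "f l"] by simp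
  qed simp
  finally show ?thesis by (simp add: trace_norm_spectral[OF fin X sp])
qed

text \<open>In an eigenbasis of \<open>A\<close> the trace norm of \<open>A\<close> is the sum of
  the moduli of its diagonal, and in this basis the diagonals of \<open>B\<close> and
  \<open>C\<close> are controlled by their own trace norms.\<close>

lemma trace_norm_triangle:
  assumes fin: "finite I" and A: "hermitian_on I A" and B: "hermitian_on I B" and C: "hermitian_on I C"
    and eq: "\<And>i j. A i j = B i j + C i j"
  shows "trace_norm I A \<le> trace_norm I B + trace_norm I C"
proof -
  obtain e a where sp: "spectral I A e a" using spectral_exists[OF fin A] by blast
  have Am: "A = smat I e a" using spectral_smat sp A by (auto simp: hermitian_on_def)
  have e: "orthonormal I (card I) e" using sp by (simp add: spectral_def)
  have q: "qform I A v = qform I B v + qform I C v" for v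
    unfolding qform_def eq by (simp add: algebra_simps sum.distrib)
  have "trace_norm I A = (\<Sum>k<card I. \<bar>Re (qform I A (e k))\<bar>)"
    unfolding trace_norm_spectral[OF fin A sp] by (simp add: Am qform_eigen[OF e])
  also have "\<dots> \<le> (\<Sum>k<card I. \<bar>Re (qform I B (e k))\<bar> + \<bar>Re (qform I C (e k))\<bar>)"
    unfolding q by (intro sum_mono) simp
  also have "\<dots> \<le> trace_norm I B + trace_norm I C"
    unfolding sum.distrib by (intro add_mono sum_qform_le_trace_norm fin B C e)
  finally show ?thesis .
qed

lemma cmod_coord_le_1: "finite I \<Longrightarrow> cinner I v v = 1 \<Longrightarrow> i \<in> I \<Longrightarrow> cmod (v i) \<le> 1"
proof -
  assume *: "finite I" "cinner I v v = 1" "i \<in> I"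
  then have "(\<Sum>i\<in>I. (cmod (v i))\<^sup>2) = 1" unfolding cinner_self by (metis of_real_eq_1_iff)
  then have "(cmod (v i))\<^sup>2 \<le> 1"
    using member_le_sum[of i I "\<lambda>i. (cmod (v i))\<^sup>2"] * by auto
  then show ?thesis by (simp add: abs_square_le_1)
qed

text \<open>A crude bound that depends on the dimension; it serves the continuity of
  \<open>dist_SEP\<close> at fixed \<open>d\<close>.\<close>

lemma trace_norm_le_entries:
  assumes fin: "finite I" and X: "hermitian_on I X"
  shows "trace_norm I X \<le> real (card I) * (\<Sum>i\<in>I. \<Sum>j\<in>I. cmod (X i j))"
proof -
  obtain e a where sp: "spectral I X e a" using spectral_exists[OF fin X] by blast
  have Am: "X = smat I e a" using spectral_smat sp X by (auto simp: hermitian_on_def)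
  have e: "orthonormal I (card I) e" using sp by (simp add: spectral_def)
  have "trace_norm I X = (\<Sum>k<card I. \<bar>Re (qform I X (e k))\<bar>)"
    unfolding trace_norm_spectral[OF fin X sp] by (simp add: Am qform_eigen[OF e])
  also have "\<dots> \<le> (\<Sum>k<card I. \<Sum>i\<in>I. \<Sum>j\<in>I. cmod (X i j))"
  proof (rule sum_mono)
    fix k assume "k \<in> {..<card I}"
    then have "cinner I (e k) (e k) = 1" using e by (simp add: orthonormal_def)
    note le1 = cmod_coord_le_1[OF fin this]
    have "\<bar>Re (qform I X (e k))\<bar> \<le> cmod (qform I X (e k))" by (rule abs_Re_le_cmod)
    also have "\<dots> \<le> (\<Sum>i\<in>I. \<Sum>j\<in>I. cmod (cnj (e k i) * X i j * e k j))"
      unfolding qform_def by (intro order_trans[OF norm_sum] sum_mono order_refl)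
    also have "\<dots> \<le> (\<Sum>i\<in>I. \<Sum>j\<in>I. cmod (X i j))"
    proof (intro sum_mono)
      fix i j assume "i \<in> I" "j \<in> I"
      then have "cmod (e k i) * cmod (X i j) * cmod (e k j) \<le> 1 * cmod (X i j) * 1"
        by (intro mult_mono le1) auto
      then show "cmod (cnj (e k i) * X i j * e k j) \<le> cmod (X i j)" by (simp add: norm_mult)
    qed
    finally show "\<bar>Re (qform I X (e k))\<bar> \<le> (\<Sum>i\<in>I. \<Sum>j\<in>I. cmod (X i j))" .
  qed
  finally show ?thesis by simp
qed

section \<open>Gaussian integration by parts and Slepian's inequality\<close>

abbreviation std_gauss :: "real measure" where
  "std_gauss \<equiv> density lborel std_normal_density"

definition gauss_on :: "'k set \<Rightarrow> ('k \<Rightarrow> real) measure" where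
  "gauss_on K = PiM K (\<lambda>_. std_gauss)"

section \<open>Standard Gaussian vectors and integration by parts\<close>

lemma prob_space_std_gauss: "prob_space std_gauss"
  by (rule prob_space_normal_density) simp

interpretation std_gauss: prob_space std_gauss
  by (rule prob_space_std_gauss)

interpretation gauss_on: prob_space "gauss_on K" for K :: "'k set"
  unfolding gauss_on_def by (intro prob_space_PiM prob_space_std_gauss)

lemma sets_gauss_on [measurable_cong]: "sets (gauss_on K) = sets (PiM K (\<lambda>_. borel))"
  unfolding gauss_on_def by (intro sets_PiM_cong) auto

lemma space_gauss_on: "space (gauss_on K) = (\<Pi>\<^sub>E k\<in>K. UNIV)"
  by (simp add: gauss_on_def space_PiM)

lemma measurable_coord: "k \<in> K \<Longrightarrow> (\<lambda>x. x k) \<in> borel_measurable (gauss_on K)"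
  by measurable

lemma deriv_std_normal_density:
  "(std_normal_density has_real_derivative - x * std_normal_density x) (at x)"
  unfolding normal_density_def
  by (rule derivative_eq_intros refl | simp)+

lemma integrable_std_gauss_iff:
  fixes f :: "real \<Rightarrow> real"
  assumes [measurable]: "f \<in> borel_measurable borel"
  shows "integrable std_gauss f \<longleftrightarrow> integrable lborel (\<lambda>x. std_normal_density x * f x)"
  using integrable_density[of f lborel std_normal_density] by (simp add: normal_density_nonneg)

lemma integral_std_gauss:
  fixes f :: "real \<Rightarrow> real"
  assumes [measurable]: "f \<in> borel_measurable borel"
  shows "integral\<^sup>L std_gauss f = (\<integral>x. std_normal_density x * f x \<partial>lborel)"
  using integral_density[of f lborel std_normal_density] by (simp add: normal_density_nonneg)

lemma integrable_std_gauss_power: "integrable std_gauss (\<lambda>x. x ^ k)"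
  using integrable_std_normal_moment by (simp add: integrable_std_gauss_iff)

lemma std_normal_density_tendsto:
  "(std_normal_density \<longlongrightarrow> 0) at_top" "(std_normal_density \<longlongrightarrow> 0) at_bot"
proof -
  have eq: "std_normal_density = (\<lambda>x. 1 / sqrt (2 * pi) * exp (- x\<^sup>2 / 2))"
    by (rule ext) (rule std_normal_density_def)
  have "((\<lambda>x::real. exp (- x\<^sup>2 / 2)) \<longlongrightarrow> 0) at_top" "((\<lambda>x::real. exp (- x\<^sup>2 / 2)) \<longlongrightarrow> 0) at_bot"
    by real_asymp+
  then show "(std_normal_density \<longlongrightarrow> 0) at_top" "(std_normal_density \<longlongrightarrow> 0) at_bot"
    unfolding eq by (auto intro: tendsto_mult_right_zero simp del: minus_divide_left times_divide_eq_left)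
qed

lemma integrable_bounded_mult_id:
  assumes f[measurable]: "f \<in> borel_measurable borel" and b: "\<And>x::real. \<bar>f x\<bar> \<le> C"
  shows "integrable std_gauss (\<lambda>x. x * f x)" "integrable std_gauss f"
proof -
  have "integrable std_gauss (\<lambda>x. C * \<bar>x ^ 1\<bar>)"
    using integrable_std_gauss_power[of 1] by (intro integrable_mult_right integrable_abs)
  then show "integrable std_gauss (\<lambda>x. x * f x)"
  proof (rule Bochner_Integration.integrable_bound)
    have "0 \<le> C" using b[of 0] by simp
    then show "AE x in std_gauss. norm (x * f x) \<le> norm (C * \<bar>x ^ 1\<bar>)"
      using mult_right_mono[OF b abs_ge_zero] by (intro AE_I2) (simp add: abs_mult mult.commute[of "\<bar>_\<bar>" "\<bar>f _\<bar>"])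
  qed measurable
  show "integrable std_gauss f"
    using b by (intro std_gauss.integrable_const_bound[where B = C]) auto
qed

text \<open>Stein's identity. With \<phi> the normal density, (f \<phi>)' = \<phi> (f' - x f), and
  this integrates to 0 because \<open>f\<close> is bounded and \<phi> vanishes at both ends of the
  line.\<close>

lemma gaussian_ibp:
  assumes d: "\<And>x. (f has_real_derivative f' x) (at x)" and c: "\<And>x. isCont f' x"
    and b: "\<And>x. \<bar>f x\<bar> \<le> C" and b': "\<And>x. \<bar>f' x\<bar> \<le> C"
  shows "(\<integral>x. x * f x \<partial>std_gauss) = (\<integral>x. f' x \<partial>std_gauss)"
proof -
  have cf: "isCont f x" for x using d DERIV_isCont by blast
  have [measurable]: "f \<in> borel_measurable borel" "f' \<in> borel_measurable borel"
    by (rule borel_measurable_continuous_onI, rule continuous_at_imp_continuous_on, simp add: cf c)+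
  have int: "integrable std_gauss (\<lambda>x. x * f x)" "integrable std_gauss f'"
    by (rule integrable_bounded_mult_id(1)[OF _ b] integrable_bounded_mult_id(2)[OF _ b'], measurable)+
  define F where "F = (\<lambda>x. f x * std_normal_density x)"
  define G where "G = (\<lambda>x. std_normal_density x * f' x - std_normal_density x * (x * f x))"
  have G: "integrable lborel G"
    unfolding G_def
    by (intro Bochner_Integration.integrable_diff integrable_std_gauss_iff[THEN iffD1] int) measurable
  have lim: "(F \<longlongrightarrow> 0) at_top" "(F \<longlongrightarrow> 0) at_bot"
  proof -
    have C: "\<bar>F x\<bar> \<le> C * std_normal_density x" for x
      unfolding F_def abs_mult using b by (intro mult_mono) (auto intro: order_trans[OF abs_ge_zero b])
    have t: "((\<lambda>x. C * std_normal_density x) \<longlongrightarrow> 0) at_top" "((\<lambda>x. C * std_normal_density x) \<longlongrightarrow> 0) at_bot"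
      using std_normal_density_tendsto by (auto intro: tendsto_mult_right_zero)
    show "(F \<longlongrightarrow> 0) at_top"
      by (rule tendsto_rabs_zero_cancel, rule tendsto_sandwich[OF _ _ tendsto_const t(1)]) (use C in auto)
    show "(F \<longlongrightarrow> 0) at_bot"
      by (rule tendsto_rabs_zero_cancel, rule tendsto_sandwich[OF _ _ tendsto_const t(2)]) (use C in auto)
  qed
  have "(LBINT x=-\<infinity>..\<infinity>. G x) = 0 - 0"
  proof (rule interval_integral_FTC_integrable[where F = F])
    show "(F has_vector_derivative G x) (at x)" for x
      unfolding F_def G_def has_real_derivative_iff_has_vector_derivative[symmetric]
      by (rule derivative_eq_intros d deriv_std_normal_density refl)+ (simp add: algebra_simps)
    show "isCont G x" for x
      unfolding G_def using cf c deriv_std_normal_density[THEN DERIV_isCont] by (intro continuous_intros) auto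
    show "set_integrable lborel (einterval (- \<infinity>) \<infinity>) G"
      using G by (simp add: set_integrable_def)
    show "((F \<circ> real_of_ereal) \<longlongrightarrow> 0) (at_right (- \<infinity>))" "((F \<circ> real_of_ereal) \<longlongrightarrow> 0) (at_left \<infinity>)"
      using lim by (simp_all add: ereal_tendsto_simps)
  qed simp
  then have "(\<integral>x. G x \<partial>lborel) = 0"
    by (simp add: interval_lebesgue_integral_def set_lebesgue_integral_def)
  then show ?thesis
    unfolding G_def
    by (subst (asm) Bochner_Integration.integral_diff)
      (simp_all add: int integrable_std_gauss_iff[symmetric] integral_std_gauss)
qed

lemma integral_coord_comp:
  fixes f :: "real \<Rightarrow> real"
  assumes "finite K" "k \<in> K" and [measurable]: "f \<in> borel_measurable borel" and f: "integrable std_gauss f"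
  shows "integrable (gauss_on K) (\<lambda>x. f (x k))" "(\<integral>x. f (x k) \<partial>gauss_on K) = (\<integral>x. f x \<partial>std_gauss)"
proof -
  have D: "distr (gauss_on K) std_gauss (\<lambda>x. x k) = std_gauss"
    unfolding gauss_on_def by (rule distr_PiM_component) (use assms prob_space_std_gauss in auto)
  have m: "(\<lambda>x. x k) \<in> measurable (gauss_on K) std_gauss"
    unfolding gauss_on_def using assms by measurable
  have p: "f \<in> borel_measurable std_gauss" by simp
  show "integrable (gauss_on K) (\<lambda>x. f (x k))"
    using f integrable_distr_eq[OF m p] unfolding D by simp
  show "(\<integral>x. f (x k) \<partial>gauss_on K) = (\<integral>x. f x \<partial>std_gauss)"
    using integral_distr[OF m p] unfolding D by simp
qed

lemma integral_gauss_insert: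
  fixes f :: "('k \<Rightarrow> real) \<Rightarrow> real"
  assumes "finite K" "k \<notin> K" "integrable (gauss_on (insert k K)) f"
  shows "(\<integral>x. f x \<partial>gauss_on (insert k K)) = (\<integral>x. (\<integral>y. f (x(k := y)) \<partial>std_gauss) \<partial>gauss_on K)"
proof -
  interpret product_sigma_finite "\<lambda>_ :: 'k. std_gauss"
    by unfold_locales
  show ?thesis
    unfolding gauss_on_def using assms by (intro product_integral_insert) (auto simp: gauss_on_def)
qed

lemma integrable_coord_times_bounded:
  assumes "finite K" "k \<in> K" and [measurable]: "f \<in> borel_measurable (gauss_on K)"
    and b: "\<And>x. \<bar>f x\<bar> \<le> C"
  shows "integrable (gauss_on K) (\<lambda>x. x k * f x)"
proof (rule Bochner_Integration.integrable_bound)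
  show "integrable (gauss_on K) (\<lambda>x. C * \<bar>x k ^ 1\<bar>)"
    using integral_coord_comp(1)[OF assms(1,2) _ integrable_std_gauss_power[of 1]]
    by (intro integrable_mult_right integrable_abs) simp
  have "0 \<le> C" using order_trans[OF abs_ge_zero b] .
  then show "AE x in gauss_on K. norm (x k * f x) \<le> norm (C * \<bar>x k ^ 1\<bar>)"
    using mult_right_mono[OF b abs_ge_zero] by (intro AE_I2) (simp add: abs_mult mult.commute[of "\<bar>_\<bar>" "\<bar>f _\<bar>"])
  show "(\<lambda>x. x k * f x) \<in> borel_measurable (gauss_on K)"
    using assms(2) by measurable
qed

text \<open>Fubini makes the coordinate \<open>k\<close> the inner variable; the one-dimensional
  identity applies with the other coordinates frozen.\<close>

lemma gaussian_ibp_coord: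
  assumes K: "finite K" "k \<in> K"
    and m[measurable]: "f \<in> borel_measurable (gauss_on K)" "f' \<in> borel_measurable (gauss_on K)"
    and d: "\<And>x y. ((\<lambda>t. f (x(k := t))) has_real_derivative f' (x(k := y))) (at y)"
    and c: "\<And>x y. isCont (\<lambda>t. f' (x(k := t))) y"
    and b: "\<And>x. \<bar>f x\<bar> \<le> C" and b': "\<And>x. \<bar>f' x\<bar> \<le> C"
  shows "(\<integral>x. x k * f x \<partial>gauss_on K) = (\<integral>x. f' x \<partial>gauss_on K)"
proof -
  define K' where "K' = K - {k}"
  have K': "K = insert k K'" "finite K'" "k \<notin> K'" using K by (auto simp: K'_def)
  have i1: "integrable (gauss_on (insert k K')) (\<lambda>x. x k * f x)"
    unfolding K'(1)[symmetric] by (rule integrable_coord_times_bounded[OF K m(1) b])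
  have i2: "integrable (gauss_on (insert k K')) f'"
    unfolding K'(1)[symmetric] using b' by (intro gauss_on.integrable_const_bound[where B = C] m) auto
  have "(\<integral>x. x k * f x \<partial>gauss_on K) = (\<integral>x. (\<integral>y. y * f (x(k := y)) \<partial>std_gauss) \<partial>gauss_on K')"
    unfolding K'(1) by (subst integral_gauss_insert[OF K'(2,3) i1]) simp
  also have "\<dots> = (\<integral>x. (\<integral>y. f' (x(k := y)) \<partial>std_gauss) \<partial>gauss_on K')"
    by (intro Bochner_Integration.integral_cong refl gaussian_ibp[where C = C] d c b b')
  also have "\<dots> = (\<integral>x. f' x \<partial>gauss_on K)"
    unfolding K'(1) by (subst integral_gauss_insert[OF K'(2,3) i2]) simp
  finally show ?thesis .
qed

text \<open>The mean value theorem bounds every difference quotient by \<open>g\<close>, which does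
  not depend on \<theta>, so dominated convergence along sequences gives the derivative.\<close>

lemma has_derivative_integral_param:
  fixes f f' :: "real \<Rightarrow> 'a \<Rightarrow> real"
  assumes int: "\<And>\<theta>. integrable M (f \<theta>)" and g: "integrable M g"
    and d: "\<And>\<theta> x. x \<in> space M \<Longrightarrow> ((\<lambda>\<theta>. f \<theta> x) has_real_derivative f' \<theta> x) (at \<theta>)"
    and b: "\<And>\<theta> x. x \<in> space M \<Longrightarrow> \<bar>f' \<theta> x\<bar> \<le> g x"
    and m: "f' \<theta> \<in> borel_measurable M"
  shows "((\<lambda>\<theta>. integral\<^sup>L M (f \<theta>)) has_real_derivative integral\<^sup>L M (f' \<theta>)) (at \<theta>)"
  unfolding has_field_derivative_iff tendsto_at_iff_sequentially comp_def
proof (intro allI impI)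
  fix X :: "nat \<Rightarrow> real" assume X: "\<forall>i. X i \<in> UNIV - {\<theta>}" and lim: "X \<longlonglongrightarrow> \<theta>"
  let ?q = "\<lambda>i x. (f (X i) x - f \<theta> x) / (X i - \<theta>)"
  have "(\<lambda>i. integral\<^sup>L M (?q i)) \<longlonglongrightarrow> integral\<^sup>L M (f' \<theta>)"
  proof (rule integral_dominated_convergence[where w = g])
    show "?q i \<in> borel_measurable M" for i
      using int[THEN borel_measurable_integrable] by measurable
    show "AE x in M. (\<lambda>i. ?q i x) \<longlonglongrightarrow> f' \<theta> x"
    proof (rule AE_I2)
      fix x assume "x \<in> space M"
      from d[OF this, of \<theta>] show "(\<lambda>i. ?q i x) \<longlonglongrightarrow> f' \<theta> x"
        unfolding has_field_derivative_iff tendsto_at_iff_sequentially comp_def using X lim by blast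
    qed
    show "AE x in M. norm (?q i x) \<le> g x" for i
    proof (rule AE_I2)
      fix x assume x: "x \<in> space M"
      have "norm (f (X i) x - f \<theta> x) \<le> g x * norm (X i - \<theta>)"
        by (rule field_differentiable_bound[where S = UNIV and f' = "\<lambda>\<theta>. f' \<theta> x"])
          (use d[OF x] b[OF x] in \<open>auto intro: has_field_derivative_at_within\<close>)
      moreover have "X i \<noteq> \<theta>" using X by auto
      ultimately show "norm (?q i x) \<le> g x" by (simp add: field_simps)
    qed
  qed (use m g in auto)
  then show "(\<lambda>i. (integral\<^sup>L M (f (X i)) - integral\<^sup>L M (f \<theta>)) / (X i - \<theta>)) \<longlonglongrightarrow> integral\<^sup>L M (f' \<theta>)"
    by (simp add: Bochner_Integration.integral_diff[OF int int])
qed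

text \<open>Along the rotation $Z_\theta = \cos\theta\, X + \sin\theta\, Y$ integration by parts turns the derivative of
  $E \prod_i h(Z_\theta(i))$ into $\sin\theta\cos\theta$ times a sum of $(K_Y - K_X)(i,j)$ weighted by
  $h' h' \prod h \ge 0$; the diagonal terms vanish since the variances agree.\<close>

lemma slepian_smooth:
  fixes A B :: "'i \<Rightarrow> 'k \<Rightarrow> real" and h h' h'' :: "real \<Rightarrow> real"
  assumes N: "finite N" and K: "finite K"
    and dh: "\<And>z. (h has_real_derivative h' z) (at z)" and dh': "\<And>z. (h' has_real_derivative h'' z) (at z)"
    and ch'': "\<And>z. isCont h'' z"
    and h: "\<And>z. 0 \<le> h z" "\<And>z. h z \<le> 1" and h': "\<And>z. h' z \<le> 0" "\<And>z. \<bar>h' z\<bar> \<le> C"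
    and h'': "\<And>z. \<bar>h'' z\<bar> \<le> C"
    and orth: "\<And>i j. i \<in> N \<Longrightarrow> j \<in> N \<Longrightarrow> (\<Sum>k\<in>K. A i k * B j k) = 0"
    and var: "\<And>i. i \<in> N \<Longrightarrow> (\<Sum>k\<in>K. A i k * A i k) = (\<Sum>k\<in>K. B i k * B i k)"
    and cov: "\<And>i j. i \<in> N \<Longrightarrow> j \<in> N \<Longrightarrow> (\<Sum>k\<in>K. B i k * B j k) \<le> (\<Sum>k\<in>K. A i k * A j k)"
  shows "(\<integral>x. (\<Prod>i\<in>N. h (\<Sum>k\<in>K. B i k * x k)) \<partial>gauss_on K)
    \<le> (\<integral>x. (\<Prod>i\<in>N. h (\<Sum>k\<in>K. A i k * x k)) \<partial>gauss_on K)"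
proof -
  \<comment> \<open>Both processes are driven by the same Gaussian vector, and \<open>orth\<close>
    makes them independent. \<open>c\<close> holds the coefficients of the rotated process, equal to
    \<open>A\<close> at \<theta> = 0 and to \<open>B\<close> at \<theta> = pi / 2; \<open>c'\<close>
    is the derivative of \<open>c\<close> in \<theta>.\<close>
  define c where "c = (\<lambda>\<theta> i k. cos \<theta> * A i k + sin \<theta> * B i k)"
  define c' where "c' = (\<lambda>\<theta> i k. cos \<theta> * B i k - sin \<theta> * A i k)"
  define Z where "Z = (\<lambda>\<theta> i x. \<Sum>k\<in>K. c \<theta> i k * x k)"
  define Z' where "Z' = (\<lambda>\<theta> i x. \<Sum>k\<in>K. c' \<theta> i k * x k)"
  define F where "F = (\<lambda>\<theta> x. \<Prod>i\<in>N. h (Z \<theta> i x))"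
  \<comment> \<open>\<open>P\<close> is the partial derivative of the product in its i-th argument,
    \<open>R\<close> the mixed second derivative for j \<noteq> i, and \<open>Q\<close> the
    derivative of \<open>P\<close> along the Gaussian coordinate \<open>x k\<close>.\<close>
  define P where "P = (\<lambda>\<theta> i x. h' (Z \<theta> i x) * (\<Prod>j\<in>N - {i}. h (Z \<theta> j x)))"
  define F' where "F' = (\<lambda>\<theta> x. \<Sum>i\<in>N. P \<theta> i x * Z' \<theta> i x)"
  define R where "R = (\<lambda>\<theta> i j x. h' (Z \<theta> i x) * (h' (Z \<theta> j x) * (\<Prod>l\<in>N - {i} - {j}. h (Z \<theta> l x))))"
  define Q where "Q = (\<lambda>\<theta> i k x. h'' (Z \<theta> i x) * (\<Prod>j\<in>N - {i}. h (Z \<theta> j x)) * c \<theta> i k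
       + (\<Sum>j\<in>N - {i}. R \<theta> i j x * c \<theta> j k))"
  have C0: "0 \<le> C" using order_trans[OF abs_ge_zero h''] .
  have cont: "isCont h z" "isCont h' z" for z using dh dh' DERIV_isCont by blast+
  have [measurable]: "h \<in> borel_measurable borel" "h' \<in> borel_measurable borel" "h'' \<in> borel_measurable borel"
    by (rule borel_measurable_continuous_onI, rule continuous_at_imp_continuous_on, simp add: cont ch'')+
  have [measurable]: "Z \<theta> i \<in> borel_measurable (gauss_on K)" "Z' \<theta> i \<in> borel_measurable (gauss_on K)" for \<theta> i
    unfolding Z_def Z'_def by measurable
  have hZ[measurable]: "(\<lambda>x. h (Z \<theta> i x)) \<in> borel_measurable (gauss_on K)" "(\<lambda>x. h' (Z \<theta> i x)) \<in> borel_measurable (gauss_on K)"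
    "(\<lambda>x. h'' (Z \<theta> i x)) \<in> borel_measurable (gauss_on K)" for \<theta> i
    by measurable
  have [measurable]: "F \<theta> \<in> borel_measurable (gauss_on K)" "P \<theta> i \<in> borel_measurable (gauss_on K)"
    "R \<theta> i j \<in> borel_measurable (gauss_on K)" for \<theta> i j
    unfolding F_def P_def R_def by (intro borel_measurable_times borel_measurable_prod; measurable)+
  have [measurable]: "F' \<theta> \<in> borel_measurable (gauss_on K)" "Q \<theta> i k \<in> borel_measurable (gauss_on K)" for \<theta> i k
    unfolding F'_def Q_def by (intro borel_measurable_add borel_measurable_times borel_measurable_sum borel_measurable_prod; measurable)+
  have prod01: "0 \<le> (\<Prod>j\<in>M. h (Z \<theta> j x))" "(\<Prod>j\<in>M. h (Z \<theta> j x)) \<le> 1" for M \<theta> x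
    using h by (auto intro!: prod_nonneg prod_le_1)
  have Pb: "\<bar>P \<theta> i x\<bar> \<le> C" for \<theta> i x
  proof -
    have "\<bar>P \<theta> i x\<bar> \<le> C * 1"
      unfolding P_def abs_mult using h' prod01 C0 by (intro mult_mono) auto
    then show ?thesis by simp
  qed
  \<comment> \<open>Two factors h' \<le> 0 multiply to a nonnegative weight; the direction of the
    comparison rests on this sign.\<close>
  have Rb: "0 \<le> R \<theta> i j x" "\<bar>R \<theta> i j x\<bar> \<le> C * (C * 1)" for \<theta> i j x
  proof -
    show "0 \<le> R \<theta> i j x"
      unfolding R_def by (rule mult_nonpos_nonpos[OF h'(1) mult_nonpos_nonneg[OF h'(1) prod01(1)]])
    show "\<bar>R \<theta> i j x\<bar> \<le> C * (C * 1)"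
      unfolding R_def abs_mult
      by (intro mult_mono h' mult_nonneg_nonneg abs_ge_zero C0) (use prod01 in auto)
  qed
  have Qb: "\<bar>Q \<theta> i k x\<bar> \<le> C * 1 * \<bar>c \<theta> i k\<bar> + (\<Sum>j\<in>N - {i}. C * (C * 1) * \<bar>c \<theta> j k\<bar>)" for \<theta> i k x
    unfolding Q_def
  proof (intro order_trans[OF abs_triangle_ineq] add_mono order_trans[OF sum_abs] sum_mono)
    show "\<bar>h'' (Z \<theta> i x) * (\<Prod>j\<in>N - {i}. h (Z \<theta> j x)) * c \<theta> i k\<bar> \<le> C * 1 * \<bar>c \<theta> i k\<bar>"
      unfolding abs_mult using h'' prod01 C0 by (intro mult_mono) auto
    show "\<bar>R \<theta> i j x * c \<theta> j k\<bar> \<le> C * (C * 1) * \<bar>c \<theta> j k\<bar>" for j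
      unfolding abs_mult using Rb C0 by (intro mult_mono) auto
  qed
  have Zupd: "Z \<theta> i (x(k := t)) = Z \<theta> i x + c \<theta> i k * (t - x k)" if "k \<in> K" for \<theta> i x k t
  proof -
    have "Z \<theta> i (x(k := t)) - Z \<theta> i x = (\<Sum>l\<in>K. if l = k then c \<theta> i k * (t - x k) else 0)"
      unfolding Z_def sum_subtractf[symmetric] by (intro sum.cong refl) (auto simp: algebra_simps)
    then show ?thesis using that K by simp
  qed
  have dZ: "((\<lambda>t. Z \<theta> i (x(k := t))) has_real_derivative c \<theta> i k) (at y)" if "k \<in> K" for \<theta> i x k y
    unfolding Zupd[OF that] by (auto intro!: derivative_eq_intros)
  have cZ: "isCont (\<lambda>t. Z \<theta> i (x(k := t))) y" if "k \<in> K" for \<theta> i x k y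
    using DERIV_isCont[OF dZ[OF that]] .
  have dprod: "((\<lambda>t. \<Prod>j\<in>M. h (g j t)) has_real_derivative
      (\<Sum>j\<in>M. h' (g j y) * (\<Prod>l\<in>M - {j}. h (g l y)) * g' j)) (at y)"
    if "\<And>j. j \<in> M \<Longrightarrow> (g j has_real_derivative g' j) (at y)" for M and g :: "'i \<Rightarrow> real \<Rightarrow> real" and g' y
  proof -
    have "((\<lambda>t. \<Prod>j\<in>M. h (g j t)) has_real_derivative
      (\<Sum>j\<in>M. (h' (g j y) * g' j) * (\<Prod>l\<in>M - {j}. h (g l y)))) (at y)"
      by (rule has_field_derivative_prod) (rule DERIV_chain2[OF dh that])
    then show ?thesis by (simp add: mult_ac)
  qed
  have dP: "((\<lambda>t. P \<theta> i (x(k := t))) has_real_derivative Q \<theta> i k (x(k := y))) (at y)"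
    if k: "k \<in> K" for \<theta> i k x y
  proof -
    have "((\<lambda>t. P \<theta> i (x(k := t))) has_real_derivative
      (h'' (Z \<theta> i (x(k := y))) * c \<theta> i k) * (\<Prod>j\<in>N - {i}. h (Z \<theta> j (x(k := y))))
      + (\<Sum>j\<in>N - {i}. h' (Z \<theta> j (x(k := y))) * (\<Prod>l\<in>N - {i} - {j}. h (Z \<theta> l (x(k := y)))) * c \<theta> j k) * h' (Z \<theta> i (x(k := y)))) (at y)"
      unfolding P_def
      by (rule DERIV_mult[OF DERIV_chain2[OF dh' dZ[OF k]] dprod]) (rule dZ[OF k])
    then show ?thesis
      by (simp add: Q_def R_def sum_distrib_left sum_distrib_right mult_ac)
  qed
  have cQ: "isCont (\<lambda>t. Q \<theta> i k (x(k := t))) y" if "k \<in> K" for \<theta> i k x y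
    unfolding Q_def R_def
    by (intro continuous_intros isCont_o2[OF cZ[OF that]] cont ch'')
  have ibp: "(\<integral>x. x k * P \<theta> i x \<partial>gauss_on K) = (\<integral>x. Q \<theta> i k x \<partial>gauss_on K)" if "k \<in> K" for \<theta> i k
  proof (rule gaussian_ibp_coord[OF K that])
    let ?D = "C * 1 * \<bar>c \<theta> i k\<bar> + (\<Sum>j\<in>N - {i}. C * (C * 1) * \<bar>c \<theta> j k\<bar>)"
    have D0: "0 \<le> ?D" using C0 by (intro add_nonneg_nonneg sum_nonneg) auto
    show "\<bar>P \<theta> i x\<bar> \<le> C + ?D" for x using Pb[of \<theta> i x] D0 by linarith
    show "\<bar>Q \<theta> i k x\<bar> \<le> C + ?D" for x using Qb[of \<theta> i k x] C0 by linarith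
  qed (auto simp: dP that cQ)
  have intQ: "integrable (gauss_on K) (Q \<theta> i k)" for \<theta> i k
    by (intro gauss_on.integrable_const_bound[OF AE_I2]) (use Qb in auto)
  have intP: "integrable (gauss_on K) (\<lambda>x. x k * P \<theta> i x)" if "k \<in> K" for \<theta> i k
    by (rule integrable_coord_times_bounded[OF K that _ Pb]) measurable
  have F'eq: "F' \<theta> = (\<lambda>x. \<Sum>i\<in>N. \<Sum>k\<in>K. c' \<theta> i k * (x k * P \<theta> i x))" for \<theta>
    unfolding F'_def Z'_def sum_distrib_left by (simp add: mult_ac)
  have "(\<integral>x. F' \<theta> x \<partial>gauss_on K) \<le> 0" if \<theta>: "0 \<le> \<theta>" "\<theta> \<le> pi / 2" for \<theta>
  proof -
    \<comment> \<open>This is the covariance of Z'_i and Z_j. The terms with cos^2 and sin^2 pair a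
      row of \<open>A\<close> with a row of \<open>B\<close> and vanish by
      \<open>orth\<close>.\<close>
    have cc: "(\<Sum>k\<in>K. c' \<theta> i k * c \<theta> j k) = sin \<theta> * cos \<theta> * ((\<Sum>k\<in>K. B i k * B j k) - (\<Sum>k\<in>K. A i k * A j k))"
      if "i \<in> N" "j \<in> N" for i j
    proof -
      have "(\<Sum>k\<in>K. c' \<theta> i k * c \<theta> j k) = (cos \<theta>)\<^sup>2 * (\<Sum>k\<in>K. A j k * B i k) - (sin \<theta>)\<^sup>2 * (\<Sum>k\<in>K. A i k * B j k)
          + sin \<theta> * cos \<theta> * ((\<Sum>k\<in>K. B i k * B j k) - (\<Sum>k\<in>K. A i k * A j k))"
        unfolding c_def c'_def sum_distrib_left sum.distrib[symmetric] sum_subtractf[symmetric]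
        by (intro sum.cong refl) (simp add: algebra_simps power2_eq_square)
      then show ?thesis using orth that by simp
    qed
    have sc: "0 \<le> sin \<theta> * cos \<theta>"
      using \<theta> by (intro mult_nonneg_nonneg sin_ge_zero cos_ge_zero) auto
    have "(\<integral>x. F' \<theta> x \<partial>gauss_on K) = (\<Sum>i\<in>N. \<Sum>k\<in>K. c' \<theta> i k * (\<integral>x. Q \<theta> i k x \<partial>gauss_on K))"
      unfolding F'eq using intP by (subst Bochner_Integration.integral_sum | intro Bochner_Integration.integrable_sum)+
        (auto simp: ibp)
    also have "\<dots> = (\<integral>x. (\<Sum>i\<in>N. \<Sum>k\<in>K. c' \<theta> i k * Q \<theta> i k x) \<partial>gauss_on K)"
      using intQ by simp
    also have "\<dots> \<le> (\<integral>x. 0 \<partial>gauss_on K)"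
    proof (rule integral_mono)
      fix x
      have "(\<Sum>k\<in>K. c' \<theta> i k * Q \<theta> i k x) \<le> 0" if i: "i \<in> N" for i
      proof -
        have "(\<Sum>k\<in>K. c' \<theta> i k * Q \<theta> i k x) = h'' (Z \<theta> i x) * (\<Prod>j\<in>N - {i}. h (Z \<theta> j x)) * (\<Sum>k\<in>K. c' \<theta> i k * c \<theta> i k)
          + (\<Sum>k\<in>K. \<Sum>j\<in>N - {i}. R \<theta> i j x * (c' \<theta> i k * c \<theta> j k))"
          unfolding Q_def by (simp add: algebra_simps sum.distrib sum_distrib_left sum_distrib_right)
        moreover have "(\<Sum>k\<in>K. c' \<theta> i k * c \<theta> i k) = 0" using cc[OF i i] var[OF i] by simp
        moreover have "(\<Sum>k\<in>K. \<Sum>j\<in>N - {i}. R \<theta> i j x * (c' \<theta> i k * c \<theta> j k)) = (\<Sum>j\<in>N - {i}. R \<theta> i j x * (\<Sum>k\<in>K. c' \<theta> i k * c \<theta> j k))"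
          unfolding sum_distrib_left by (rule sum.swap)
        moreover have "(\<Sum>j\<in>N - {i}. R \<theta> i j x * (\<Sum>k\<in>K. c' \<theta> i k * c \<theta> j k)) \<le> 0"
        proof (rule sum_nonpos, rule mult_nonneg_nonpos[OF Rb(1)])
          fix j assume "j \<in> N - {i}"
          then show "(\<Sum>k\<in>K. c' \<theta> i k * c \<theta> j k) \<le> 0"
            using cc[OF i, of j] sc cov[OF i, of j] by (simp add: mult_nonneg_nonpos)
        qed
        ultimately show ?thesis by simp
      qed
      then show "(\<Sum>i\<in>N. \<Sum>k\<in>K. c' \<theta> i k * Q \<theta> i k x) \<le> 0" by (rule sum_nonpos)
    qed (use intQ in auto)
    finally show ?thesis by simp
  qed
  note neg = this
  \<comment> \<open>This dominates the derivative uniformly in \<theta>, because |c'| \<le> |A| +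
    |B| and |P| \<le> C.\<close>
  define g where "g = (\<lambda>x. \<Sum>i\<in>N. \<Sum>k\<in>K. (\<bar>A i k\<bar> + \<bar>B i k\<bar>) * C * \<bar>x k\<bar>)"
  have intF: "integrable (gauss_on K) (F \<theta>)" for \<theta>
    by (rule gauss_on.integrable_const_bound[where B = 1]) (use prod01 in \<open>auto simp: F_def\<close>)
  have intg: "integrable (gauss_on K) g"
    unfolding g_def using integral_coord_comp(1)[OF K _ _ integrable_std_gauss_power[of 1]]
    by (intro Bochner_Integration.integrable_sum integrable_mult_right integrable_abs) auto
  have dF: "((\<lambda>\<theta>. F \<theta> x) has_real_derivative F' \<theta> x) (at \<theta>)" for \<theta> x
  proof -
    have "((\<lambda>\<theta>. Z \<theta> i x) has_real_derivative Z' \<theta> i x) (at \<theta>)" for i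
      unfolding Z_def Z'_def c_def c'_def
      by (auto intro!: derivative_eq_intros sum.cong simp: algebra_simps)
    from dprod[OF this] show ?thesis unfolding F_def F'_def P_def .
  qed
  have F'b: "\<bar>F' \<theta> x\<bar> \<le> g x" for \<theta> x
    unfolding F'eq g_def
  proof (intro order_trans[OF sum_abs] sum_mono)
    fix i k
    have "\<bar>c' \<theta> i k\<bar> \<le> \<bar>cos \<theta>\<bar> * \<bar>B i k\<bar> + \<bar>sin \<theta>\<bar> * \<bar>A i k\<bar>"
      unfolding c'_def abs_mult[symmetric] by (rule abs_triangle_ineq4)
    also have "\<dots> \<le> 1 * \<bar>B i k\<bar> + 1 * \<bar>A i k\<bar>"
      by (intro add_mono mult_right_mono) auto
    finally have "\<bar>c' \<theta> i k\<bar> * (\<bar>x k\<bar> * \<bar>P \<theta> i x\<bar>) \<le> (\<bar>A i k\<bar> + \<bar>B i k\<bar>) * (\<bar>x k\<bar> * C)"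
      using Pb by (intro mult_mono) auto
    then show "\<bar>c' \<theta> i k * (x k * P \<theta> i x)\<bar> \<le> (\<bar>A i k\<bar> + \<bar>B i k\<bar>) * C * \<bar>x k\<bar>"
      by (simp add: abs_mult mult_ac)
  qed
  have "integral\<^sup>L (gauss_on K) (F (pi / 2)) \<le> integral\<^sup>L (gauss_on K) (F 0)"
  proof (rule DERIV_nonpos_imp_nonincreasing[of 0 "pi / 2" "\<lambda>\<theta>. integral\<^sup>L (gauss_on K) (F \<theta>)"])
    fix \<theta> :: real assume "0 \<le> \<theta>" "\<theta> \<le> pi / 2"
    then show "\<exists>y. ((\<lambda>\<theta>. integral\<^sup>L (gauss_on K) (F \<theta>)) has_real_derivative y) (at \<theta>) \<and> y \<le> 0"
      using has_derivative_integral_param[of "gauss_on K" F g F' \<theta>, OF intF intg dF F'b] neg by auto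
  qed simp
  then show ?thesis by (simp add: F_def Z_def c_def)
qed

text \<open>The logistic function satisfies h' = - a h (1 - h), so its derivatives are polynomials
  in \<open>h\<close> and therefore bounded. The common bound a + a^2 serves both orders because
  \<open>slepian_smooth\<close> takes a single constant.\<close>

lemma logistic_derivs:
  fixes a b :: real
  defines "h \<equiv> \<lambda>z. 1 / (1 + exp (a * z - b))"
  assumes a: "0 \<le> a"
  shows "(h has_real_derivative - a * (h z * (1 - h z))) (at z)"
    and "((\<lambda>z. - a * (h z * (1 - h z))) has_real_derivative a\<^sup>2 * (h z * (1 - h z)) * (1 - 2 * h z)) (at z)"
    and "0 \<le> h z" "h z \<le> 1"
    and "- a * (h z * (1 - h z)) \<le> 0"
    and "\<bar>- a * (h z * (1 - h z))\<bar> \<le> a + a\<^sup>2"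
    and "\<bar>a\<^sup>2 * (h z * (1 - h z)) * (1 - 2 * h z)\<bar> \<le> a + a\<^sup>2"
proof -
  have pos: "1 + exp x \<noteq> 0" for x :: real by (smt (verit) exp_gt_zero)
  show d: "(h has_real_derivative - a * (h z * (1 - h z))) (at z)" for z
    unfolding h_def
    by (rule derivative_eq_intros refl pos)+ (simp add: pos field_simps power2_eq_square)
  show "((\<lambda>z. - a * (h z * (1 - h z))) has_real_derivative a\<^sup>2 * (h z * (1 - h z)) * (1 - 2 * h z)) (at z)"
    by (rule derivative_eq_intros refl d)+ (simp add: algebra_simps power2_eq_square)
  have "1 + exp x \<ge> 1" for x :: real by simp
  then show h0: "0 \<le> h z" "h z \<le> 1"
    unfolding h_def by (simp_all add: divide_le_eq_1 add_nonneg_nonneg add_pos_pos)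
  have hh: "0 \<le> h z * (1 - h z)" "h z * (1 - h z) \<le> 1"
    using h0 by (auto intro: mult_le_one)
  show "- a * (h z * (1 - h z)) \<le> 0"
    using mult_nonneg_nonneg[OF a hh(1)] by (simp only: mult_minus_left neg_le_0_iff_le)
  have *: "a * (h z * (1 - h z)) \<le> a * 1" by (rule mult_left_mono[OF hh(2) a])
  have "\<bar>- a * (h z * (1 - h z))\<bar> = a * (h z * (1 - h z))"
    using mult_nonneg_nonneg[OF a hh(1)] by (simp only: mult_minus_left abs_minus_cancel abs_of_nonneg)
  then show "\<bar>- a * (h z * (1 - h z))\<bar> \<le> a + a\<^sup>2"
    using * zero_le_power2[of a] by linarith
  have "\<bar>a\<^sup>2 * (h z * (1 - h z)) * (1 - 2 * h z)\<bar> \<le> a\<^sup>2 * 1 * 1"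
    unfolding abs_mult[of _ "1 - 2 * h z"] abs_mult[of "a\<^sup>2"] using hh h0 by (intro mult_mono) auto
  then show "\<bar>a\<^sup>2 * (h z * (1 - h z)) * (1 - 2 * h z)\<bar> \<le> a + a\<^sup>2" using a by linarith
qed

text \<open>The shift by $m$ makes the limit equal $1$ also at $z = t$.\<close>

lemma logistic_tendsto:
  fixes t z :: real
  shows "(\<lambda>m. 1 / (1 + exp ((real m)\<^sup>2 * z - ((real m)\<^sup>2 * t + real m)))) \<longlonglongrightarrow> (if z \<le> t then 1 else 0)"
proof -
  define c where "c = z - t"
  have eq: "(real m)\<^sup>2 * z - ((real m)\<^sup>2 * t + real m) = (real m)\<^sup>2 * c - real m" for m
    by (simp add: c_def algebra_simps)
  consider "c < 0" | "c = 0" | "c > 0" by linarith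
  then have "(\<lambda>m. 1 / (1 + exp ((real m)\<^sup>2 * c - real m))) \<longlonglongrightarrow> (if c \<le> 0 then 1 else 0)"
  proof cases
    case 1 then have "(\<lambda>m. 1 / (1 + exp ((real m)\<^sup>2 * c - real m))) \<longlonglongrightarrow> 1" by real_asymp
    then show ?thesis using 1 by simp
  next
    case 2
    have "(\<lambda>m. 1 / (1 + exp (- real m))) \<longlonglongrightarrow> 1" by real_asymp
    then show ?thesis using 2 by simp
  next
    case 3 then have "(\<lambda>m. 1 / (1 + exp ((real m)\<^sup>2 * c - real m))) \<longlonglongrightarrow> 0" by real_asymp
    then show ?thesis using 3 by simp
  qed
  then show ?thesis unfolding eq by (simp add: c_def)
qed

section \<open>Comparison of the probabilities that a process stays below a level\<close>

abbreviation below :: "'k set \<Rightarrow> 'i set \<Rightarrow> ('i \<Rightarrow> 'k \<Rightarrow> real) \<Rightarrow> real \<Rightarrow> ('k \<Rightarrow> real) set" where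
  "below K T A t \<equiv> {x \<in> space (gauss_on K). \<forall>i\<in>T. (\<Sum>k\<in>K. A i k * x k) \<le> t}"

lemma sets_below:
  assumes "countable T"
  shows "below K T A t \<in> sets (gauss_on K)"
proof -
  have [measurable]: "(\<lambda>x. \<Sum>k\<in>K. A i k * x k) \<in> borel_measurable (gauss_on K)" for i
    by measurable
  show ?thesis
    by (rule sets.sets_Collect_countable_All'[OF _ assms]) measurable
qed

text \<open>The logistic products are bounded by 1 and converge pointwise to the indicator of
  \<open>below\<close>, so the smooth comparison passes to probabilities by dominated
  convergence.\<close>

lemma slepian_orthogonal:
  fixes A B :: "'i \<Rightarrow> 'k \<Rightarrow> real"
  assumes N: "finite N" and K: "finite K"
    and orth: "\<And>i j. i \<in> N \<Longrightarrow> j \<in> N \<Longrightarrow> (\<Sum>k\<in>K. A i k * B j k) = 0"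
    and var: "\<And>i. i \<in> N \<Longrightarrow> (\<Sum>k\<in>K. A i k * A i k) = (\<Sum>k\<in>K. B i k * B i k)"
    and cov: "\<And>i j. i \<in> N \<Longrightarrow> j \<in> N \<Longrightarrow> (\<Sum>k\<in>K. B i k * B j k) \<le> (\<Sum>k\<in>K. A i k * A j k)"
  shows "measure (gauss_on K) (below K N B t)
    \<le> measure (gauss_on K) (below K N A t)"
proof -
  define h where "h = (\<lambda>m z. 1 / (1 + exp ((real m)\<^sup>2 * z - ((real m)\<^sup>2 * t + real m))))"
  have h01: "0 \<le> h m z" "h m z \<le> 1" for m z
    unfolding h_def by (rule logistic_derivs, simp)+
  have hlim: "(\<lambda>m. h m z) \<longlonglongrightarrow> (if z \<le> t then 1 else 0)" for z
    unfolding h_def by (rule logistic_tendsto)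
  have [measurable]: "h m \<in> borel_measurable borel" for m unfolding h_def by measurable
  have [measurable]: "(\<lambda>x. \<Sum>k\<in>K. D i k * x k) \<in> borel_measurable (gauss_on K)" for i and D :: "'i \<Rightarrow> 'k \<Rightarrow> real"
    by measurable
  have lim: "(\<lambda>m. \<integral>x. (\<Prod>i\<in>N. h m (\<Sum>k\<in>K. D i k * x k)) \<partial>gauss_on K)
      \<longlonglongrightarrow> measure (gauss_on K) (below K N D t)" for D
  proof -
    let ?S = "below K N D t"
    have S: "?S \<in> sets (gauss_on K)" by (rule sets_below) (rule countable_finite[OF N])
    have "(\<lambda>m. \<integral>x. (\<Prod>i\<in>N. h m (\<Sum>k\<in>K. D i k * x k)) \<partial>gauss_on K) \<longlonglongrightarrow> (\<integral>x. indicator ?S x \<partial>gauss_on K)"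
    proof (rule integral_dominated_convergence[where w = "\<lambda>_. 1"])
      show "AE x in gauss_on K. (\<lambda>m. \<Prod>i\<in>N. h m (\<Sum>k\<in>K. D i k * x k)) \<longlonglongrightarrow> indicator ?S x"
      proof (rule AE_I2)
        fix x assume x: "x \<in> space (gauss_on K)"
        have "(\<lambda>m. \<Prod>i\<in>N. h m (\<Sum>k\<in>K. D i k * x k)) \<longlonglongrightarrow> (\<Prod>i\<in>N. if (\<Sum>k\<in>K. D i k * x k) \<le> t then 1 else 0)"
          by (intro tendsto_prod hlim)
        also have "(\<Prod>i\<in>N. if (\<Sum>k\<in>K. D i k * x k) \<le> t then 1 else 0) = (indicator ?S x :: real)"
        proof (cases "\<forall>i\<in>N. (\<Sum>k\<in>K. D i k * x k) \<le> t")
          case True then show ?thesis using x by simp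
        next
          case False
          then have "(\<Prod>i\<in>N. if (\<Sum>k\<in>K. D i k * x k) \<le> t then 1 else 0 :: real) = 0"
            using N by (intro prod_zero) auto
          then show ?thesis using False by simp
        qed
        finally show "(\<lambda>m. \<Prod>i\<in>N. h m (\<Sum>k\<in>K. D i k * x k)) \<longlonglongrightarrow> indicator ?S x" .
      qed
      show "AE x in gauss_on K. norm (\<Prod>i\<in>N. h m (\<Sum>k\<in>K. D i k * x k)) \<le> 1" for m
        using h01 by (intro AE_I2) (auto simp: abs_prod intro!: prod_le_1)
      show "(\<lambda>x. \<Prod>i\<in>N. h m (\<Sum>k\<in>K. D i k * x k)) \<in> borel_measurable (gauss_on K)" for m
        by (intro borel_measurable_prod) measurable
      show "indicator ?S \<in> borel_measurable (gauss_on K)" using S by measurable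
    qed simp
    then show ?thesis using S by simp
  qed
  show ?thesis
  proof (rule LIMSEQ_le[OF lim lim], intro exI allI impI)
    fix m
    show "(\<integral>x. (\<Prod>i\<in>N. h m (\<Sum>k\<in>K. B i k * x k)) \<partial>gauss_on K)
      \<le> (\<integral>x. (\<Prod>i\<in>N. h m (\<Sum>k\<in>K. A i k * x k)) \<partial>gauss_on K)"
    proof (rule slepian_smooth[where C = "(real m)\<^sup>2 + ((real m)\<^sup>2)\<^sup>2", OF N K])
      show "(h m has_real_derivative - (real m)\<^sup>2 * (h m z * (1 - h m z))) (at z)" for z
        unfolding h_def by (rule logistic_derivs) simp
      show "((\<lambda>z. - (real m)\<^sup>2 * (h m z * (1 - h m z))) has_real_derivative
          ((real m)\<^sup>2)\<^sup>2 * (h m z * (1 - h m z)) * (1 - 2 * h m z)) (at z)" for z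
        unfolding h_def by (rule logistic_derivs) simp
      have "isCont (h m) z" for z
        unfolding h_def by (rule DERIV_isCont[OF logistic_derivs(1)]) simp
      then show "isCont (\<lambda>z. ((real m)\<^sup>2)\<^sup>2 * (h m z * (1 - h m z)) * (1 - 2 * h m z)) z" for z
        by (intro continuous_intros)
      show "0 \<le> h m z" "h m z \<le> 1" for z by (rule h01)+
      show "- (real m)\<^sup>2 * (h m z * (1 - h m z)) \<le> 0"
           "\<bar>- (real m)\<^sup>2 * (h m z * (1 - h m z))\<bar> \<le> (real m)\<^sup>2 + ((real m)\<^sup>2)\<^sup>2"
           "\<bar>((real m)\<^sup>2)\<^sup>2 * (h m z * (1 - h m z)) * (1 - 2 * h m z)\<bar> \<le> (real m)\<^sup>2 + ((real m)\<^sup>2)\<^sup>2" for z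
        unfolding h_def by (rule logistic_derivs, simp)+
    qed (use orth var cov in auto)
  qed
qed

text \<open>An injective selection of coordinates from an independent standard Gaussian family is
  again such a family. This moves processes with different index sets onto a common one.\<close>

lemma gauss_on_marginal:
  assumes f: "inj_on f K" "f ` K \<subseteq> K'" and S: "{x \<in> space (gauss_on K). \<Phi> x} \<in> sets (gauss_on K)"
  shows "measure (gauss_on K') {x \<in> space (gauss_on K'). \<Phi> (\<lambda>n\<in>K. x (f n))}
    = measure (gauss_on K) {x \<in> space (gauss_on K). \<Phi> x}"
proof -
  let ?r = "\<lambda>x. \<lambda>n\<in>K. x (f n)"
  have D: "distr (gauss_on K') (gauss_on K) ?r = gauss_on K"
    unfolding gauss_on_def by (rule distr_PiM_reindex) (use f prob_space_std_gauss in auto)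
  have r: "?r \<in> measurable (gauss_on K') (gauss_on K)"
    unfolding gauss_on_def using f by (intro measurable_restrict) auto
  have "measure (gauss_on K) {x \<in> space (gauss_on K). \<Phi> x} = measure (distr (gauss_on K') (gauss_on K) ?r) {x \<in> space (gauss_on K). \<Phi> x}"
    unfolding D ..
  also have "\<dots> = measure (gauss_on K') (?r -` {x \<in> space (gauss_on K). \<Phi> x} \<inter> space (gauss_on K'))"
    by (rule measure_distr[OF r S])
  also have "?r -` {x \<in> space (gauss_on K). \<Phi> x} \<inter> space (gauss_on K') = {x \<in> space (gauss_on K'). \<Phi> (?r x)}"
    using measurable_space[OF r] by auto
  finally show ?thesis by simp
qed

theorem slepian:
  fixes A :: "'i \<Rightarrow> 'k \<Rightarrow> real" and B :: "'i \<Rightarrow> 'l \<Rightarrow> real"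
  assumes N: "finite N" and K: "finite K" and L: "finite L"
    and var: "\<And>i. i \<in> N \<Longrightarrow> (\<Sum>k\<in>K. A i k * A i k) = (\<Sum>l\<in>L. B i l * B i l)"
    and cov: "\<And>i j. i \<in> N \<Longrightarrow> j \<in> N \<Longrightarrow> (\<Sum>l\<in>L. B i l * B j l) \<le> (\<Sum>k\<in>K. A i k * A j k)"
  shows "measure (gauss_on L) (below L N B t)
    \<le> measure (gauss_on K) (below K N A t)"
proof -
  \<comment> \<open>Extension by zero to the disjoint union lets the two processes use independent
    blocks of coordinates: every row of \<open>A'\<close> is orthogonal to every row of
    \<open>B'\<close>.\<close>
  define A' where "A' = (\<lambda>i. case_sum (A i) (\<lambda>_ :: 'l. 0))"
  define B' where "B' = (\<lambda>i. case_sum (\<lambda>_ :: 'k. 0) (B i))"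
  let ?M = "K <+> L"
  note plus = sum.Plus[OF K L] comp_def A'_def B'_def
  have "measure (gauss_on ?M) (below ?M N B' t)
    \<le> measure (gauss_on ?M) (below ?M N A' t)"
    by (rule slepian_orthogonal) (use assms in \<open>simp_all add: plus\<close>)
  moreover have "measure (gauss_on ?M) (below ?M N A' t)
    = measure (gauss_on K) (below K N A t)"
    by (subst gauss_on_marginal[symmetric, where f = Inl and K' = ?M])
      (auto simp: plus countable_finite[OF N] intro!: sets_below)
  moreover have "measure (gauss_on ?M) (below ?M N B' t)
    = measure (gauss_on L) (below L N B t)"
    by (subst gauss_on_marginal[symmetric, where f = Inr and K' = ?M])
      (auto simp: plus countable_finite[OF N] intro!: sets_below)
  ultimately show ?thesis by simp
qed

text \<open>Initial segments of an enumeration exhaust \<open>T\<close>. The corresponding events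
  decrease, and continuity from above carries the finite comparison to the limit.\<close>

lemma slepian_countable:
  fixes A :: "'i \<Rightarrow> 'k \<Rightarrow> real" and B :: "'i \<Rightarrow> 'l \<Rightarrow> real"
  assumes T: "countable T" and K: "finite K" and L: "finite L"
    and var: "\<And>i. i \<in> T \<Longrightarrow> (\<Sum>k\<in>K. A i k * A i k) = (\<Sum>l\<in>L. B i l * B i l)"
    and cov: "\<And>i j. i \<in> T \<Longrightarrow> j \<in> T \<Longrightarrow> (\<Sum>l\<in>L. B i l * B j l) \<le> (\<Sum>k\<in>K. A i k * A j k)"
  shows "measure (gauss_on L) (below L T B t)
    \<le> measure (gauss_on K) (below K T A t)"
proof (cases "T = {}")
  case True
  then show ?thesis by (simp add: gauss_on.prob_space)
next
  case False
  define e where "e = (\<lambda>n. from_nat_into T ` {..n::nat})"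
  have Te: "T = (\<Union>n. e n)"
    unfolding e_def using range_from_nat_into[OF False T] by (auto simp flip: image_UN)
  have fe: "finite (e n)" for n by (simp add: e_def)
  have mono: "e m \<subseteq> e n" if "m \<le> n" for m n using that by (auto simp: e_def)
  have lim: "(\<lambda>n. measure (gauss_on M) (below M (e n) D t))
    \<longlonglongrightarrow> measure (gauss_on M) (below M T D t)"
    for M :: "'m set" and D :: "'i \<Rightarrow> 'm \<Rightarrow> real"
  proof -
    let ?E = "\<lambda>n. below M (e n) D t"
    have "(\<lambda>n. measure (gauss_on M) (?E n)) \<longlonglongrightarrow> measure (gauss_on M) (\<Inter>n. ?E n)"
      by (rule gauss_on.finite_Lim_measure_decseq)
        (use mono in \<open>auto simp: decseq_def countable_finite[OF fe] intro!: sets_below\<close>)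
    also have "(\<Inter>n. ?E n) = below M T D t"
      using Te by auto
    finally show ?thesis .
  qed
  show ?thesis
  proof (rule LIMSEQ_le[OF lim lim], intro exI allI impI)
    fix n
    have eT: "i \<in> T" if "i \<in> e n" for i using Te that by auto
    show "measure (gauss_on L) (below L (e n) B t)
      \<le> measure (gauss_on K) (below K (e n) A t)"
      by (intro slepian fe K L var cov eT)
  qed
qed

text \<open>Reflection at 0 exchanges the two half-lines, which together cover the line.\<close>

lemma std_gauss_nonneg: "measure std_gauss {0..} \<ge> 1 / 2"
proof -
  have "emeasure std_gauss {0..} = (\<integral>\<^sup>+x. ennreal (std_normal_density x) * indicator {0..} x \<partial>lborel)"
    by (rule emeasure_density) auto
  also have "\<dots> = ennreal \<bar>-1\<bar> * (\<integral>\<^sup>+x. ennreal (std_normal_density (0 + (-1) * x)) * indicator {0..} (0 + (-1) * x) \<partial>lborel)"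
    by (rule nn_integral_real_affine) auto
  also have "\<dots> = (\<integral>\<^sup>+x. ennreal (std_normal_density x) * indicator {..0} x \<partial>lborel)"
    by (auto simp: std_normal_density_def indicator_def intro!: nn_integral_cong)
  also have "\<dots> = emeasure std_gauss {..0}"
    by (rule emeasure_density[symmetric]) auto
  finally have eq: "measure std_gauss {0..} = measure std_gauss {..0}" by (simp add: measure_def)
  have "1 = measure std_gauss (space std_gauss)" by (rule std_gauss.prob_space[symmetric])
  also have "space std_gauss = {0..} \<union> {..0::real}" by auto
  also have "measure std_gauss ({0..} \<union> {..0}) \<le> measure std_gauss {0..} + measure std_gauss {..0}"
    by (rule measure_Un_le) auto
  finally show ?thesis using eq by simp
qed

text \<open>An independent Gaussian $c\xi$ is added to the first process to match the variances.
  Since $\xi \ge 0$ with probability at least $1/2$, removing it costs a factor two.\<close>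

theorem slepian_shifted:
  fixes A :: "'i \<Rightarrow> 'k \<Rightarrow> real" and B :: "'i \<Rightarrow> 'l \<Rightarrow> real"
  assumes T: "countable T" and K: "finite K" and L: "finite L" and c: "0 \<le> c"
    and var: "\<And>i. i \<in> T \<Longrightarrow> (\<Sum>k\<in>K. A i k * A i k) + c * c = (\<Sum>l\<in>L. B i l * B i l)"
    and cov: "\<And>i j. i \<in> T \<Longrightarrow> j \<in> T \<Longrightarrow> (\<Sum>l\<in>L. B i l * B j l) \<le> (\<Sum>k\<in>K. A i k * A j k) + c * c"
  shows "1 - measure (gauss_on K) (below K T A t)
    \<le> 2 * (1 - measure (gauss_on L) (below L T B t))"
proof -
  \<comment> \<open>The additional index \<open>None\<close> carries \<xi>, with the same
    coefficient \<open>c\<close> for every \<open>i\<close>.\<close>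
  define A' where "A' = (\<lambda>i. case_option c (A i))"
  let ?J = "Some ` K"
  let ?M = "insert None ?J"
  have fin: "finite ?J" "finite ?M" "None \<notin> ?J" using K by auto
  have sumM: "(\<Sum>k\<in>?M. f k) = f None + (\<Sum>k\<in>K. f (Some k))" for f :: "'k option \<Rightarrow> real"
    using fin by (simp add: sum.reindex)
  let ?good = "below ?M T A' t"
  let ?G = "below K T A t"
  let ?G' = "below ?J T A' t"
  have sl: "measure (gauss_on L) (below L T B t) \<le> measure (gauss_on ?M) ?good"
    by (rule slepian_countable[OF T fin(2) L]) (use var cov in \<open>auto simp: sumM A'_def add.commute\<close>)
  have GG': "measure (gauss_on ?J) ?G' = measure (gauss_on K) ?G"
    by (subst gauss_on_marginal[symmetric, where f = Some and K' = ?J and K = K])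
      (auto simp: sum.reindex A'_def intro!: sets_below T)
  \<comment> \<open>If the process without \<xi> exceeds \<open>t\<close> somewhere and \<xi> \<ge>
    0, then the shifted process exceeds \<open>t\<close> as well. So \<open>U\<close> is disjoint
    from the good event of the shifted process, and by independence its probability is a
    product.\<close>
  define U where "U = {x \<in> space (gauss_on ?M). \<not> (\<forall>i\<in>T. (\<Sum>k\<in>?J. A' i k * x k) \<le> t) \<and> 0 \<le> x None}"
  have [measurable]: "(\<lambda>x. \<Sum>k\<in>?J. A' i k * x k) \<in> borel_measurable (gauss_on ?M)" for i
    by (intro borel_measurable_sum borel_measurable_times borel_measurable_const measurable_coord) auto
  have [measurable]: "{x \<in> space (gauss_on ?M). (\<forall>i\<in>T. (\<Sum>k\<in>?J. A' i k * x k) \<le> t)} \<in> sets (gauss_on ?M)"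
    by (rule sets.sets_Collect_countable_All'[OF _ T]) measurable
  have [measurable]: "(\<lambda>x. x None) \<in> borel_measurable (gauss_on ?M)" by (rule measurable_coord) simp
  have U: "U \<in> sets (gauss_on ?M)"
    unfolding U_def by (intro sets.sets_Collect_conj sets.sets_Collect_neg) measurable
  have "measure (gauss_on ?M) U = (\<integral>x. indicator U x \<partial>gauss_on ?M)"
    using U by simp
  also have "\<dots> = (\<integral>x. (\<integral>y. indicator U (x(None := y)) \<partial>std_gauss) \<partial>gauss_on ?J)"
    by (rule integral_gauss_insert[OF fin(1,3)]) (use U in \<open>auto simp: gauss_on.emeasure_eq_measure\<close>)
  also have "\<dots> = (\<integral>x. indicator (space (gauss_on ?J) - ?G') x * measure std_gauss {0..} \<partial>gauss_on ?J)"
  proof (rule Bochner_Integration.integral_cong[OF refl])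
    fix x assume x: "x \<in> space (gauss_on ?J)"
    have "indicator U (x(None := y)) = indicator (space (gauss_on ?J) - ?G') x * (indicator {0..} y :: real)" for y
    proof -
      have "x(None := y) \<in> space (gauss_on ?M)" using x by (auto simp: space_gauss_on PiE_iff extensional_def)
      moreover have "(\<Sum>k\<in>?J. A' i k * (x(None := y)) k) = (\<Sum>k\<in>?J. A' i k * x k)" for i
        by (intro sum.cong) auto
      ultimately show ?thesis using x by (auto simp: U_def indicator_def)
    qed
    then show "(\<integral>y. indicator U (x(None := y)) \<partial>std_gauss) = indicator (space (gauss_on ?J) - ?G') x * measure std_gauss {0..}"
      by simp
  qed
  also have "\<dots> = measure (gauss_on ?J) (space (gauss_on ?J) - ?G') * measure std_gauss {0..}"
    using sets_below[OF T, of ?J A' t] by simp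
  also have "measure (gauss_on ?J) (space (gauss_on ?J) - ?G') = 1 - measure (gauss_on K) ?G"
    using gauss_on.prob_compl[OF sets_below[OF T, of ?J A' t]] GG' by simp
  finally have mU: "measure (gauss_on ?M) U = (1 - measure (gauss_on K) ?G) * measure std_gauss {0..}" .
  have "?good \<inter> U = {}"
  proof (rule ccontr)
    assume "?good \<inter> U \<noteq> {}"
    then obtain x where x: "x \<in> ?good" "x \<in> U" by blast
    then obtain i where i: "i \<in> T" "t < (\<Sum>k\<in>?J. A' i k * x k)" "0 \<le> x None" by (auto simp: U_def not_le)
    have "(\<Sum>k\<in>?M. A' i k * x k) = c * x None + (\<Sum>k\<in>?J. A' i k * x k)"
      using fin by (simp add: A'_def)
    then have "t < (\<Sum>k\<in>?M. A' i k * x k)" using i c by (simp add: add_nonneg_pos order_less_le_trans)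
    then show False using x i by force
  qed
  then have "measure (gauss_on ?M) ?good + measure (gauss_on ?M) U = measure (gauss_on ?M) (?good \<union> U)"
    using sets_below[OF T, of ?M A' t] U by (intro gauss_on.finite_measure_Union[symmetric]) auto
  also have "\<dots> \<le> 1" by (rule gauss_on.prob_le_1)
  finally have "measure (gauss_on ?M) U \<le> 1 - measure (gauss_on ?M) ?good" by simp
  moreover have "(1 - measure (gauss_on K) ?G) * (1 / 2) \<le> measure (gauss_on ?M) U"
    unfolding mU by (intro mult_left_mono std_gauss_nonneg) simp
  ultimately show ?thesis using sl by simp
qed

section \<open>Suprema of Gaussian processes\<close>

lemma integral_coord_mult:
  fixes f :: "real \<Rightarrow> real"
  assumes K: "finite K" "k \<in> K" "l \<in> K" "k \<noteq> l" and f: "integrable std_gauss f" "(\<integral>x. f x \<partial>std_gauss) = 0"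
  shows "integrable (gauss_on K) (\<lambda>x. f (x k) * f (x l))" "(\<integral>x. f (x k) * f (x l) \<partial>gauss_on K) = 0"
proof -
  interpret P: product_sigma_finite "\<lambda>_ :: 'a. std_gauss" by unfold_locales
  define F where "F = (\<lambda>i. if i = k \<or> i = l then f else (\<lambda>_. 1))"
  have eq: "(\<Prod>i\<in>K. F i (x i)) = f (x k) * f (x l)" for x
  proof -
    have "(\<Prod>i\<in>K. F i (x i)) = (\<Prod>i\<in>{k, l}. F i (x i))"
      by (rule prod.mono_neutral_right) (use K in \<open>auto simp: F_def\<close>)
    then show ?thesis using K by (simp add: F_def)
  qed
  have iF: "integrable std_gauss (F i)" for i
    using f by (auto simp: F_def)
  have "integrable (gauss_on K) (\<lambda>x. \<Prod>i\<in>K. F i (x i))"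
    unfolding gauss_on_def by (rule P.product_integrable_prod[OF K(1) iF])
  then show "integrable (gauss_on K) (\<lambda>x. f (x k) * f (x l))" by (simp add: eq)
  have "(\<integral>x. (\<Prod>i\<in>K. F i (x i)) \<partial>gauss_on K) = (\<Prod>i\<in>K. integral\<^sup>L std_gauss (F i))"
    unfolding gauss_on_def by (rule P.product_integral_prod[OF K(1) iF])
  also have "\<dots> = 0" using K f by (intro prod_zero) (auto simp: F_def)
  finally show "(\<integral>x. f (x k) * f (x l) \<partial>gauss_on K) = 0" by (simp add: eq)
qed

text \<open>Distinct coordinates contribute orthogonal terms, so the second moment of the sum is
  \<open>card S * v\<close>. The subset \<open>S\<close> allows for the diagonal coordinates, whose
  sum is the trace.\<close>

lemma gauss_sum_chebyshev:
  fixes f :: "real \<Rightarrow> real"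
  assumes K: "finite K" "S \<subseteq> K" and [measurable]: "f \<in> borel_measurable borel"
    and f: "integrable std_gauss f" "(\<integral>x. f x \<partial>std_gauss) = 0"
    and f2: "integrable std_gauss (\<lambda>x. f x * f x)" "(\<integral>x. f x * f x \<partial>std_gauss) = v"
    and a: "0 < a"
  shows "measure (gauss_on K) {x \<in> space (gauss_on K). a \<le> \<bar>\<Sum>k\<in>S. f (x k)\<bar>} \<le> real (card S) * v / a\<^sup>2"
    and "{x \<in> space (gauss_on K). a \<le> \<bar>\<Sum>k\<in>S. f (x k)\<bar>} \<in> sets (gauss_on K)"
proof -
  have fin: "finite S" using K finite_subset by blast
  have mc: "(\<lambda>x. x k) \<in> borel_measurable (gauss_on K)" if "k \<in> S" for k
    using that K by (intro measurable_coord) auto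
  have [measurable]: "(\<lambda>x. \<Sum>k\<in>S. f (x k)) \<in> borel_measurable (gauss_on K)"
    by (intro borel_measurable_sum measurable_compose[OF mc]) auto
  show "{x \<in> space (gauss_on K). a \<le> \<bar>\<Sum>k\<in>S. f (x k)\<bar>} \<in> sets (gauss_on K)" by measurable
  have int: "integrable (gauss_on K) (\<lambda>x. f (x k) * f (x l))"
    "(\<integral>x. f (x k) * f (x l) \<partial>gauss_on K) = (if k = l then v else 0)" if "k \<in> S" "l \<in> S" for k l
  proof -
    have kl: "k \<in> K" "l \<in> K" using that K by auto
    have m2: "(\<lambda>x. f x * f x) \<in> borel_measurable borel" by measurable
    show "integrable (gauss_on K) (\<lambda>x. f (x k) * f (x l))"
      using integral_coord_mult(1)[OF K(1) kl _ f] integral_coord_comp(1)[OF K(1) kl(1) m2 f2(1)] by (cases "k = l") auto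
    show "(\<integral>x. f (x k) * f (x l) \<partial>gauss_on K) = (if k = l then v else 0)"
      using integral_coord_mult(2)[OF K(1) kl _ f] integral_coord_comp(2)[OF K(1) kl(1) m2 f2(1)] f2(2) by auto
  qed
  have sq: "(\<Sum>k\<in>S. f (x k))\<^sup>2 = (\<Sum>k\<in>S. \<Sum>l\<in>S. f (x k) * f (x l))" for x
    by (simp add: power2_eq_square sum_product)
  have i2: "integrable (gauss_on K) (\<lambda>x. (\<Sum>k\<in>S. f (x k))\<^sup>2)"
    unfolding sq by (intro Bochner_Integration.integrable_sum int)
  have "(\<integral>x. (\<Sum>k\<in>S. f (x k))\<^sup>2 \<partial>gauss_on K) = (\<Sum>k\<in>S. \<Sum>l\<in>S. (\<integral>x. f (x k) * f (x l) \<partial>gauss_on K))"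
    unfolding sq by (subst Bochner_Integration.integral_sum, intro Bochner_Integration.integrable_sum int, assumption+)
      (intro sum.cong refl Bochner_Integration.integral_sum int)
  also have "\<dots> = (\<Sum>k\<in>S. \<Sum>l\<in>S. if k = l then v else 0)"
    by (intro sum.cong refl int)
  also have "\<dots> = real (card S) * v" using fin by simp
  finally have e2: "(\<integral>x. (\<Sum>k\<in>S. f (x k))\<^sup>2 \<partial>gauss_on K) = real (card S) * v" .
  have "measure (gauss_on K) {x \<in> space (gauss_on K). a \<le> \<bar>\<Sum>k\<in>S. f (x k)\<bar>}
      = measure (gauss_on K) {x \<in> space (gauss_on K). (\<Sum>k\<in>S. f (x k))\<^sup>2 \<ge> a\<^sup>2}"
    using a by (intro arg_cong[where f = "measure _"] Collect_cong conj_cong refl)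
      (metis abs_le_square_iff abs_of_pos)
  also have "\<dots> \<le> (\<integral>x. (\<Sum>k\<in>S. f (x k))\<^sup>2 \<partial>gauss_on K) / a\<^sup>2"
    using a by (intro integral_Markov_inequality_measure[OF i2, where A = "space (gauss_on K)"]) auto
  finally show "measure (gauss_on K) {x \<in> space (gauss_on K). a \<le> \<bar>\<Sum>k\<in>S. f (x k)\<bar>} \<le> real (card S) * v / a\<^sup>2"
    unfolding e2 .
qed

lemma std_gauss_moments:
  "(\<integral>x. x \<partial>std_gauss) = 0" "(\<integral>x. x\<^sup>2 \<partial>std_gauss) = 1" "(\<integral>x. x ^ 4 \<partial>std_gauss) = 3"
proof -
  show "(\<integral>x. x \<partial>std_gauss) = 0"
    using integral_std_normal_moment_odd[of 0] by (simp add: integral_std_gauss)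
  show "(\<integral>x. x\<^sup>2 \<partial>std_gauss) = 1"
    using integral_std_normal_moment_even[of 1] by (simp add: integral_std_gauss)
  show "(\<integral>x. x ^ 4 \<partial>std_gauss) = 3"
    using integral_std_normal_moment_even[of 2] by (simp add: integral_std_gauss fact_numeral)
qed

lemma chi_square_deviation:
  assumes K: "finite K" and a: "0 < a"
  shows "measure (gauss_on K) {x \<in> space (gauss_on K). a \<le> \<bar>(\<Sum>k\<in>K. (x k)\<^sup>2) - real (card K)\<bar>}
      \<le> 2 * real (card K) / a\<^sup>2"
    and "{x \<in> space (gauss_on K). a \<le> \<bar>(\<Sum>k\<in>K. (x k)\<^sup>2) - real (card K)\<bar>} \<in> sets (gauss_on K)"
proof -
  let ?f = "\<lambda>x::real. x\<^sup>2 - 1"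
  \<comment> \<open>With the moments 3 and 1 the expectation is 3 - 2 + 1 = 2, the constant in the
    bound.\<close>
  have sq: "?f x * ?f x = x ^ 4 - 2 * x\<^sup>2 + 1" for x by (simp add: algebra_simps power4_eq_xxxx power2_eq_square)
  note i = integrable_std_gauss_power[of 2] integrable_std_gauss_power[of 4]
  have 1: "integrable std_gauss ?f" "(\<integral>x. ?f x \<partial>std_gauss) = 0"
    using i std_gauss_moments std_gauss.prob_space by simp_all
  have 2: "integrable std_gauss (\<lambda>x. ?f x * ?f x)" "(\<integral>x. ?f x * ?f x \<partial>std_gauss) = 2"
    unfolding sq using i std_gauss_moments std_gauss.prob_space by simp_all
  have eq: "(\<Sum>k\<in>K. ?f (x k)) = (\<Sum>k\<in>K. (x k)\<^sup>2) - real (card K)" for x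
    by (simp add: sum_subtractf)
  have m: "?f \<in> borel_measurable borel" by measurable
  show "measure (gauss_on K) {x \<in> space (gauss_on K). a \<le> \<bar>(\<Sum>k\<in>K. (x k)\<^sup>2) - real (card K)\<bar>}
      \<le> 2 * real (card K) / a\<^sup>2"
    using gauss_sum_chebyshev(1)[OF K order_refl m 1 2 a] unfolding eq by (simp add: mult.commute)
  show "{x \<in> space (gauss_on K). a \<le> \<bar>(\<Sum>k\<in>K. (x k)\<^sup>2) - real (card K)\<bar>} \<in> sets (gauss_on K)"
    using gauss_sum_chebyshev(2)[OF K order_refl m 1 2 a] unfolding eq .
qed

text \<open>One point of \<open>V\<close> is picked from each basic open set that meets
  \<open>V\<close>. The points must lie in \<open>V\<close> itself because the covariance relations
  are only available there.\<close>

lemma countable_dense_in: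
  fixes V :: "'a::second_countable_topology set"
  obtains T where "countable T" "T \<subseteq> V" "V \<subseteq> closure T"
proof -
  obtain \<B> :: "'a set set" where B: "countable \<B>" "\<And>C. C \<in> \<B> \<Longrightarrow> open C"
    "\<And>S. open S \<Longrightarrow> \<exists>U. U \<subseteq> \<B> \<and> S = \<Union>U"
    by (rule univ_second_countable) blast
  define \<B>' where "\<B>' = {C \<in> \<B>. C \<inter> V \<noteq> {}}"
  define p where "p = (\<lambda>C. SOME v. v \<in> C \<inter> V)"
  have p: "p C \<in> C \<inter> V" if "C \<in> \<B>'" for C
  proof -
    have "\<exists>v. v \<in> C \<inter> V" using that by (auto simp: \<B>'_def)
    then show ?thesis unfolding p_def by (rule someI_ex)
  qed
  show thesis
  proof (rule that[of "p ` \<B>'"])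
    show "countable (p ` \<B>')" using B(1) by (auto simp: \<B>'_def intro: countable_subset)
    show "p ` \<B>' \<subseteq> V" using p by auto
    show "V \<subseteq> closure (p ` \<B>')"
    proof
      fix v assume v: "v \<in> V"
      show "v \<in> closure (p ` \<B>')"
        unfolding closure_iff_nhds_not_empty
      proof (intro allI impI)
        fix A U :: "'a set" assume A: "U \<subseteq> A" "open U" "v \<in> U"
        then obtain C where "C \<in> \<B>" "v \<in> C" "C \<subseteq> U" using B(3)[of U] by blast
        then have "C \<in> \<B>'" "p C \<in> A" using p[of C] v A by (auto simp: \<B>'_def)
        then show "p ` \<B>' \<inter> A \<noteq> {}" by blast
      qed
    qed
  qed
qed

lemma le_on_closure:
  fixes f :: "'a::topological_space \<Rightarrow> real"
  assumes "continuous_on UNIV f" "\<And>v. v \<in> T \<Longrightarrow> f v \<le> t" "v \<in> closure T"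
  shows "f v \<le> t"
proof -
  have "closed {v. f v \<le> t}" by (intro closed_Collect_le assms continuous_on_const)
  then have "closure T \<subseteq> {v. f v \<le> t}" using assms(2) by (intro closure_minimal) auto
  then show ?thesis using assms(3) by auto
qed

text \<open>By Cauchy-Schwarz the linear process is at most sqrt s |y|, so it stays below
  \<open>t\<close> as soon as |y|^2 \<le> t^2 / s. The chi-square deviation with margin t^2 / s -
  card L bounds the failure by 2 card L / margin^2, and the shift by \<open>c\<close> doubles this
  to the factor 4. Continuity in \<open>v\<close> replaces \<open>V\<close> by a countable dense
  subset, which also makes the event measurable.\<close>

theorem gaussian_sup_bound:
  fixes A :: "'i::second_countable_topology \<Rightarrow> 'k \<Rightarrow> real" and B :: "'i \<Rightarrow> 'l \<Rightarrow> real"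
  assumes K: "finite K" and L: "finite L" and c: "0 \<le> c" and s: "0 < s" and t: "0 < t"
    and cont: "\<And>k. k \<in> K \<Longrightarrow> continuous_on UNIV (\<lambda>v. A v k)"
    and var: "\<And>v. v \<in> V \<Longrightarrow> (\<Sum>k\<in>K. A v k * A v k) + c * c = s"
    and varB: "\<And>v. v \<in> V \<Longrightarrow> (\<Sum>l\<in>L. B v l * B v l) = s"
    and cov: "\<And>v w. v \<in> V \<Longrightarrow> w \<in> V \<Longrightarrow> (\<Sum>l\<in>L. B v l * B w l) \<le> (\<Sum>k\<in>K. A v k * A w k) + c * c"
    and ts: "real (card L) < t\<^sup>2 / s"
  shows "below K V A t \<in> sets (gauss_on K)"
    and "1 - measure (gauss_on K) (below K V A t)
      \<le> 4 * real (card L) / (t\<^sup>2 / s - real (card L))\<^sup>2"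
proof -
  obtain T where T: "countable T" "T \<subseteq> V" "V \<subseteq> closure T" by (rule countable_dense_in)
  have "continuous_on UNIV (\<lambda>v. \<Sum>k\<in>K. A v k * x k)" for x
    by (intro continuous_on_sum continuous_on_mult cont continuous_on_const)
  then have "(\<Sum>k\<in>K. A v k * x k) \<le> t" if "v \<in> V" "\<And>v. v \<in> T \<Longrightarrow> (\<Sum>k\<in>K. A v k * x k) \<le> t" for v x
    by (rule le_on_closure[where T = T and f = "\<lambda>v. \<Sum>k\<in>K. A v k * x k", OF _ that(2) subsetD[OF T(3) that(1)]])
  then have eq: "below K V A t
      = below K T A t"
    using T(2) by blast
  show "below K V A t \<in> sets (gauss_on K)"
    unfolding eq by (rule sets_below[OF T(1)])
  let ?a = "t\<^sup>2 / s - real (card L)"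
  let ?bad = "{y \<in> space (gauss_on L). ?a \<le> \<bar>(\<Sum>l\<in>L. (y l)\<^sup>2) - real (card L)\<bar>}"
  let ?ok = "below L T B t"
  have a: "0 < ?a" using ts by simp
  have sub: "space (gauss_on L) - ?bad \<subseteq> ?ok"
  proof
    fix y assume y: "y \<in> space (gauss_on L) - ?bad"
    then have le: "(\<Sum>l\<in>L. (y l)\<^sup>2) \<le> t\<^sup>2 / s" by auto
    have "(\<Sum>l\<in>L. B v l * y l) \<le> t" if "v \<in> T" for v
    proof -
      have "(\<Sum>l\<in>L. B v l * y l)\<^sup>2 \<le> (\<Sum>l\<in>L. (B v l)\<^sup>2) * (\<Sum>l\<in>L. (y l)\<^sup>2)"
        by (rule Cauchy_Schwarz_ineq_sum)
      also have "(\<Sum>l\<in>L. (B v l)\<^sup>2) = s" using varB[of v] that T(2) by (auto simp: power2_eq_square)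
      also have "s * (\<Sum>l\<in>L. (y l)\<^sup>2) \<le> s * (t\<^sup>2 / s)" using le s by (intro mult_left_mono) auto
      also have "\<dots> = t\<^sup>2" using s by simp
      finally show ?thesis using t by (simp add: power2_le_iff_abs_le)
    qed
    then show "y \<in> ?ok" using y by auto
  qed
  have "measure (gauss_on L) (space (gauss_on L) - ?bad) \<le> measure (gauss_on L) ?ok"
    by (rule gauss_on.finite_measure_mono[OF sub sets_below[OF T(1)]])
  moreover have "measure (gauss_on L) (space (gauss_on L) - ?bad) = 1 - measure (gauss_on L) ?bad"
    by (rule gauss_on.prob_compl[OF chi_square_deviation(2)[OF L a]])
  moreover have "measure (gauss_on L) ?bad \<le> 2 * real (card L) / ?a\<^sup>2"
    by (rule chi_square_deviation(1)[OF L a])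
  moreover have "1 - measure (gauss_on K) (below K T A t)
      \<le> 2 * (1 - measure (gauss_on L) ?ok)"
    by (rule slepian_shifted[OF T(1) K L c]) (auto simp: var[OF subsetD[OF T(2)]] varB[OF subsetD[OF T(2)]] intro!: cov subsetD[OF T(2)])
  ultimately show "1 - measure (gauss_on K) (below K V A t)
      \<le> 4 * real (card L) / ?a\<^sup>2"
    unfolding eq by simp
qed

section \<open>Gaussian Hermitian matrices\<close>

lemma inj_on_flat: "inj_on (flat d) (bip d)"
proof (rule inj_onI)
  fix i j assume ij: "i \<in> bip d" "j \<in> bip d" "flat d i = flat d j"
  obtain a b a' b' where [simp]: "i = (a, b)" "j = (a', b')" by (cases i, cases j)
  have b: "b < d" "b' < d" and eq: "a * d + b = a' * d + b'" using ij by (auto simp: flat_def)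
  have "(a * d + b) div d = (a' * d + b') div d" "(a * d + b) mod d = (a' * d + b') mod d" by (simp_all add: eq)
  then show "i = j" using b by simp
qed

definition upper_pairs :: "nat \<Rightarrow> ((nat \<times> nat) \<times> (nat \<times> nat)) set" where
  "upper_pairs d = {(i, j). i \<in> bip d \<and> j \<in> bip d \<and> flat d i < flat d j}"

text \<open>Since \<open>flat\<close> is injective, every off-diagonal pair is ordered one way or
  the other; this is the case distinction of \<open>herm_of\<close>.\<close>

lemma sum_bip_split:
  fixes f :: "nat \<times> nat \<Rightarrow> nat \<times> nat \<Rightarrow> 'c::comm_monoid_add"
  shows "(\<Sum>(i, j)\<in>bip d \<times> bip d. f i j) = (\<Sum>i\<in>bip d. f i i) + (\<Sum>(i, j)\<in>upper_pairs d. f i j + f j i)"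
proof -
  have fu: "finite (upper_pairs d)" unfolding upper_pairs_def by (rule finite_subset[of _ "bip d \<times> bip d"]) auto
  let ?D = "(\<lambda>i. (i, i)) ` bip d"
  let ?L = "prod.swap ` upper_pairs d"
  have split: "bip d \<times> bip d = ?D \<union> (upper_pairs d \<union> ?L)"
  proof (intro equalityI subsetI)
    fix p assume p: "p \<in> bip d \<times> bip d"
    obtain i j where [simp]: "p = (i, j)" by (cases p)
    have ij: "i \<in> bip d" "j \<in> bip d" using p by auto
    consider "i = j" | "flat d i < flat d j" | "flat d j < flat d i"
      using inj_onD[OF inj_on_flat _ ij] by fastforce
    then show "p \<in> ?D \<union> (upper_pairs d \<union> ?L)"
    proof cases
      case 3
      then have "(j, i) \<in> upper_pairs d" using ij by (simp add: upper_pairs_def del: mem_Sigma_iff)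
      then show ?thesis by force
    qed (use ij in \<open>auto simp: upper_pairs_def\<close>)
  qed (auto simp: upper_pairs_def)
  have "(\<Sum>(i, j)\<in>bip d \<times> bip d. f i j) = (\<Sum>(i, j)\<in>?D. f i j) + ((\<Sum>(i, j)\<in>upper_pairs d. f i j) + (\<Sum>(i, j)\<in>?L. f i j))"
    unfolding split by (subst sum.union_disjoint, use fu in \<open>auto simp: upper_pairs_def\<close>)
      (subst sum.union_disjoint, use fu in \<open>auto simp: upper_pairs_def\<close>)
  also have "(\<Sum>(i, j)\<in>?D. f i j) = (\<Sum>i\<in>bip d. f i i)"
    by (subst sum.reindex) (auto simp: inj_on_def)
  also have "(\<Sum>(i, j)\<in>?L. f i j) = (\<Sum>(i, j)\<in>upper_pairs d. f j i)"
    by (subst sum.reindex) (auto simp: inj_on_def prod.swap_def case_prod_beta)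
  finally show ?thesis by (simp add: sum.distrib case_prod_beta)
qed

lemma sum_pair_cong:
  "(\<And>i j. (i, j) \<in> S \<Longrightarrow> f i j = g i j) \<Longrightarrow> (\<Sum>(i, j)\<in>S. f i j) = (\<Sum>(i, j)\<in>S. g i j)"
  by (intro sum.cong refl) (metis case_prod_conv surj_pair)

lemma hs_inner_eq: "hs_inner d X Y = (\<Sum>(i, j)\<in>bip d \<times> bip d. Re (X i j * Y j i))"
  unfolding hs_inner_def mtrace_mmul sum.cartesian_product Re_sum
  by (intro sum.cong refl) (simp only: case_prod_beta)

text \<open>The coordinates of \<open>H\<close> in the orthonormal basis behind
  \<open>herm_of\<close>. The factor sqrt 2 accounts for the two conjugate entries; the minus sign
  arises because the imaginary part is read off the lower entry, the conjugate of the upper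
  one.\<close>

definition herm_coef :: "nat \<Rightarrow> (nat \<times> nat) cmat \<Rightarrow> (nat \<times> nat) \<times> (nat \<times> nat) \<Rightarrow> real" where
  "herm_coef d H k = (if fst k = snd k then Re (H (fst k) (fst k))
     else if flat d (fst k) < flat d (snd k) then sqrt 2 * Re (H (fst k) (snd k))
     else - sqrt 2 * Im (H (fst k) (snd k)))"

lemma hermitian_entry: "hermitian_on I X \<Longrightarrow> X j i = cnj (X i j)"
  unfolding hermitian_on_def madj_def by (metis (no_types))

lemma upper_neq: "(i, j) \<in> upper_pairs d \<Longrightarrow> i \<noteq> j \<and> j \<noteq> i \<and> i \<in> bip d \<and> j \<in> bip d \<and> flat d i < flat d j \<and> \<not> flat d j < flat d i"
  by (auto simp: upper_pairs_def)

lemma hermitian_herm_of: "hermitian_on (bip d) (herm_of d x)"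
proof -
  have "cnj (herm_of d x j i) = herm_of d x i j" for i j
  proof (cases "i \<in> bip d \<and> j \<in> bip d \<and> i \<noteq> j")
    case True
    then consider "flat d i < flat d j" | "flat d j < flat d i"
      using inj_onD[OF inj_on_flat, of d i j] by fastforce
    then show ?thesis
      using True by cases (auto simp: herm_of_def simp del: mem_Sigma_iff)
  qed (auto simp: herm_of_def)
  then show ?thesis by (auto simp: hermitian_on_def madj_def ops_on_def herm_of_def intro!: ext)
qed

text \<open>Here <H, G> becomes a linear form in the Gaussian coordinates, the shape in which the
  comparison theorem takes its processes.\<close>

lemma hs_inner_herm_of:
  assumes H: "hermitian_on (bip d) H"
  shows "hs_inner d H (herm_of d x) = (\<Sum>k\<in>bip d \<times> bip d. herm_coef d H k * x k)"
proof -
  have 1: "Re (H i j * herm_of d x j i) + Re (H j i * herm_of d x i j)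
      = herm_coef d H (i, j) * x (i, j) + herm_coef d H (j, i) * x (j, i)" if "(i, j) \<in> upper_pairs d" for i j
  proof -
    have "H j i = cnj (H i j)" by (rule hermitian_entry[OF H])
    then show ?thesis
      using upper_neq[OF that] by (simp add: herm_of_def herm_coef_def Re_divide_of_real Im_divide_of_real field_simps del: mem_Sigma_iff)
  qed
  have "hs_inner d H (herm_of d x) = (\<Sum>i\<in>bip d. herm_coef d H (i, i) * x (i, i)) +
      (\<Sum>(i, j)\<in>upper_pairs d. herm_coef d H (i, j) * x (i, j) + herm_coef d H (j, i) * x (j, i))"
    unfolding hs_inner_eq sum_bip_split
    by (intro arg_cong2[where f = "(+)"] sum.cong sum_pair_cong 1 refl; simp add: herm_of_def herm_coef_def del: mem_Sigma_iff)
  also have "\<dots> = (\<Sum>(i, j)\<in>bip d \<times> bip d. herm_coef d H (i, j) * x (i, j))"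
    by (rule sum_bip_split[symmetric])
  finally show ?thesis by (simp add: case_prod_beta)
qed

text \<open>The entries (i, j) and (j, i) together contribute twice the real part of one product,
  which is the square of the factor sqrt 2. Covariances of the Gaussian forms <H, G> are thereby
  Hilbert-Schmidt products.\<close>

lemma coef_isometry:
  assumes H: "hermitian_on (bip d) H" and H': "hermitian_on (bip d) H'"
  shows "(\<Sum>k\<in>bip d \<times> bip d. herm_coef d H k * herm_coef d H' k) = hs_inner d H H'"
proof -
  have im: "Im (H i i) = 0" "Im (H' i i) = 0" for i
    using hermitian_entry[OF H, of i i] hermitian_entry[OF H', of i i] by (simp_all add: complex_eq_iff)
  have 1: "Re (H i j * H' j i) + Re (H j i * H' i j)
      = herm_coef d H (i, j) * herm_coef d H' (i, j) + herm_coef d H (j, i) * herm_coef d H' (j, i)" if "(i, j) \<in> upper_pairs d" for i j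
  proof -
    have *: "H j i = cnj (H i j)" "H' j i = cnj (H' i j)" by (rule hermitian_entry[OF H] hermitian_entry[OF H'])+
    have "sqrt 2 * a * (sqrt 2 * b) = 2 * (a * b)" for a b by simp
    then show ?thesis
      using upper_neq[OF that] by (simp add: herm_coef_def * algebra_simps del: mem_Sigma_iff)
  qed
  have "(\<Sum>k\<in>bip d \<times> bip d. herm_coef d H k * herm_coef d H' k) = (\<Sum>(i, j)\<in>bip d \<times> bip d. herm_coef d H (i, j) * herm_coef d H' (i, j))"
    by (simp add: case_prod_beta)
  also have "\<dots> = hs_inner d H H'"
    unfolding hs_inner_eq sum_bip_split
    by (intro arg_cong2[where f = "(+)"] sum.cong sum_pair_cong 1[symmetric] refl; simp add: im herm_coef_def)
  finally show ?thesis .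
qed

section \<open>Rank-one operators and the partial transpose\<close>

definition outer :: "'a set \<Rightarrow> ('a \<Rightarrow> complex) \<Rightarrow> 'a cmat" where
  "outer I v = (\<lambda>i j. if i \<in> I \<and> j \<in> I then v i * cnj (v j) else 0)"

lemma hermitian_outer: "hermitian_on I (outer I v)"
  by (auto simp: hermitian_on_def madj_def ops_on_def outer_def intro!: ext)

lemma mtrace_mmul_outer: "mtrace I (mmul I (outer I v) X) = qform I X v"
  unfolding mtrace_mmul qform_def outer_def by (subst sum.swap) (simp add: mult_ac)

lemma hs_inner_outer: "hs_inner d (outer (bip d) v) X = Re (qform (bip d) X v)"
  by (simp add: hs_inner_def mtrace_mmul_outer)

lemma hs_inner_commute: "hs_inner d X Y = hs_inner d Y X"
  by (simp add: hs_inner_def mtrace_mmul_commute)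

lemma qform_outer: "qform I (outer I w) v = of_real ((cmod (cinner I w v))\<^sup>2)"
proof -
  have "qform I (outer I w) v = (\<Sum>i\<in>I. \<Sum>j\<in>I. cnj (v i) * w i * (cnj (w j) * v j))"
    unfolding qform_def outer_def by (simp add: mult_ac)
  also have "\<dots> = cnj (cinner I w v) * cinner I w v"
    unfolding cinner_cnj by (simp add: cinner_def sum_product)
  finally show ?thesis by (metis complex_norm_square mult.commute)
qed

lemma psd_outer: "psd_on I (outer I w)"
  unfolding psd_on_iff qform_outer by (auto simp: ops_on_def outer_def)

lemma state_outer: "cinner I w w = 1 \<Longrightarrow> state_on I (outer I w)"
  by (simp add: state_on_def psd_outer) (simp add: mtrace_def outer_def cinner_def mult.commute)

lemma ptrans_ptrans: "ptrans (ptrans X) = X"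
  by (simp add: ptrans_def)

text \<open>Exchanging the second components of row and column is an involution on the pairs of
  indices, so the partial transpose is self-adjoint. Together with \<open>ptrans_ptrans\<close> this
  makes it an isometry.\<close>

lemma hs_inner_ptrans: "hs_inner d (ptrans X) Y = hs_inner d X (ptrans Y)"
  unfolding hs_inner_eq
  by (rule sum.reindex_bij_witness[where
        i = "\<lambda>((a, b), (a', b')). ((a, b'), (a', b))" and j = "\<lambda>((a, b), (a', b')). ((a, b'), (a', b))"])
    (auto simp: ptrans_def)

lemma hermitian_ptrans:
  assumes "hermitian_on (bip d) X"
  shows "hermitian_on (bip d) (ptrans X)"
proof -
  have "cnj (ptrans X j i) = ptrans X i j" for i j
    unfolding ptrans_def using hermitian_entry[OF assms] by (metis complex_cnj_cnj)
  moreover have "ptrans X i j = 0" if "i \<notin> bip d \<or> j \<notin> bip d" for i j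
    using assms that unfolding hermitian_on_def ops_on_def ptrans_def by (auto simp: mem_Times_iff)
  ultimately show ?thesis by (auto simp: hermitian_on_def madj_def ops_on_def intro!: ext simp del: mem_Sigma_iff)
qed

lemma hermitian_uminus: "hermitian_on I X \<Longrightarrow> hermitian_on I (\<lambda>i j. - X i j)"
  by (auto simp: hermitian_on_def madj_def ops_on_def fun_eq_iff)

lemma hs_inner_uminus_left: "hs_inner d (\<lambda>i j. - X i j) Y = - hs_inner d X Y"
  and hs_inner_uminus_right: "hs_inner d X (\<lambda>i j. - Y i j) = - hs_inner d X Y"
  unfolding hs_inner_eq sum_negf[symmetric] by (simp_all add: case_prod_beta)

lemma gauss_coords_eq: "gauss_coords d = gauss_on (bip d \<times> bip d)"
  by (simp add: gauss_coords_def gauss_on_def)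

lemma cmod_cinner_le_1:
  assumes "finite I" "cinner I v v = 1" "cinner I w w = 1"
  shows "cmod (cinner I v w) \<le> 1"
proof -
  have "(\<Sum>k<1::nat. (cmod (cinner I ((\<lambda>_. v) k) w))\<^sup>2) \<le> (\<Sum>i\<in>I. (cmod (w i))\<^sup>2)"
    by (rule bessel_ineq) (use assms in \<open>auto simp: orthonormal_def\<close>)
  also have "\<dots> = 1" using assms(3) unfolding cinner_self by (metis of_real_eq_1_iff)
  finally show ?thesis by (simp add: abs_square_le_1)
qed

section \<open>Norm bounds over unit vectors and over product vectors\<close>

lemma sum_bool_Times:
  fixes f :: "bool \<times> 'a \<Rightarrow> real"
  shows "(\<Sum>p\<in>UNIV \<times> I. f p) = (\<Sum>i\<in>I. f (True, i)) + (\<Sum>i\<in>I. f (False, i))"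
proof -
  have "(\<Sum>p\<in>UNIV \<times> I. f p) = (\<Sum>q\<in>UNIV. \<Sum>i\<in>I. f (q, i))"
    by (simp add: sum.cartesian_product)
  then show ?thesis by (simp add: UNIV_bool)
qed

text \<open>The coefficients of the linear comparison process: \<open>v\<close> as a real vector in
  twice the dimension, scaled by sqrt 2 so that the covariance is 2 Re <v, w> and the variance on
  the unit sphere is 2.\<close>

definition recoord :: "('a \<Rightarrow> complex) \<Rightarrow> bool \<times> 'a \<Rightarrow> real" where
  "recoord v p = (if fst p then sqrt 2 * Re (v (snd p)) else sqrt 2 * Im (v (snd p)))"

lemma sum_recoord: "(\<Sum>p\<in>UNIV \<times> I. recoord v p * recoord w p) = 2 * Re (cinner I v w)"
  unfolding sum_bool_Times recoord_def cinner_def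
  by (simp add: sum.distrib sum_distrib_left algebra_simps)

lemma continuous_on_coef:
  assumes "\<And>i j. continuous_on S (\<lambda>v. H v i j)"
  shows "continuous_on S (\<lambda>v. herm_coef d (H v) k)"
proof -
  have "(\<lambda>v. herm_coef d (H v) k) = (if fst k = snd k then (\<lambda>v. Re (H v (fst k) (fst k)))
      else if flat d (fst k) < flat d (snd k) then (\<lambda>v. sqrt 2 * Re (H v (fst k) (snd k)))
      else (\<lambda>v. - sqrt 2 * Im (H v (fst k) (snd k))))"
    by (simp add: herm_coef_def)
  moreover have "continuous_on S (\<lambda>v. Re (H v i j))" "continuous_on S (\<lambda>v. a * Re (H v i j))"
    "continuous_on S (\<lambda>v. a * Im (H v i j))" for a i j
    by (intro continuous_intros assms)+
  ultimately show ?thesis by presburger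
qed

text \<open>\<open>H\<close> enters through its covariance |<v, w>|^2, so one statement serves the
  upper bound, the lower bound and the partial transpose. With n = d^2 the comparison process has 2n
  real dimensions and variance 2. Here t^2 / 2 exceeds 2n by at least 2 \<delta> n, which makes the
  failure probability at most 8n / (2 \<delta> n)^2.\<close>

lemma operator_bound:
  fixes H :: "(nat \<times> nat \<Rightarrow> complex) \<Rightarrow> (nat \<times> nat) cmat"
  assumes d: "0 < d" and \<delta>: "0 < \<delta>"
    and herm: "\<And>v. hermitian_on (bip d) (H v)"
    and H: "\<And>v w. hs_inner d (H v) (H w) = (cmod (cinner (bip d) v w))\<^sup>2"
    and cont: "\<And>i j. continuous_on UNIV (\<lambda>v. H v i j)"
  defines "E \<equiv> {x \<in> space (gauss_coords d). \<forall>v\<in>{v. cinner (bip d) v v = 1}.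
      hs_inner d (H v) (herm_of d x) \<le> (2 + \<delta>) * real d}"
  shows "E \<in> sets (gauss_coords d)" "1 - measure (gauss_coords d) E \<le> 2 / (\<delta>\<^sup>2 * (real d)\<^sup>2)"
proof -
  let ?K = "bip d \<times> bip d" and ?L = "(UNIV :: bool set) \<times> bip d" and ?V = "{v. cinner (bip d) v v = 1}"
  let ?t = "(2 + \<delta>) * real d"
  define n where "n = (real d)\<^sup>2"
  have n: "0 < n" using d by (simp add: n_def)
  have E: "E = {x \<in> space (gauss_on ?K). \<forall>v\<in>?V. (\<Sum>k\<in>?K. herm_coef d (H v) k * x k) \<le> ?t}"
    unfolding E_def gauss_coords_eq hs_inner_herm_of[OF herm] ..
  have cL: "real (card ?L) = 2 * n"
    by (simp add: card_cartesian_product n_def power2_eq_square)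
  have gap: "2 * \<delta> * n \<le> ?t\<^sup>2 / 2 - 2 * n"
  proof -
    have "?t\<^sup>2 / 2 - 2 * n = 2 * \<delta> * n + \<delta>\<^sup>2 * n / 2" by (simp add: n_def power2_eq_square field_simps)
    moreover have "0 \<le> \<delta>\<^sup>2 * n / 2" using n by simp
    ultimately show ?thesis by linarith
  qed
  have ts: "real (card ?L) < ?t\<^sup>2 / 2"
    using gap mult_pos_pos[OF \<delta> n] unfolding cL by linarith
  have ccont: "continuous_on UNIV (\<lambda>v. herm_coef d (H v) k)" for k
    by (intro continuous_on_coef cont)
  \<comment> \<open>The inequality (|z| - 1)^2 \<ge> 0 for z = <v, w>. The summand
    \<open>1 * 1\<close> is the variance gap 2 - 1, that is c = 1.\<close>
  have cov: "(\<Sum>l\<in>?L. recoord v l * recoord w l) \<le> (\<Sum>k\<in>?K. herm_coef d (H v) k * herm_coef d (H w) k) + 1 * 1" for v w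
  proof -
    let ?z = "cinner (bip d) v w"
    have "0 \<le> (cmod ?z - 1)\<^sup>2" by simp
    then have "2 * cmod ?z \<le> (cmod ?z)\<^sup>2 + 1" by (simp add: power2_eq_square algebra_simps)
    then have "2 * Re ?z \<le> (cmod ?z)\<^sup>2 + 1" using complex_Re_le_cmod[of ?z] by linarith
    then show ?thesis by (simp add: sum_recoord coef_isometry[OF herm herm] H)
  qed
  note sup = gaussian_sup_bound[where K = ?K and L = ?L and c = 1 and s = 2 and t = ?t and V = ?V
      and A = "\<lambda>v. herm_coef d (H v)" and B = recoord]
  show "E \<in> sets (gauss_coords d)"
    unfolding E gauss_coords_eq
    by (rule sup(1)) (use d \<delta> ts cov ccont in \<open>auto simp: sum_recoord coef_isometry[OF herm herm] H\<close>)
  have "1 - measure (gauss_coords d) E \<le> 4 * real (card ?L) / (?t\<^sup>2 / 2 - real (card ?L))\<^sup>2"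
    unfolding E gauss_coords_eq
    by (rule sup(2)) (use d \<delta> ts cov ccont in \<open>auto simp: sum_recoord coef_isometry[OF herm herm] H\<close>)
  also have "\<dots> \<le> 4 * real (card ?L) / (2 * \<delta> * n)\<^sup>2"
    unfolding cL
    by (intro divide_left_mono power_mono mult_pos_pos zero_less_power) (use gap n \<delta> mult_pos_pos[OF \<delta> n] in linarith)+
  also have "\<dots> = 2 / (\<delta>\<^sup>2 * n)" unfolding cL using n \<delta> by (simp add: field_simps power2_eq_square)
  finally show "1 - measure (gauss_coords d) E \<le> 2 / (\<delta>\<^sup>2 * (real d)\<^sup>2)" by (simp add: n_def)
qed

definition kron :: "(nat \<Rightarrow> complex) \<Rightarrow> (nat \<Rightarrow> complex) \<Rightarrow> nat \<times> nat \<Rightarrow> complex" where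
  "kron x y = (\<lambda>i. x (fst i) * y (snd i))"

lemma continuous_on_outer:
  assumes f: "continuous_on S f"
  shows "continuous_on S (\<lambda>v. outer I (f v) i j)"
proof -
  have "(\<lambda>v. outer I (f v) i j) = (if i \<in> I \<and> j \<in> I then (\<lambda>v. f v i * cnj (f v j)) else (\<lambda>_. 0))"
    by (auto simp: outer_def)
  moreover have "continuous_on S (\<lambda>v. f v i * cnj (f v j))"
    by (intro continuous_on_mult continuous_on_cnj continuous_on_coord[OF f])
  moreover have "continuous_on S (\<lambda>v. 0 :: complex)" by (rule continuous_on_const)
  ultimately show ?thesis by presburger
qed

lemma continuous_on_kron:
  assumes f: "continuous_on S f" and g: "continuous_on S g"
  shows "continuous_on S (\<lambda>v. kron (f v) (g v))"
  unfolding kron_def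
  by (intro continuous_on_coordinatewise_then_product continuous_on_mult continuous_on_coord[OF f] continuous_on_coord[OF g])

lemma cinner_kron: "cinner (bip d) (kron x y) (kron x' y') = cinner {..<d} x x' * cinner {..<d} y y'"
proof -
  have "cinner (bip d) (kron x y) (kron x' y') = (\<Sum>(a, b)\<in>bip d. (cnj (x a) * x' a) * (cnj (y b) * y' b))"
    unfolding cinner_def kron_def by (intro sum.cong refl) (auto simp: mult_ac)
  also have "\<dots> = cinner {..<d} x x' * cinner {..<d} y y'"
    unfolding cinner_def sum_product sum.cartesian_product ..
  finally show ?thesis .
qed

text \<open>The comparison process is a sum of two independent linear processes, one for each tensor
  factor. It has 4d real dimensions and variance 4 against variance 1 for the product form, hence
  \<open>c = sqrt 3\<close>. The condition \<open>large\<close> makes t^2 / 4 at least twice the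
  dimension 4d, so that half of it remains as margin.\<close>

lemma product_bound:
  assumes d: "0 < d" and \<delta>: "0 < \<delta>" and large: "32 \<le> \<delta>\<^sup>2 * real d"
  defines "E \<equiv> {z \<in> space (gauss_coords d). \<forall>v\<in>{v. cinner {..<d} (fst v) (fst v) = 1 \<and> cinner {..<d} (snd v) (snd v) = 1}.
      hs_inner d (outer (bip d) (kron (fst v) (snd v))) (herm_of d z) \<le> \<delta> * real d}"
  shows "E \<in> sets (gauss_coords d)" "1 - measure (gauss_coords d) E \<le> 1024 / (\<delta> ^ 4 * (real d) ^ 3)"
proof -
  let ?K = "bip d \<times> bip d" and ?L = "(UNIV :: bool set) \<times> ((UNIV :: bool set) \<times> {..<d})"
  let ?V = "{v. cinner {..<d} (fst v) (fst v) = 1 \<and> cinner {..<d} (snd v) (snd v) = 1}"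
  let ?t = "\<delta> * real d"
  let ?H = "\<lambda>v. outer (bip d) (kron (fst v) (snd v))"
  define B where "B = (\<lambda>(v :: (nat \<Rightarrow> complex) \<times> (nat \<Rightarrow> complex)) p. if fst p then recoord (fst v) (snd p) else recoord (snd v) (snd p))"
  have herm: "hermitian_on (bip d) (?H v)" for v by (rule hermitian_outer)
  have H: "hs_inner d (?H v) (?H w) = (cmod (cinner {..<d} (fst v) (fst w)) * cmod (cinner {..<d} (snd v) (snd w)))\<^sup>2" for v w
    by (simp add: hs_inner_outer qform_outer cinner_kron norm_mult cmod_cinner_commute[of _ "fst w"] cmod_cinner_commute[of _ "snd w"])
  have sB: "(\<Sum>p\<in>?L. B v p * B w p) = 2 * Re (cinner {..<d} (fst v) (fst w)) + 2 * Re (cinner {..<d} (snd v) (snd w))" for v w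
    unfolding sum_bool_Times[of _ "(UNIV :: bool set) \<times> {..<d}"] B_def by (simp add: sum_recoord)
  have E: "E = {x \<in> space (gauss_on ?K). \<forall>v\<in>?V. (\<Sum>k\<in>?K. herm_coef d (?H v) k * x k) \<le> ?t}"
    unfolding E_def gauss_coords_eq hs_inner_herm_of[OF herm] ..
  have cL: "real (card ?L) = 4 * real d" by (simp add: card_cartesian_product)
  have gap: "\<delta>\<^sup>2 * (real d)\<^sup>2 / 8 \<le> ?t\<^sup>2 / 4 - 4 * real d"
  proof -
    have "32 * real d \<le> \<delta>\<^sup>2 * real d * real d" using large by (intro mult_right_mono) auto
    then show ?thesis by (simp add: power2_eq_square algebra_simps)
  qed
  have pos: "0 < \<delta>\<^sup>2 * (real d)\<^sup>2 / 8" using d \<delta> by simp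
  have ts: "real (card ?L) < ?t\<^sup>2 / 4" using gap pos unfolding cL by linarith
  have "continuous_on UNIV (\<lambda>v. ?H v i j)" for i j
    by (intro continuous_on_outer continuous_on_kron continuous_on_fst continuous_on_snd continuous_on_id)
  then have ccont: "continuous_on UNIV (\<lambda>v. herm_coef d (?H v) k)" for k
    by (intro continuous_on_coef)
  have cov: "(\<Sum>l\<in>?L. B v l * B w l) \<le> (\<Sum>k\<in>?K. herm_coef d (?H v) k * herm_coef d (?H w) k) + sqrt 3 * sqrt 3"
    if "v \<in> ?V" "w \<in> ?V" for v w
  proof -
    let ?a = "cmod (cinner {..<d} (fst v) (fst w))" and ?b = "cmod (cinner {..<d} (snd v) (snd w))"
    have ab: "0 \<le> ?a" "?a \<le> 1" "0 \<le> ?b" "?b \<le> 1"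
      using that by (auto intro: cmod_cinner_le_1)
    then have "?a * ?b \<le> 1" by (simp add: mult_le_one)
    \<comment> \<open>For moduli a, b in [0, 1] the product gives a + b \<le> 1 + ab, and the square
      below gives 2ab \<le> 1 + (ab)^2. Together they yield 2a + 2b \<le> (ab)^2 + 3.\<close>
    have "0 \<le> (1 - ?a) * (1 - ?b)" using ab by (intro mult_nonneg_nonneg) auto
    moreover have "0 \<le> (1 - ?a * ?b)\<^sup>2" by simp
    ultimately have "2 * ?a + 2 * ?b \<le> (?a * ?b)\<^sup>2 + 3"
      by (simp add: power2_eq_square algebra_simps)
    moreover have "Re (cinner {..<d} (fst v) (fst w)) \<le> ?a" "Re (cinner {..<d} (snd v) (snd w)) \<le> ?b"
      by (rule complex_Re_le_cmod)+
    ultimately show ?thesis unfolding sB coef_isometry[OF herm herm] H by simp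
  qed
  note sup = gaussian_sup_bound[where K = ?K and L = ?L and c = "sqrt 3" and s = 4 and t = ?t and V = ?V
      and A = "\<lambda>v. herm_coef d (?H v)" and B = B]
  show "E \<in> sets (gauss_coords d)"
    unfolding E gauss_coords_eq
    by (rule sup(1)) (use d \<delta> ts cov ccont in \<open>auto simp: sB coef_isometry[OF herm herm] H\<close>)
  have "1 - measure (gauss_coords d) E \<le> 4 * real (card ?L) / (?t\<^sup>2 / 4 - real (card ?L))\<^sup>2"
    unfolding E gauss_coords_eq
    by (rule sup(2)) (use d \<delta> ts cov ccont in \<open>auto simp: sB coef_isometry[OF herm herm] H\<close>)
  also have "\<dots> \<le> 4 * real (card ?L) / (\<delta>\<^sup>2 * (real d)\<^sup>2 / 8)\<^sup>2"
    unfolding cL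
    by (intro divide_left_mono power_mono mult_pos_pos zero_less_power) (use gap pos in linarith)+
  also have "\<dots> = 1024 / (\<delta> ^ 4 * (real d) ^ 3)"
    unfolding cL using d \<delta> by (simp add: field_simps power2_eq_square power3_eq_cube power4_eq_xxxx)
  finally show "1 - measure (gauss_coords d) E \<le> 1024 / (\<delta> ^ 4 * (real d) ^ 3)" .
qed

lemma coef_herm_of: "k \<in> bip d \<times> bip d \<Longrightarrow> herm_coef d (herm_of d x) k = x k"
  by (cases k) (use inj_onD[OF inj_on_flat, of d "fst k" "snd k"] in
      \<open>fastforce simp: herm_coef_def herm_of_def Re_divide_of_real Im_divide_of_real simp del: mem_Sigma_iff\<close>)

lemma hs_inner_herm_of_self: "hs_inner d (herm_of d x) (herm_of d x) = (\<Sum>k\<in>bip d \<times> bip d. (x k)\<^sup>2)"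
  unfolding hs_inner_herm_of[OF hermitian_herm_of]
  by (intro sum.cong refl) (simp only: coef_herm_of power2_eq_square)

lemma mtrace_herm_of: "mtrace (bip d) (herm_of d x) = of_real (\<Sum>i\<in>bip d. x (i, i))"
  unfolding mtrace_def of_real_sum by (intro sum.cong refl) (simp add: herm_of_def del: mem_Sigma_iff)

section \<open>PPT and separable states\<close>

lemma hs_inner_diff_left: "hs_inner d (X - X') Y = hs_inner d X Y - hs_inner d X' Y"
  unfolding hs_inner_eq sum_subtractf[symmetric]
  by (intro sum.cong refl) (simp add: case_prod_beta algebra_simps)

lemma hermitian_diff: "hermitian_on I X \<Longrightarrow> hermitian_on I Y \<Longrightarrow> hermitian_on I (X - Y)"
  by (auto simp: hermitian_on_def madj_def ops_on_def fun_eq_iff)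

lemma PPT_hermitian: "\<rho> \<in> PPT d \<Longrightarrow> hermitian_on (bip d) \<rho>"
  by (auto simp: PPT_def state_on_def intro!: psd_on_imp_hermitian)

lemma hermitian_tensor:
  assumes "hermitian_on {..<d} A" "hermitian_on {..<d} B"
  shows "hermitian_on (bip d) (tensor A B)"
proof -
  have "cnj (tensor A B j i) = tensor A B i j" for i j
    by (simp add: tensor_def hermitian_entry[OF assms(1), of "fst i" "fst j"] hermitian_entry[OF assms(2), of "snd i" "snd j"])
  moreover have "tensor A B i j = 0" if "i \<notin> bip d \<or> j \<notin> bip d" for i j
    using assms that by (auto simp: tensor_def hermitian_on_def ops_on_def mem_Times_iff)
  ultimately show ?thesis by (auto simp: hermitian_on_def madj_def ops_on_def intro!: ext simp del: mem_Sigma_iff)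
qed

lemma mixture_eq: "mixture k p A B x y = (\<Sum>i<k. of_real (p i) * tensor (A i) (B i) x y)"
  by (simp add: mixture_def)

lemma SEP_hermitian:
  assumes "\<sigma> \<in> SEP d"
  shows "hermitian_on (bip d) \<sigma>"
proof -
  obtain k p A B where \<sigma>: "\<sigma> = mixture k p A B"
    and AB: "\<And>i. i < k \<Longrightarrow> 0 \<le> p i \<and> state_on {..<d} (A i) \<and> state_on {..<d} (B i)"
    using assms by (auto simp: SEP_def)
  have h: "hermitian_on (bip d) (tensor (A i) (B i))" if "i < k" for i
    using AB[OF that] by (intro hermitian_tensor psd_on_imp_hermitian) (auto simp: state_on_def)
  have "cnj (\<sigma> j i) = \<sigma> i j" for i j
    unfolding \<sigma> mixture_eq by (auto intro!: sum.cong simp: hermitian_entry[OF h, symmetric])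
  moreover have "\<sigma> i j = 0" if "i \<notin> bip d \<or> j \<notin> bip d" for i j
  proof -
    have "tensor (A l) (B l) i j = 0" if "l < k" for l
      using h[OF that] \<open>i \<notin> bip d \<or> j \<notin> bip d\<close> unfolding hermitian_on_def ops_on_def by blast
    then show ?thesis unfolding \<sigma> mixture_eq by simp
  qed
  ultimately show ?thesis by (auto simp: hermitian_on_def madj_def ops_on_def intro!: ext simp del: mem_Sigma_iff)
qed

lemma state_spectral:
  assumes fin: "finite I" and A: "state_on I A"
  obtains e a where "A = smat I e a" "orthonormal I (card I) e" "\<And>k. k < card I \<Longrightarrow> 0 \<le> a k" "(\<Sum>k<card I. a k) = 1"
proof -
  have psd: "psd_on I A" and tr: "mtrace I A = 1" using A by (auto simp: state_on_def)
  obtain e a where sp: "spectral I A e a" using spectral_exists[OF fin psd_on_imp_hermitian[OF fin psd]] by blast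
  have e: "orthonormal I (card I) e" using sp by (simp add: spectral_def)
  have Am: "A = smat I e a" using spectral_smat sp psd by (auto simp: psd_on_def)
  have "0 \<le> a k" if "k < card I" for k
    using psd qform_eigen[OF e that, of a] unfolding psd_on_iff Am by (metis Re_complex_of_real)
  moreover have "(\<Sum>k<card I. a k) = 1"
    using tr unfolding Am mtrace_smat_id[OF fin e] by (metis of_real_eq_1_iff)
  ultimately show thesis using that Am e by blast
qed

lemma tensor_smat:
  "tensor (smat {..<d} e a) (smat {..<d} f b) =
    (\<lambda>i j. \<Sum>k<d. \<Sum>l<d. of_real (a k * b l) * outer (bip d) (kron (e k) (f l)) i j)"
proof (intro ext)
  fix i j
  show "tensor (smat {..<d} e a) (smat {..<d} f b) i j = (\<Sum>k<d. \<Sum>l<d. of_real (a k * b l) * outer (bip d) (kron (e k) (f l)) i j)"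
  proof (cases "i \<in> bip d \<and> j \<in> bip d")
    case True
    then have "tensor (smat {..<d} e a) (smat {..<d} f b) i j = (\<Sum>k<d. of_real (a k) * e k (fst i) * cnj (e k (fst j))) *
        (\<Sum>l<d. of_real (b l) * f l (snd i) * cnj (f l (snd j)))"
      by (auto simp: tensor_def smat_def mem_Times_iff)
    also have "\<dots> = (\<Sum>k<d. \<Sum>l<d. of_real (a k * b l) * outer (bip d) (kron (e k) (f l)) i j)"
      unfolding sum_product using True by (intro sum.cong refl) (simp add: outer_def kron_def mult_ac del: mem_Sigma_iff)
    finally show ?thesis .
  next
    case False
    then have "tensor (smat {..<d} e a) (smat {..<d} f b) i j = 0"
      by (auto simp: tensor_def smat_def mem_Times_iff)
    moreover have "outer (bip d) (kron (e k) (f l)) i j = 0" for k l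
      using False by (auto simp: outer_def simp del: mem_Sigma_iff)
    ultimately show ?thesis by simp
  qed
qed

lemma hs_inner_sum_left: "hs_inner d (\<lambda>i j. \<Sum>k\<in>K. of_real (c k) * X k i j) Y = (\<Sum>k\<in>K. c k * hs_inner d (X k) Y)"
proof -
  have "hs_inner d (\<lambda>i j. \<Sum>k\<in>K. of_real (c k) * X k i j) Y
      = (\<Sum>p\<in>bip d \<times> bip d. \<Sum>k\<in>K. c k * Re (X k (fst p) (snd p) * Y (snd p) (fst p)))"
    unfolding hs_inner_eq by (simp add: case_prod_beta sum_distrib_right mult.assoc)
  also have "\<dots> = (\<Sum>k\<in>K. c k * hs_inner d (X k) Y)"
    unfolding hs_inner_eq sum_distrib_left by (subst sum.swap) (simp add: case_prod_beta)
  finally show ?thesis .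
qed

text \<open>Spectral decompositions of the local factors refine a separable state to a convex
  combination of pure product vectors, and the linear functional is at most \<open>b\<close> on each
  of these.\<close>

lemma hs_inner_SEP_le:
  assumes \<sigma>: "\<sigma> \<in> SEP d"
    and b: "\<And>x y. cinner {..<d} x x = 1 \<Longrightarrow> cinner {..<d} y y = 1 \<Longrightarrow> Re (qform (bip d) Y (kron x y)) \<le> b"
  shows "hs_inner d \<sigma> Y \<le> b"
proof -
  obtain k p A B where \<sigma>: "\<sigma> = mixture k p A B" and p1: "(\<Sum>i<k. p i) = 1"
    and AB: "\<And>i. i < k \<Longrightarrow> 0 \<le> p i \<and> state_on {..<d} (A i) \<and> state_on {..<d} (B i)"
    using \<sigma> by (auto simp: SEP_def)
  have t: "hs_inner d (tensor (A i) (B i)) Y \<le> b" if i: "i < k" for i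
  proof -
    obtain e a where A: "A i = smat {..<d} e a" "orthonormal {..<d} d e" "\<And>k. k < d \<Longrightarrow> 0 \<le> a k" "(\<Sum>k<d. a k) = 1"
      using state_spectral[of "{..<d}" "A i"] AB[OF i] by auto
    obtain f c where B: "B i = smat {..<d} f c" "orthonormal {..<d} d f" "\<And>k. k < d \<Longrightarrow> 0 \<le> c k" "(\<Sum>k<d. c k) = 1"
      using state_spectral[of "{..<d}" "B i"] AB[OF i] by auto
    have "hs_inner d (tensor (A i) (B i)) Y = hs_inner d (\<lambda>i j. \<Sum>p\<in>{..<d} \<times> {..<d}. of_real (a (fst p) * c (snd p)) * outer (bip d) (kron (e (fst p)) (f (snd p))) i j) Y"
      unfolding A(1) B(1) tensor_smat sum.cartesian_product by (simp add: case_prod_beta)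
    also have "\<dots> = (\<Sum>p\<in>{..<d} \<times> {..<d}. (a (fst p) * c (snd p)) * hs_inner d (outer (bip d) (kron (e (fst p)) (f (snd p)))) Y)"
      by (rule hs_inner_sum_left)
    also have "\<dots> \<le> (\<Sum>p\<in>{..<d} \<times> {..<d}. (a (fst p) * c (snd p)) * b)"
      unfolding hs_inner_outer using A B by (intro sum_mono mult_left_mono b) (auto simp: orthonormal_def)
    also have "\<dots> = (\<Sum>p\<in>{..<d} \<times> {..<d}. a (fst p) * c (snd p)) * b"
      by (simp only: sum_distrib_right)
    also have "(\<Sum>p\<in>{..<d} \<times> {..<d}. a (fst p) * c (snd p)) = (\<Sum>k<d. a k) * (\<Sum>l<d. c l)"
      unfolding sum_product sum.cartesian_product by (intro sum.cong refl) auto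
    finally show ?thesis using A B by simp
  qed
  have "hs_inner d \<sigma> Y = (\<Sum>i<k. p i * hs_inner d (tensor (A i) (B i)) Y)"
    unfolding \<sigma> mixture_def by (rule hs_inner_sum_left)
  also have "\<dots> \<le> (\<Sum>i<k. p i * b)"
    using AB t by (intro sum_mono mult_left_mono) auto
  also have "\<dots> = b" using p1 by (simp flip: sum_distrib_right)
  finally show ?thesis .
qed

lemma SEP_nonempty:
  assumes "0 < d"
  shows "SEP d \<noteq> {}"
proof -
  define w :: "nat \<Rightarrow> complex" where "w = (\<lambda>j. if j = 0 then 1 else 0)"
  have "cinner {..<d} w w = 1" unfolding w_def using assms by (subst cinner_delta(2)) auto
  then have "state_on {..<d} (outer {..<d} w)" by (rule state_outer)
  then have "mixture 1 (\<lambda>_. 1) (\<lambda>_. outer {..<d} w) (\<lambda>_. outer {..<d} w) \<in> SEP d"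
    unfolding SEP_def by fastforce
  then show ?thesis by blast
qed

section \<open>The perturbed identity and lower bounds on the distance to separable states\<close>

definition mat_one :: "'a set \<Rightarrow> 'a cmat" where
  "mat_one I = (\<lambda>i j. if i = j \<and> i \<in> I then 1 else 0)"

lemma qform_mat_one: "finite I \<Longrightarrow> qform I (mat_one I) v = cinner I v v"
proof -
  assume I: "finite I"
  have "mvec I (mat_one I) v i = v i" if "i \<in> I" for i
  proof -
    have "mvec I (mat_one I) v i = (\<Sum>j\<in>I. if i = j then v j else 0)"
      unfolding mvec_def mat_one_def by (intro sum.cong) (use that in auto)
    then show ?thesis using I that by simp
  qed
  then show ?thesis unfolding qform_eq_cinner by (intro cinner_cong) auto
qed

lemma qform_shift_scale:
  "qform I (\<lambda>i j. c * (X i j + b * Y i j)) v = c * (qform I X v + b * qform I Y v)"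
  unfolding qform_def by (simp add: sum.distrib sum_distrib_left algebra_simps)

lemma ptrans_mat_one: "ptrans (mat_one (bip d)) = mat_one (bip d)"
  by (auto simp: ptrans_def mat_one_def intro!: ext)

lemma hs_inner_mat_one: "hs_inner d X (mat_one (bip d)) = Re (mtrace (bip d) X)"
proof -
  have "(\<Sum>j\<in>bip d. X i j * mat_one (bip d) j i) = X i i" if "i \<in> bip d" for i
  proof -
    have "(\<Sum>j\<in>bip d. X i j * mat_one (bip d) j i) = (\<Sum>j\<in>bip d. if j = i then X i j else 0)"
      using that by (intro sum.cong refl) (simp add: mat_one_def)
    then show ?thesis using that by simp
  qed
  then show ?thesis unfolding hs_inner_def mtrace_mmul by (simp add: mtrace_def)
qed

lemma mtrace_mat_one: "mtrace (bip d) (mat_one (bip d)) = of_real ((real d)\<^sup>2)"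
  by (simp add: mtrace_def mat_one_def card_cartesian_product power2_eq_square)

text \<open>The partial transpose fixes the identity, so one positivity argument applied to Z = Y
  and to Z = \<open>ptrans Y\<close> gives both conditions from the two lower bounds. The overlap
  with \<open>Y\<close> comes from the perturbation alone because \<open>Y\<close> is orthogonal to
  the identity.\<close>

lemma perturbed_identity_PPT:
  assumes d: "0 < d" and Y: "hermitian_on (bip d) Y" and tr: "mtrace (bip d) Y = 0" and M: "0 < M"
    and lower: "\<And>v. cinner (bip d) v v = 1 \<Longrightarrow> - Re (qform (bip d) Y v) \<le> M"
    and lower': "\<And>v. cinner (bip d) v v = 1 \<Longrightarrow> - Re (qform (bip d) (ptrans Y) v) \<le> M"
  defines "\<rho> \<equiv> \<lambda>i j. of_real (1 / (real d)\<^sup>2) * (mat_one (bip d) i j + of_real (1 / M) * Y i j)"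
  shows "\<rho> \<in> PPT d" "hs_inner d \<rho> Y = hs_inner d Y Y / ((real d)\<^sup>2 * M)"
proof -
  let ?I = "bip d"
  have psd: "psd_on ?I (\<lambda>i j. of_real (1 / (real d)\<^sup>2) * (mat_one ?I i j + of_real (1 / M) * Z i j))"
    if Z: "hermitian_on ?I Z" and low: "\<And>v. cinner ?I v v = 1 \<Longrightarrow> - Re (qform ?I Z v) \<le> M" for Z
    unfolding psd_on_iff
  proof (intro conjI allI)
    show "(\<lambda>i j. of_real (1 / (real d)\<^sup>2) * (mat_one ?I i j + of_real (1 / M) * Z i j)) \<in> ops_on ?I"
      using Z by (auto simp: hermitian_on_def ops_on_def mat_one_def)
    fix v
    have "Re (qform ?I (\<lambda>i j. - Z i j) v) \<le> M * Re (cinner ?I v v)"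
    proof (rule qform_le_cinner)
      fix c :: real
      let ?w = "\<lambda>i. of_real c * v i"
      assume "cinner ?I ?w ?w = 1"
      from low[OF this] show "Re (qform ?I (\<lambda>i j. - Z i j) ?w) \<le> M" by (simp add: qform_def sum_negf)
    qed simp
    then have "0 \<le> M * Re (cinner ?I v v) + Re (qform ?I Z v)" by (simp add: qform_def sum_negf)
    then have "0 \<le> (M * Re (cinner ?I v v) + Re (qform ?I Z v)) / M" using M by simp
    then have pos: "0 \<le> Re (cinner ?I v v) + Re (qform ?I Z v) / M" using M by (simp add: add_divide_distrib)
    have "qform ?I Z v = of_real (Re (qform ?I Z v))" using qform_hermitian_real[OF Z, of v] by simp
    moreover have "cinner ?I v v = of_real (Re (cinner ?I v v))" by (simp add: cinner_self)
    ultimately have eq: "qform ?I (\<lambda>i j. of_real (1 / (real d)\<^sup>2) * (mat_one ?I i j + of_real (1 / M) * Z i j)) v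
       = of_real (1 / (real d)\<^sup>2 * (Re (cinner ?I v v) + Re (qform ?I Z v) / M))"
    proof -
      assume *: "qform ?I Z v = of_real (Re (qform ?I Z v))" "cinner ?I v v = of_real (Re (cinner ?I v v))"
      have q1: "qform ?I (mat_one ?I) v = cinner ?I v v" by (rule qform_mat_one) simp
      show ?thesis
        unfolding qform_shift_scale q1 by (subst *(1), subst *(2)) simp
    qed
    show "qform ?I (\<lambda>i j. of_real (1 / (real d)\<^sup>2) * (mat_one ?I i j + of_real (1 / M) * Z i j)) v \<in> \<real>"
      unfolding eq by simp
    show "0 \<le> Re (qform ?I (\<lambda>i j. of_real (1 / (real d)\<^sup>2) * (mat_one ?I i j + of_real (1 / M) * Z i j)) v)"
      unfolding eq Re_complex_of_real using pos by (intro mult_nonneg_nonneg) auto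
  qed
  have "mtrace ?I \<rho> = of_real (1 / (real d)\<^sup>2) * (mtrace ?I (mat_one ?I) + of_real (1 / M) * mtrace ?I Y)"
    unfolding \<rho>_def mtrace_def sum_distrib_left[symmetric] sum.distrib ..
  also have "\<dots> = 1" unfolding mtrace_mat_one tr using d by simp
  finally have "mtrace ?I \<rho> = 1" .
  then have "state_on ?I \<rho>" unfolding state_on_def \<rho>_def using psd[OF Y lower] by blast
  moreover have "ptrans \<rho> = (\<lambda>i j. of_real (1 / (real d)\<^sup>2) * (mat_one ?I i j + of_real (1 / M) * ptrans Y i j))"
  proof -
    have "ptrans \<rho> i j = of_real (1 / (real d)\<^sup>2) * (ptrans (mat_one ?I) i j + of_real (1 / M) * ptrans Y i j)" for i j
      by (simp add: ptrans_def \<rho>_def)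
    then show ?thesis unfolding ptrans_mat_one by blast
  qed
  ultimately show "\<rho> \<in> PPT d"
    using psd[OF hermitian_ptrans[OF Y] lower'] by (simp add: PPT_def)
  have 0: "hs_inner d (mat_one ?I) Y = 0"
    by (subst hs_inner_commute) (simp add: hs_inner_mat_one tr)
  have "hs_inner d \<rho> Y = 1 / (real d)\<^sup>2 * (hs_inner d (mat_one ?I) Y + 1 / M * hs_inner d Y Y)"
    unfolding hs_inner_eq \<rho>_def sum_distrib_left sum.distrib[symmetric]
    by (intro sum.cong refl) (auto simp: algebra_simps)
  then show "hs_inner d \<rho> Y = hs_inner d Y Y / ((real d)\<^sup>2 * M)" by (simp add: 0)
qed

text \<open>The operator \<open>Y\<close> and the bounds \<open>M\<close> and \<open>b\<close> do
  not depend on the separable state, so the duality estimate passes to the infimum over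
  \<open>SEP d\<close>.\<close>

lemma dist_SEP_witness:
  assumes d: "0 < d" and M: "0 < M" and \<rho>: "hermitian_on (bip d) \<rho>"
    and abs: "\<And>v. cinner (bip d) v v = 1 \<Longrightarrow> \<bar>Re (qform (bip d) Y v)\<bar> \<le> M"
    and prod: "\<And>x y. cinner {..<d} x x = 1 \<Longrightarrow> cinner {..<d} y y = 1 \<Longrightarrow> Re (qform (bip d) Y (kron x y)) \<le> b"
  shows "(hs_inner d \<rho> Y - b) / M \<le> dist_SEP d \<rho>"
  unfolding dist_SEP_def
proof (rule cInf_greatest)
  show "(\<lambda>\<sigma>. trace_norm (bip d) (\<rho> - \<sigma>)) ` SEP d \<noteq> {}" using SEP_nonempty[OF d] by simp
  fix r assume "r \<in> (\<lambda>\<sigma>. trace_norm (bip d) (\<rho> - \<sigma>)) ` SEP d"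
  then obtain \<sigma> where \<sigma>: "\<sigma> \<in> SEP d" and r: "r = trace_norm (bip d) (\<rho> - \<sigma>)" by blast
  have "hs_inner d (\<rho> - \<sigma>) Y \<le> M * r"
    unfolding r hs_inner_def by (rule trace_norm_duality) (use abs hermitian_diff[OF \<rho> SEP_hermitian[OF \<sigma>]] in auto)
  moreover have "hs_inner d \<sigma> Y \<le> b" by (rule hs_inner_SEP_le[OF \<sigma> prod])
  ultimately have "hs_inner d \<rho> Y - b \<le> M * r" by (simp add: hs_inner_diff_left)
  then show "(hs_inner d \<rho> Y - b) / M \<le> r" using M by (simp add: field_simps)
qed

text \<open>Every separable state that competes for \<open>\<rho>'\<close> also competes for
  \<open>\<rho>\<close>; the triangle inequality costs the trace norm of the difference.\<close>

lemma dist_SEP_diff_le: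
  assumes d: "0 < d" and \<rho>: "hermitian_on (bip d) \<rho>" and \<rho>': "hermitian_on (bip d) \<rho>'"
  shows "dist_SEP d \<rho> - dist_SEP d \<rho>' \<le> real (card (bip d)) * (\<Sum>i\<in>bip d. \<Sum>j\<in>bip d. cmod (\<rho> i j - \<rho>' i j))"
proof -
  let ?C = "real (card (bip d)) * (\<Sum>i\<in>bip d. \<Sum>j\<in>bip d. cmod (\<rho> i j - \<rho>' i j))"
  have bdd: "bdd_below ((\<lambda>\<sigma>. trace_norm (bip d) (\<rho> - \<sigma>)) ` SEP d)"
    by (rule bdd_belowI2[where m = 0]) (auto intro!: trace_norm_nonneg hermitian_diff[OF \<rho> SEP_hermitian])
  have "dist_SEP d \<rho> - ?C \<le> dist_SEP d \<rho>'"
    unfolding dist_SEP_def[of d \<rho>']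
  proof (rule cInf_greatest)
    show "(\<lambda>\<sigma>. trace_norm (bip d) (\<rho>' - \<sigma>)) ` SEP d \<noteq> {}" using SEP_nonempty[OF d] by simp
    fix r assume "r \<in> (\<lambda>\<sigma>. trace_norm (bip d) (\<rho>' - \<sigma>)) ` SEP d"
    then obtain \<sigma> where \<sigma>: "\<sigma> \<in> SEP d" and r: "r = trace_norm (bip d) (\<rho>' - \<sigma>)" by blast
    have "dist_SEP d \<rho> \<le> trace_norm (bip d) (\<rho> - \<sigma>)"
      unfolding dist_SEP_def using \<sigma> by (intro cInf_lower bdd) auto
    also have "\<dots> \<le> trace_norm (bip d) (\<rho>' - \<sigma>) + trace_norm (bip d) (\<rho> - \<rho>')"
      by (rule trace_norm_triangle[where A = "\<rho> - \<sigma>" and B = "\<rho>' - \<sigma>" and C = "\<rho> - \<rho>'"])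
        (auto intro: hermitian_diff \<rho> \<rho>' SEP_hermitian[OF \<sigma>])
    also have "trace_norm (bip d) (\<rho> - \<rho>') \<le> ?C"
      using trace_norm_le_entries[OF _ hermitian_diff[OF \<rho> \<rho>']] by simp
    finally show "dist_SEP d \<rho> - ?C \<le> r" unfolding r by (simp only: diff_le_eq)
  qed
  then show ?thesis by simp
qed

text \<open>The topology is that of entrywise convergence, in which \<open>PPT d\<close> is compact.
  Continuity makes the sublevel sets of the distance compact too.\<close>

lemma continuous_on_dist_SEP:
  assumes d: "0 < d"
  shows "continuous_on (PPT d) (dist_SEP d)"
  unfolding continuous_on_def
proof
  fix \<rho> assume \<rho>: "\<rho> \<in> PPT d"
  let ?g = "\<lambda>\<rho>'. real (card (bip d)) * (\<Sum>i\<in>bip d. \<Sum>j\<in>bip d. cmod (\<rho>' i j - \<rho> i j))"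
  have "continuous_on UNIV ?g"
    by (intro continuous_on_mult continuous_on_const continuous_on_sum continuous_on_norm continuous_on_diff
        continuous_on_coord[OF continuous_on_coord[OF continuous_on_id]])
  then have "(?g \<longlongrightarrow> ?g \<rho>) (at \<rho> within PPT d)"
    by (meson continuous_on_def continuous_on_subset subset_UNIV \<rho>)
  then have g: "(?g \<longlongrightarrow> 0) (at \<rho> within PPT d)" by simp
  have "((\<lambda>\<rho>'. dist_SEP d \<rho>' - dist_SEP d \<rho>) \<longlongrightarrow> 0) (at \<rho> within PPT d)"
  proof (rule Lim_null_comparison[OF _ g])
    have "\<bar>dist_SEP d \<rho>' - dist_SEP d \<rho>\<bar> \<le> ?g \<rho>'" if "\<rho>' \<in> PPT d" for \<rho>'
      using dist_SEP_diff_le[OF d PPT_hermitian[OF \<rho>] PPT_hermitian[OF that]]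
        dist_SEP_diff_le[OF d PPT_hermitian[OF that] PPT_hermitian[OF \<rho>]]
      by (simp add: norm_minus_commute[of "\<rho> _ _"])
    then show "\<forall>\<^sub>F \<rho>' in at \<rho> within PPT d. norm (dist_SEP d \<rho>' - dist_SEP d \<rho>) \<le> ?g \<rho>'"
      unfolding eventually_at_filter by simp
  qed
  then show "(dist_SEP d \<longlongrightarrow> dist_SEP d \<rho>) (at \<rho> within PPT d)" by (rule LIM_zero_cancel)
qed

section \<open>Compactness of the PPT states and measurability of events about maximisers\<close>

lemma state_entry_le_1:
  assumes fin: "finite I" and A: "state_on I A"
  shows "cmod (A i j) \<le> 1"
proof -
  obtain e a where Am: "A = smat I e a" and e: "orthonormal I (card I) e"
    and a: "\<And>k. k < card I \<Longrightarrow> 0 \<le> a k" "(\<Sum>k<card I. a k) = 1"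
    using state_spectral[OF fin A] by blast
  show ?thesis
  proof (cases "i \<in> I \<and> j \<in> I")
    case True
    have "cmod (A i j) \<le> (\<Sum>k<card I. cmod (of_real (a k) * e k i * cnj (e k j)))"
      unfolding Am smat_def using True by (auto intro: norm_sum)
    also have "\<dots> \<le> (\<Sum>k<card I. a k)"
    proof (rule sum_mono)
      fix k assume k: "k \<in> {..<card I}"
      have "cmod (e k i) \<le> 1" "cmod (e k j) \<le> 1"
        using cmod_coord_le_1[OF fin, of "e k"] e k True by (auto simp: orthonormal_def)
      then have "cmod (e k i) * cmod (e k j) \<le> 1" by (intro mult_le_one) auto
      then show "cmod (of_real (a k) * e k i * cnj (e k j)) \<le> a k"
        using a(1)[of k] k mult_left_mono[of _ 1 "a k"] by (simp add: norm_mult mult.assoc)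
    qed
    finally show ?thesis using a by simp
  qed (auto simp: Am smat_def)
qed

lemma continuous_on_ptrans: "continuous_on S (ptrans :: (nat \<times> nat) cmat \<Rightarrow> _)"
  unfolding ptrans_def
  by (intro continuous_on_coordinatewise_then_product continuous_on_coord[OF continuous_on_coord[OF continuous_on_id]])

lemma compact_PPT: "compact (PPT d)"
proof -
  let ?I = "bip d"
  let ?c = "\<lambda>i j. if i \<in> ?I \<and> j \<in> ?I then cball 0 1 else {0 :: complex}"
  \<comment> \<open>States vanish outside \<open>bip d\<close> and have entries of modulus at most
    1, so \<open>PPT d\<close> is a compact box cut by closed conditions on the form values and the
    trace.\<close>
  define box where "box = {X :: (nat \<times> nat) cmat. \<forall>i. X i \<in> {r. \<forall>j. r j \<in> ?c i j}}"
  have "compact box"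
    unfolding box_def by (intro compact_function_box) (auto simp del: mem_Sigma_iff)
  have q: "continuous_on UNIV (\<lambda>X. qform ?I X v)" "continuous_on UNIV (\<lambda>X. qform ?I (ptrans X) v)" for v
    by (intro continuous_on_qform continuous_on_ptrans continuous_on_id continuous_on_const)+
  have t: "continuous_on UNIV (\<lambda>X. mtrace ?I X)"
    unfolding mtrace_def
    by (intro continuous_on_sum continuous_on_coord[OF continuous_on_coord[OF continuous_on_id]])
  have "closed {X. (\<forall>v. Im (qform ?I X v) = 0 \<and> 0 \<le> Re (qform ?I X v)) \<and> mtrace ?I X = 1 \<and>
     (\<forall>v. Im (qform ?I (ptrans X) v) = 0 \<and> 0 \<le> Re (qform ?I (ptrans X) v))}" (is "closed ?S")
    by (intro closed_Collect_conj closed_Collect_all closed_Collect_eq closed_Collect_le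
        continuous_on_Re continuous_on_Im continuous_on_const q t)
  have "PPT d = box \<inter> ?S"
  proof (intro equalityI subsetI)
    fix X assume X: "X \<in> PPT d"
    then have st: "state_on ?I X" and pt: "psd_on ?I (ptrans X)" by (auto simp: PPT_def)
    have "X i j \<in> ?c i j" for i j
    proof (cases "i \<in> ?I \<and> j \<in> ?I")
      case True
      then show ?thesis using state_entry_le_1[OF _ st, of i j] by simp
    next
      case False
      then have "X i j = 0" using st unfolding state_on_def psd_on_iff ops_on_def by blast
      then show ?thesis using False by auto
    qed
    then have "X \<in> box" unfolding box_def by blast
    moreover have "X \<in> ?S" using st pt by (auto simp: state_on_def psd_on_iff complex_is_Real_iff)
    ultimately show "X \<in> box \<inter> ?S" ..
  next
    fix X assume X: "X \<in> box \<inter> ?S"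
    then have "X \<in> box" by blast
    then have "X i j \<in> ?c i j" for i j unfolding box_def by blast
    then have z: "X i j = 0" if "i \<notin> ?I \<or> j \<notin> ?I" for i j using that by (metis (full_types) singletonD)
    then have "X \<in> ops_on ?I" unfolding ops_on_def by blast
    moreover have "ptrans X \<in> ops_on ?I" unfolding ops_on_def ptrans_def using z by (auto simp: mem_Times_iff)
    ultimately show "X \<in> PPT d" using X by (auto simp: PPT_def state_on_def psd_on_iff complex_is_Real_iff)
  qed
  then show ?thesis using \<open>compact box\<close> \<open>closed ?S\<close> by (simp add: compact_Int_closed)
qed

text \<open>By compactness an exact maximiser exists iff there are $1/(n+1)$-approximate ones in a countable dense subset.\<close>

lemma sets_exists_maximiser:
  fixes L :: "'a::second_countable_topology \<Rightarrow> 'x \<Rightarrow> real"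
  assumes m[measurable]: "\<And>a. L a \<in> borel_measurable M" and cont: "\<And>x. continuous_on UNIV (\<lambda>a. L a x)"
    and K: "compact K"
  shows "{x \<in> space M. \<exists>a\<in>K. \<forall>b\<in>P. L b x \<le> L a x} \<in> sets M"
proof (cases "K = {}")
  case False
  obtain T where T: "countable T" "T \<subseteq> K" "K \<subseteq> closure T" by (rule countable_dense_in)
  obtain Q where Q: "countable Q" "Q \<subseteq> P" "P \<subseteq> closure Q" by (rule countable_dense_in)
  have "(\<exists>a\<in>K. \<forall>b\<in>P. L b x \<le> L a x) \<longleftrightarrow> (\<forall>n::nat. \<exists>a\<in>T. \<forall>b\<in>Q. L b x \<le> L a x + 1 / real (Suc n))" (is "?l \<longleftrightarrow> ?r") for x
  proof
    assume ?l
    then obtain a where a: "a \<in> K" "\<And>b. b \<in> P \<Longrightarrow> L b x \<le> L a x" by blast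
    show ?r
    proof
      fix n
      have "\<exists>a'\<in>T. L a x - 1 / real (Suc n) \<le> L a' x"
      proof (rule ccontr)
        assume "\<not> ?thesis"
        then have "L a' x \<le> L a x - 1 / real (Suc n)" if "a' \<in> T" for a' using that by (simp add: not_le less_imp_le)
        then have "L a x \<le> L a x - 1 / real (Suc n)"
          using le_on_closure[OF cont, of T x _ a] T(3) a(1) by blast
        then show False by simp
      qed
      then obtain a' where "a' \<in> T" "L a x - 1 / real (Suc n) \<le> L a' x" by blast
      then show "\<exists>a\<in>T. \<forall>b\<in>Q. L b x \<le> L a x + 1 / real (Suc n)"
        using a(2) Q(2) by (intro bexI[of _ a']) (auto simp: algebra_simps intro: order_trans)
    qed
  next
    \<comment> \<open>A true maximiser over the compact set is at least as good as every approximate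
      one in \<open>T\<close>. The slack tends to 0, and density of \<open>Q\<close> extends the
      inequality to \<open>P\<close>.\<close>
    assume r: ?r
    obtain a where a: "a \<in> K" "\<And>a'. a' \<in> K \<Longrightarrow> L a' x \<le> L a x"
      using continuous_attains_sup[OF K False continuous_on_subset[OF cont]] by blast
    have "L b x \<le> L a x" if b: "b \<in> Q" for b
    proof (rule field_le_epsilon)
      fix e :: real assume "0 < e"
      then obtain n where n: "1 / real (Suc n) < e" using nat_approx_posE by blast
      obtain a' where a': "a' \<in> T" "\<forall>b\<in>Q. L b x \<le> L a' x + 1 / real (Suc n)" using r by blast
      have "L b x \<le> L a' x + 1 / real (Suc n)" using a' b by blast
      also have "\<dots> \<le> L a x + e" using a(2)[of a'] a'(1) T(2) n by force
      finally show "L b x \<le> L a x + e" .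
    qed
    then have "L b x \<le> L a x" if "b \<in> P" for b
      using le_on_closure[OF cont, of Q x "L a x" b] Q(3) that by blast
    then show ?l using a(1) by blast
  qed
  then have eq: "{x \<in> space M. \<exists>a\<in>K. \<forall>b\<in>P. L b x \<le> L a x}
    = {x \<in> space M. \<forall>n::nat. \<exists>a\<in>T. \<forall>b\<in>Q. L b x \<le> L a x + 1 / real (Suc n)}" by simp
  show ?thesis
    unfolding eq
    by (intro sets.sets_Collect_countable_All sets.sets_Collect_countable_Ex'[OF _ T(1)]
        sets.sets_Collect_countable_All'[OF _ Q(1)]) measurable
qed simp

section \<open>Random directions\<close>

definition mean_diag :: "nat \<Rightarrow> ((nat \<times> nat) \<times> (nat \<times> nat) \<Rightarrow> real) \<Rightarrow> real" where
  "mean_diag d x = (\<Sum>i\<in>bip d. x (i, i)) / (real d)\<^sup>2"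

abbreviation gue0 :: "nat \<Rightarrow> ((nat \<times> nat) \<times> (nat \<times> nat) \<Rightarrow> real) \<Rightarrow> (nat \<times> nat) cmat" where
  "gue0 d x \<equiv> traceless_part d (herm_of d x)"

lemma gue0_eq: "gue0 d x = (\<lambda>i j. herm_of d x i j - of_real (mean_diag d x) * mat_one (bip d) i j)"
  unfolding traceless_part_def mtrace_herm_of mat_one_def mean_diag_def
  by (auto intro!: ext simp: herm_of_def power2_eq_square simp del: mem_Sigma_iff)

lemma hermitian_gue0: "hermitian_on (bip d) (gue0 d x)"
  using hermitian_herm_of[of d x] unfolding gue0_eq
  by (auto simp: hermitian_on_def madj_def ops_on_def mat_one_def fun_eq_iff)

lemma mtrace_gue0: "0 < d \<Longrightarrow> mtrace (bip d) (gue0 d x) = 0"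
proof -
  assume d: "0 < d"
  have "mtrace (bip d) (gue0 d x) = mtrace (bip d) (herm_of d x) - of_real (mean_diag d x) * mtrace (bip d) (mat_one (bip d))"
    unfolding gue0_eq mtrace_def sum_subtractf sum_distrib_left ..
  also have "\<dots> = of_real ((\<Sum>i\<in>bip d. x (i, i)) - mean_diag d x * (real d)\<^sup>2)"
    unfolding mtrace_herm_of mtrace_mat_one by simp
  also have "(\<Sum>i\<in>bip d. x (i, i)) - mean_diag d x * (real d)\<^sup>2 = 0"
    using d by (simp add: mean_diag_def)
  finally show ?thesis by simp
qed

lemma hs_inner_gue0: "hs_inner d X (gue0 d x) = hs_inner d X (herm_of d x) - mean_diag d x * Re (mtrace (bip d) X)"
proof -
  have "hs_inner d X (gue0 d x) = hs_inner d X (herm_of d x) - mean_diag d x * hs_inner d X (mat_one (bip d))"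
    unfolding gue0_eq hs_inner_eq sum_distrib_left sum_subtractf[symmetric]
    by (intro sum.cong refl) (auto simp: algebra_simps)
  then show ?thesis unfolding hs_inner_mat_one .
qed

text \<open>Pythagoras for the splitting of G into its traceless part and a multiple \<tau> of the
  identity, whose squared norm is d^2 \<tau>^2.\<close>

lemma hs_inner_gue0_self:
  assumes "0 < d"
  shows "hs_inner d (gue0 d x) (gue0 d x) = (\<Sum>k\<in>bip d \<times> bip d. (x k)\<^sup>2) - (real d)\<^sup>2 * (mean_diag d x)\<^sup>2"
proof -
  have "hs_inner d (gue0 d x) (gue0 d x) = hs_inner d (herm_of d x) (gue0 d x)"
    by (subst hs_inner_gue0) (simp add: mtrace_gue0[OF assms] hs_inner_commute)
  also have "\<dots> = (\<Sum>k\<in>bip d \<times> bip d. (x k)\<^sup>2) - mean_diag d x * (\<Sum>i\<in>bip d. x (i, i))"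
    unfolding hs_inner_gue0 hs_inner_herm_of_self mtrace_herm_of by simp
  also have "(\<Sum>i\<in>bip d. x (i, i)) = (real d)\<^sup>2 * mean_diag d x"
    using assms by (simp add: mean_diag_def)
  finally show ?thesis by (simp add: power2_eq_square)
qed

lemma qform_gue0:
  "qform (bip d) (gue0 d x) v = qform (bip d) (herm_of d x) v - of_real (mean_diag d x) * cinner (bip d) v v"
  "qform (bip d) (ptrans (gue0 d x)) v = qform (bip d) (ptrans (herm_of d x)) v - of_real (mean_diag d x) * cinner (bip d) v v"
proof -
  have *: "qform (bip d) (\<lambda>i j. X i j - c * mat_one (bip d) i j) v = qform (bip d) X v - c * cinner (bip d) v v" for X c
  proof -
    have "qform (bip d) (\<lambda>i j. X i j - c * mat_one (bip d) i j) v = qform (bip d) X v - c * qform (bip d) (mat_one (bip d)) v"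
      unfolding qform_def by (simp add: algebra_simps sum_subtractf sum_distrib_left)
    then show ?thesis by (simp add: qform_mat_one)
  qed
  show "qform (bip d) (gue0 d x) v = qform (bip d) (herm_of d x) v - of_real (mean_diag d x) * cinner (bip d) v v"
    unfolding gue0_eq * ..
  have "ptrans (gue0 d x) = (\<lambda>i j. ptrans (herm_of d x) i j - of_real (mean_diag d x) * mat_one (bip d) i j)"
    unfolding gue0_eq by (subst ptrans_mat_one[symmetric]) (simp add: ptrans_def)
  then show "qform (bip d) (ptrans (gue0 d x)) v = qform (bip d) (ptrans (herm_of d x)) v - of_real (mean_diag d x) * cinner (bip d) v v"
    by (simp only: *)
qed

definition far_directions :: "nat \<Rightarrow> real \<Rightarrow> (nat \<times> nat) cmat set" where
  "far_directions d c = {u \<in> sphere_S d. \<forall>\<rho>\<in>PPT d.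
     (\<forall>\<tau>\<in>PPT d. hs_inner d \<tau> u \<le> hs_inner d \<rho> u) \<longrightarrow> c \<le> dist_SEP d \<rho>}"

lemma hs_inner_scale_right: "hs_inner d X (\<lambda>i j. Y i j / of_real c) = hs_inner d X Y / c"
  unfolding hs_inner_eq sum_divide_distrib by (intro sum.cong refl) auto

text \<open>Positive rescaling leaves the maximisers in place. If the traceless part is 0, division
  by zero makes \<open>direction d x\<close> the zero matrix, which is off the sphere; the
  positivity clause excludes this case.\<close>

lemma direction_far_iff:
  assumes d: "0 < d"
  shows "direction d x \<in> far_directions d c \<longleftrightarrow> 0 < hs_inner d (gue0 d x) (gue0 d x) \<and>
    (\<forall>\<rho>\<in>PPT d. (\<forall>\<tau>\<in>PPT d. hs_inner d \<tau> (gue0 d x) \<le> hs_inner d \<rho> (gue0 d x)) \<longrightarrow> c \<le> dist_SEP d \<rho>)"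
proof -
  define N where "N = hs_inner d (gue0 d x) (gue0 d x)"
  have dir: "direction d x = (\<lambda>i j. gue0 d x i j / of_real (sqrt N))"
    by (simp add: direction_def Let_def N_def)
  have N0: "0 \<le> N"
    unfolding N_def coef_isometry[OF hermitian_gue0 hermitian_gue0, symmetric] by (intro sum_nonneg) simp
  have hs: "hs_inner d X (direction d x) = hs_inner d X (gue0 d x) / sqrt N" for X
    unfolding dir by (rule hs_inner_scale_right)
  have "hs_inner d (direction d x) (direction d x) = N / sqrt N / sqrt N"
    unfolding hs by (subst hs_inner_commute) (simp add: hs N_def)
  also have "\<dots> = (if N = 0 then 0 else 1)" using N0 by (simp add: field_simps)
  finally have norm: "hs_inner d (direction d x) (direction d x) = (if N = 0 then 0 else 1)" .
  have herm: "hermitian_on (bip d) (direction d x)"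
    using hermitian_gue0[of d x] unfolding dir by (auto simp: hermitian_on_def madj_def ops_on_def fun_eq_iff)
  have tr: "mtrace (bip d) (direction d x) = 0"
    using mtrace_gue0[OF d, of x] unfolding dir mtrace_def by (simp flip: sum_divide_distrib)
  have sph: "direction d x \<in> sphere_S d \<longleftrightarrow> 0 < N"
    using herm tr norm N0 by (auto simp: sphere_S_def)
  show ?thesis
  proof (cases "0 < N")
    case True
    then have "hs_inner d \<tau> (direction d x) \<le> hs_inner d \<rho> (direction d x) \<longleftrightarrow> hs_inner d \<tau> (gue0 d x) \<le> hs_inner d \<rho> (gue0 d x)" for \<tau> \<rho>
      unfolding hs by (simp add: divide_le_cancel)
    then show ?thesis using True sph by (simp add: far_directions_def N_def)
  next
    case False
    then show ?thesis using sph by (simp add: far_directions_def N_def)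
  qed
qed

text \<open>Apart from a vanishing traceless part, failure means that some maximiser is nearer than
  \<open>c\<close>. This is a countable union over \<open>m\<close> of the events that a maximiser
  lies in the compact set \<open>C m\<close>, each measurable by
  \<open>sets_exists_maximiser\<close>.\<close>

lemma sets_far_directions:
  assumes d: "0 < d"
  shows "{x \<in> space (gauss_coords d). direction d x \<in> far_directions d c} \<in> sets (gauss_coords d)"
proof -
  let ?K = "bip d \<times> bip d"
  define L where "L = (\<lambda>\<rho> x. \<Sum>k\<in>?K. herm_coef d \<rho> k * x k)"
  \<comment> \<open>The margin 1 / (m + 1) turns the strict inequality into a closed condition, so
    that \<open>C m\<close> is compact.\<close>
  define C where "C = (\<lambda>m. {\<rho> \<in> PPT d. dist_SEP d \<rho> \<le> c - 1 / real (Suc m)})"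
  \<comment> \<open>States have trace 1, so removing the trace of G shifts the functional by the
    same amount on all of \<open>PPT d\<close>.\<close>
  have L: "hs_inner d \<rho> (gue0 d x) = L \<rho> x - mean_diag d x" if "\<rho> \<in> PPT d" for \<rho> x
    using that unfolding hs_inner_gue0 L_def hs_inner_herm_of[OF PPT_hermitian[OF that]]
    by (simp add: PPT_def state_on_def)
  have [measurable]: "L \<rho> \<in> borel_measurable (gauss_on ?K)" for \<rho>
    unfolding L_def by measurable
  have Lcont: "continuous_on UNIV (\<lambda>\<rho>. L \<rho> x)" for x
    unfolding L_def
    by (intro continuous_on_sum continuous_on_mult continuous_on_const continuous_on_coef
        continuous_on_coord[OF continuous_on_coord[OF continuous_on_id]])
  have "compact (C m)" for m
  proof -
    have "closed (C m)" unfolding C_def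
      by (intro continuous_on_closed_Collect_le continuous_on_dist_SEP d continuous_on_const compact_imp_closed compact_PPT)
    then have "compact (PPT d \<inter> C m)" by (intro compact_Int_closed compact_PPT)
    then show ?thesis by (simp add: C_def Collect_conj_eq Int_absorb1 inf.absorb2 Int_left_absorb)
  qed
  then have m: "{x \<in> space (gauss_on ?K). \<exists>\<rho>\<in>C m. \<forall>\<tau>\<in>PPT d. L \<tau> x \<le> L \<rho> x} \<in> sets (gauss_on ?K)" for m
    by (intro sets_exists_maximiser Lcont) measurable
  have [measurable]: "(\<lambda>x. mean_diag d x) \<in> borel_measurable (gauss_on ?K)"
    unfolding mean_diag_def
    by (intro borel_measurable_divide borel_measurable_sum measurable_coord borel_measurable_const) auto
  have [measurable]: "(\<lambda>x. \<Sum>k\<in>?K. (x k)\<^sup>2) \<in> borel_measurable (gauss_on ?K)"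
    by (intro borel_measurable_sum borel_measurable_power measurable_coord)
  have key: "(\<forall>\<rho>\<in>PPT d. (\<forall>\<tau>\<in>PPT d. hs_inner d \<tau> (gue0 d x) \<le> hs_inner d \<rho> (gue0 d x)) \<longrightarrow> c \<le> dist_SEP d \<rho>) \<longleftrightarrow>
      (\<forall>m. \<not> (\<exists>\<rho>\<in>C m. \<forall>\<tau>\<in>PPT d. L \<tau> x \<le> L \<rho> x))" (is "?l \<longleftrightarrow> ?r") for x
  proof
    assume l: ?l
    show ?r
    proof (intro allI notI)
      fix m assume "\<exists>\<rho>\<in>C m. \<forall>\<tau>\<in>PPT d. L \<tau> x \<le> L \<rho> x"
      then obtain \<rho> where \<rho>: "\<rho> \<in> C m" "\<forall>\<tau>\<in>PPT d. L \<tau> x \<le> L \<rho> x" by blast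
      have "\<rho> \<in> PPT d" "dist_SEP d \<rho> \<le> c - 1 / real (Suc m)" using \<rho>(1) unfolding C_def by blast+
      moreover from this have "c \<le> dist_SEP d \<rho>" using l \<rho>(2) by (simp add: L)
      moreover have "0 < 1 / real (Suc m)" by simp
      ultimately show False by linarith
    qed
  next
    assume r: ?r
    show ?l
    proof (intro ballI impI, rule ccontr)
      fix \<rho> assume \<rho>: "\<rho> \<in> PPT d" "\<forall>\<tau>\<in>PPT d. hs_inner d \<tau> (gue0 d x) \<le> hs_inner d \<rho> (gue0 d x)" "\<not> c \<le> dist_SEP d \<rho>"
      then have "0 < c - dist_SEP d \<rho>" by simp
      then obtain m where "1 / real (Suc m) < c - dist_SEP d \<rho>" using nat_approx_posE by blast
      then have "\<rho> \<in> C m" using \<rho> unfolding C_def by simp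
      moreover have "\<forall>\<tau>\<in>PPT d. L \<tau> x \<le> L \<rho> x" using \<rho>(1,2) by (simp add: L)
      ultimately show False using r by blast
    qed
  qed
  have eq: "{x \<in> space (gauss_coords d). direction d x \<in> far_directions d c} =
      {x \<in> space (gauss_on ?K). 0 < (\<Sum>k\<in>?K. (x k)\<^sup>2) - (real d)\<^sup>2 * (mean_diag d x)\<^sup>2} \<inter>
      (space (gauss_on ?K) - (\<Union>m. {x \<in> space (gauss_on ?K). \<exists>\<rho>\<in>C m. \<forall>\<tau>\<in>PPT d. L \<tau> x \<le> L \<rho> x}))"
    unfolding gauss_coords_eq direction_far_iff[OF d] hs_inner_gue0_self[OF d] key by auto
  have "{x \<in> space (gauss_on ?K). 0 < (\<Sum>k\<in>?K. (x k)\<^sup>2) - (real d)\<^sup>2 * (mean_diag d x)\<^sup>2} \<in> sets (gauss_on ?K)"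
    by measurable
  moreover have "(\<Union>m. {x \<in> space (gauss_on ?K). \<exists>\<rho>\<in>C m. \<forall>\<tau>\<in>PPT d. L \<tau> x \<le> L \<rho> x}) \<in> sets (gauss_on ?K)"
    by (rule sets.countable_UN) (use m in blast)
  ultimately show ?thesis unfolding eq unfolding gauss_coords_eq
    by (intro sets.Int sets.Diff sets.top)
qed

text \<open>The right-hand side is at least (1 - 2 \<delta>) / (4 (1 + \<delta>)^2) - \<delta> / (1
  + \<delta>). Since (1 - 2 \<delta>) (1 + \<delta>)^2 \<le> 1, the first term is at least (1 - 2
  \<delta>)^2 / 4 \<ge> 1/4 - \<delta>, and the second is at most \<delta>.\<close>

lemma witness_constant:
  fixes \<delta> D N :: real
  assumes \<delta>: "0 < \<delta>" "\<delta> \<le> 1 / 4" and D: "0 < D" and N: "(1 - 2 * \<delta>) * (D\<^sup>2)\<^sup>2 \<le> N"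
  shows "1 / 4 - 2 * \<delta> \<le> (N / (D\<^sup>2 * ((2 + 2 * \<delta>) * D)) - 2 * \<delta> * D) / ((2 + 2 * \<delta>) * D)"
proof -
  have "(1 - 2 * \<delta>) * (1 - 2 * \<delta>) * (1 + \<delta>)\<^sup>2 \<le> (1 - 2 * \<delta>) * 1"
  proof -
    have "(1 - 2 * \<delta>) * (1 + \<delta>)\<^sup>2 = 1 - 3 * \<delta>\<^sup>2 - 2 * \<delta> ^ 3"
      by (simp add: power2_eq_square power3_eq_cube algebra_simps)
    also have "\<dots> \<le> 1" using zero_le_power[of \<delta> 3] zero_le_power2[of \<delta>] \<delta>(1) by linarith
    finally show ?thesis using \<delta> unfolding mult.assoc by (intro mult_left_mono) auto
  qed
  then have "(1 - 2 * \<delta>) * (1 - 2 * \<delta>) / 4 \<le> (1 - 2 * \<delta>) / (4 * (1 + \<delta>)\<^sup>2)"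
    using \<delta> by (simp add: field_simps)
  moreover have "(1 - 2 * \<delta>) * (1 - 2 * \<delta>) / 4 \<ge> 1 / 4 - \<delta>" by (simp add: algebra_simps)
  moreover have "\<delta> / (1 + \<delta>) \<le> \<delta>" using \<delta> by (simp add: field_simps)
  moreover have "(1 - 2 * \<delta>) / (4 * (1 + \<delta>)\<^sup>2) - \<delta> / (1 + \<delta>) \<le> (N / (D\<^sup>2 * ((2 + 2 * \<delta>) * D)) - 2 * \<delta> * D) / ((2 + 2 * \<delta>) * D)"
  proof -
    have "(1 - 2 * \<delta>) / (4 * (1 + \<delta>)\<^sup>2) - \<delta> / (1 + \<delta>) =
      ((1 - 2 * \<delta>) * (D\<^sup>2)\<^sup>2 / (D\<^sup>2 * ((2 + 2 * \<delta>) * D)) - 2 * \<delta> * D) / ((2 + 2 * \<delta>) * D)"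
    proof -
      define e where "e = 1 + \<delta>"
      have e: "2 + 2 * \<delta> = 2 * e" "e \<noteq> 0" "1 + \<delta> = e" using \<delta> by (auto simp: e_def)
      show ?thesis unfolding e using e(2) D by (simp add: field_simps power2_eq_square)
    qed
    also have "\<dots> \<le> (N / (D\<^sup>2 * ((2 + 2 * \<delta>) * D)) - 2 * \<delta> * D) / ((2 + 2 * \<delta>) * D)"
      using N D \<delta> by (intro divide_right_mono diff_mono) auto
    finally show ?thesis .
  qed
  ultimately show ?thesis by linarith
qed

text \<open>The deterministic half of the argument, for one sample \<open>x\<close>. Passing from G
  to its traceless part moves each form value at a unit vector by at most \<delta> d; this accounts
  for the second \<delta> in M = (2 + 2 \<delta>) d and in the product bound 2 \<delta> d.\<close>

lemma far_if_regular:
  assumes d: "0 < d" and \<delta>: "0 < \<delta>" "\<delta> \<le> 1 / 4"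
    and up: "\<And>v. cinner (bip d) v v = 1 \<Longrightarrow> Re (qform (bip d) (herm_of d x) v) \<le> (2 + \<delta>) * real d"
    and low: "\<And>v. cinner (bip d) v v = 1 \<Longrightarrow> - Re (qform (bip d) (herm_of d x) v) \<le> (2 + \<delta>) * real d"
    and low': "\<And>v. cinner (bip d) v v = 1 \<Longrightarrow> - Re (qform (bip d) (ptrans (herm_of d x)) v) \<le> (2 + \<delta>) * real d"
    and prod: "\<And>y z. cinner {..<d} y y = 1 \<Longrightarrow> cinner {..<d} z z = 1 \<Longrightarrow>
      Re (qform (bip d) (herm_of d x) (kron y z)) \<le> \<delta> * real d"
    and tr: "\<bar>\<Sum>i\<in>bip d. x (i, i)\<bar> < \<delta> * (real d) ^ 3"
    and nrm: "\<bar>(\<Sum>k\<in>bip d \<times> bip d. (x k)\<^sup>2) - (real d) ^ 4\<bar> < \<delta> * (real d) ^ 4"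
  shows "direction d x \<in> far_directions d (1 / 4 - 2 * \<delta>)"
proof -
  let ?I = "bip d" and ?Y = "gue0 d x" and ?\<tau> = "mean_diag d x"
  define D where "D = real d"
  have D: "0 < D" using d by (simp add: D_def)
  define M where "M = (2 + 2 * \<delta>) * D"
  have M: "0 < M" using D \<delta> by (simp add: M_def)
  have \<tau>: "\<bar>?\<tau>\<bar> \<le> \<delta> * D"
  proof -
    have "\<bar>?\<tau>\<bar> = \<bar>\<Sum>i\<in>?I. x (i, i)\<bar> / D\<^sup>2" by (simp add: mean_diag_def D_def)
    also have "\<dots> \<le> \<delta> * D ^ 3 / D\<^sup>2" using tr by (intro divide_right_mono) (auto simp: D_def)
    also have "\<dots> = \<delta> * D" using D by (simp add: power3_eq_cube power2_eq_square)
    finally show ?thesis .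
  qed
  define N where "N = hs_inner d ?Y ?Y"
  \<comment> \<open>One \<delta> is lost to the fluctuation of |G|^2 and one to the removed trace,
    because d^2 \<tau>^2 \<le> \<delta>^2 d^4 \<le> \<delta> d^4.\<close>
  have N: "(1 - 2 * \<delta>) * (D\<^sup>2)\<^sup>2 \<le> N"
  proof -
    have "?\<tau>\<^sup>2 \<le> (\<delta> * D)\<^sup>2" using \<tau> by (simp add: abs_le_square_iff[symmetric] abs_mult) (use \<delta> D in simp)
    then have "D\<^sup>2 * ?\<tau>\<^sup>2 \<le> D\<^sup>2 * (\<delta> * D)\<^sup>2" by (intro mult_left_mono) auto
    also have "\<dots> = \<delta>\<^sup>2 * D ^ 4" by (simp add: power2_eq_square power4_eq_xxxx)
    also have "\<dots> \<le> \<delta> * D ^ 4" using \<delta> by (intro mult_right_mono) (auto simp: power2_eq_square)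
    finally have "D\<^sup>2 * ?\<tau>\<^sup>2 \<le> \<delta> * D ^ 4" .
    moreover have "D ^ 4 - \<delta> * D ^ 4 \<le> (\<Sum>k\<in>?I \<times> ?I. (x k)\<^sup>2)" using nrm unfolding D_def by linarith
    moreover have "N = (\<Sum>k\<in>?I \<times> ?I. (x k)\<^sup>2) - D\<^sup>2 * ?\<tau>\<^sup>2"
      unfolding N_def hs_inner_gue0_self[OF d] D_def ..
    moreover have "(1 - 2 * \<delta>) * (D\<^sup>2)\<^sup>2 = D ^ 4 - \<delta> * D ^ 4 - \<delta> * D ^ 4" by (simp add: algebra_simps)
    ultimately show ?thesis by linarith
  qed
  have "0 < (1 - 2 * \<delta>) * (D\<^sup>2)\<^sup>2" using \<delta> D by simp
  then have N0: "0 < N" using N by linarith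
  have sum: "(2 + \<delta>) * D + \<delta> * D = M" by (simp add: M_def algebra_simps)
  have Yv: "Re (qform ?I ?Y v) = Re (qform ?I (herm_of d x) v) - ?\<tau>"
    "Re (qform ?I (ptrans ?Y) v) = Re (qform ?I (ptrans (herm_of d x)) v) - ?\<tau>"
    if "cinner ?I v v = 1" for v
    unfolding qform_gue0 that by simp_all
  have abs: "\<bar>Re (qform ?I ?Y v)\<bar> \<le> M" if "cinner ?I v v = 1" for v
    using Yv[OF that] up[OF that] low[OF that] \<tau> sum unfolding D_def[symmetric] by linarith
  have lowY: "- Re (qform ?I ?Y v) \<le> M" if "cinner ?I v v = 1" for v
    using abs[OF that] by linarith
  have lowY': "- Re (qform ?I (ptrans ?Y) v) \<le> M" if "cinner ?I v v = 1" for v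
    using Yv[OF that] low'[OF that] \<tau> sum unfolding D_def[symmetric] by linarith
  have prodY: "Re (qform ?I ?Y (kron y z)) \<le> 2 * \<delta> * D" if "cinner {..<d} y y = 1" "cinner {..<d} z z = 1" for y z
    using Yv(1)[of "kron y z"] prod[OF that] \<tau> that unfolding D_def[symmetric] by (simp add: cinner_kron)
  let ?\<rho>0 = "\<lambda>i j. of_real (1 / (real d)\<^sup>2) * (mat_one ?I i j + of_real (1 / M) * ?Y i j)"
  note \<rho>0 = perturbed_identity_PPT[OF d hermitian_gue0 mtrace_gue0[OF d] M lowY lowY']
  have "1 / 4 - 2 * \<delta> \<le> dist_SEP d \<rho>"
    if \<rho>: "\<rho> \<in> PPT d" and max: "\<forall>\<tau>\<in>PPT d. hs_inner d \<tau> ?Y \<le> hs_inner d \<rho> ?Y" for \<rho>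
  proof -
    have "1 / 4 - 2 * \<delta> \<le> (N / (D\<^sup>2 * M) - 2 * \<delta> * D) / M"
      unfolding M_def by (rule witness_constant[OF \<delta> D N])
    also have "\<dots> \<le> (hs_inner d \<rho> ?Y - 2 * \<delta> * D) / M"
    proof (intro divide_right_mono diff_right_mono)
      have "hs_inner d ?\<rho>0 ?Y \<le> hs_inner d \<rho> ?Y" using max \<rho>0(1) by blast
      moreover have "hs_inner d ?\<rho>0 ?Y = N / (D\<^sup>2 * M)" unfolding N_def D_def by (rule \<rho>0(2))
      ultimately show "N / (D\<^sup>2 * M) \<le> hs_inner d \<rho> ?Y" by linarith
    qed (use M in simp)
    also have "\<dots> \<le> dist_SEP d \<rho>"
      by (rule dist_SEP_witness[OF d M PPT_hermitian[OF \<rho>] abs prodY])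
    finally show ?thesis .
  qed
  then show ?thesis unfolding direction_far_iff[OF d] using N0 by (simp add: N_def)
qed

section \<open>Probability of the good directions and the limit\<close>

lemma (in prob_space) compl_prob_Int_le:
  assumes "A \<in> events" "B \<in> events"
  shows "1 - prob (A \<inter> B) \<le> (1 - prob A) + (1 - prob B)"
proof -
  have "prob (A \<union> B) = prob A + prob B - prob (A \<inter> B)"
    by (rule measure_Un3) (use assms in \<open>auto simp: fmeasurable_eq_sets\<close>)
  then show ?thesis using prob_le_1[of "A \<union> B"] by linarith
qed

text \<open>A union bound over six events. The three operator bounds and the deviation of |G|^2
  contribute 2 / (\<delta>^2 d^2) each, which explains the 8; the other two terms come from the
  product vectors and the trace.\<close>

lemma sphere_measure_far_ge:
  assumes \<delta>: "0 < \<delta>" "\<delta> \<le> 1 / 4" and d: "0 < d" and large: "32 \<le> \<delta>\<^sup>2 * real d"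
  shows "1 - (8 / (\<delta>\<^sup>2 * (real d)\<^sup>2) + 1024 / (\<delta> ^ 4 * (real d) ^ 3) + 1 / (\<delta>\<^sup>2 * (real d) ^ 4))
    \<le> sphere_measure d (far_directions d (1 / 4 - 2 * \<delta>))"
proof -
  let ?M = "gauss_coords d" and ?K = "bip d \<times> bip d" and ?V = "{v. cinner (bip d) v v = 1}"
  let ?b = "2 / (\<delta>\<^sup>2 * (real d)\<^sup>2)"
  interpret prob_space ?M unfolding gauss_coords_eq by (rule gauss_on.prob_space_axioms)
  define E where "E = (\<lambda>H. {x \<in> space ?M. \<forall>v\<in>?V. hs_inner d (H v) (herm_of d x) \<le> (2 + \<delta>) * real d})"
  \<comment> \<open>These encode the upper bound on G, the lower bound on G and the lower bound on
    its partial transpose. A sign or a partial transpose preserves the covariance, so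
    \<open>operator_bound\<close> applies to all three.\<close>
  define H1 where "H1 = (\<lambda>v. outer (bip d) v)"
  define H2 where "H2 = (\<lambda>v i j. - outer (bip d) v i j)"
  define H3 where "H3 = (\<lambda>v i j. - ptrans (outer (bip d) v) i j)"
  have hs: "hs_inner d (outer (bip d) v) (outer (bip d) w) = (cmod (cinner (bip d) v w))\<^sup>2" for v w
    by (simp add: hs_inner_outer qform_outer cmod_cinner_commute[of _ w])
  have cont: "continuous_on UNIV (\<lambda>v. outer (bip d) v i j)" for i j
    by (rule continuous_on_outer[OF continuous_on_id])
  have E1: "E H1 \<in> events" "1 - prob (E H1) \<le> ?b"
    unfolding E_def by (rule operator_bound[OF d \<delta>(1)]; simp add: H1_def hs hermitian_outer cont)+
  have E2: "E H2 \<in> events" "1 - prob (E H2) \<le> ?b"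
    unfolding E_def
    by (rule operator_bound[OF d \<delta>(1)];
        simp add: H2_def hs hs_inner_uminus_left hs_inner_uminus_right hermitian_uminus hermitian_outer cont continuous_on_minus)+
  have cont': "continuous_on UNIV (\<lambda>v. ptrans (outer (bip d) v) i j)" for i j
    unfolding ptrans_def by (rule cont)
  have E3: "E H3 \<in> events" "1 - prob (E H3) \<le> ?b"
    unfolding E_def
    by (rule operator_bound[OF d \<delta>(1)];
        simp add: H3_def hs hs_inner_ptrans ptrans_ptrans hs_inner_uminus_left hs_inner_uminus_right hermitian_uminus
          hermitian_ptrans hermitian_outer cont' continuous_on_minus)+
  define E4 where "E4 = {z \<in> space ?M. \<forall>v\<in>{v. cinner {..<d} (fst v) (fst v) = 1 \<and> cinner {..<d} (snd v) (snd v) = 1}.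
      hs_inner d (outer (bip d) (kron (fst v) (snd v))) (herm_of d z) \<le> \<delta> * real d}"
  have E4: "E4 \<in> events" "1 - prob E4 \<le> 1024 / (\<delta> ^ 4 * (real d) ^ 3)"
    unfolding E4_def by (rule product_bound[OF d \<delta>(1) large])+
  have D: "0 < real d" using d by simp
  have cK: "real (card ?K) = (real d) ^ 4" by (simp add: card_cartesian_product power4_eq_xxxx)
  define B5 where "B5 = {x \<in> space ?M. \<delta> * (real d) ^ 4 \<le> \<bar>(\<Sum>k\<in>?K. (x k)\<^sup>2) - (real d) ^ 4\<bar>}"
  have B5: "B5 \<in> events" "prob B5 \<le> 2 / (\<delta>\<^sup>2 * (real d)\<^sup>2)"
  proof -
    have a: "0 < \<delta> * (real d) ^ 4" using D \<delta> by simp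
    show "B5 \<in> events"
      using chi_square_deviation(2)[OF _ a, of ?K] unfolding B5_def gauss_coords_eq cK by simp
    have "prob B5 \<le> 2 * (real d) ^ 4 / (\<delta> * (real d) ^ 4)\<^sup>2"
      using chi_square_deviation(1)[OF _ a, of ?K] unfolding B5_def gauss_coords_eq cK by simp
    also have "\<dots> = 2 / (\<delta>\<^sup>2 * (real d) ^ 4)" using D by (simp add: power2_eq_square)
    \<comment> \<open>Weakened from d^4 to d^2 in order to merge with the three operator
      terms.\<close>
    also have "\<dots> \<le> 2 / (\<delta>\<^sup>2 * (real d)\<^sup>2)"
      using D d \<delta> by (intro divide_left_mono mult_left_mono power_increasing) auto
    finally show "prob B5 \<le> 2 / (\<delta>\<^sup>2 * (real d)\<^sup>2)" .
  qed
  \<comment> \<open>The trace of G is a sum of d^2 independent standard Gaussians, so its variance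
    is d^2, and Chebyshev at the level \<delta> d^3 gives 1 / (\<delta>^2 d^4).\<close>
  let ?S = "(\<lambda>i. (i, i)) ` bip d"
  define B6 where "B6 = {x \<in> space ?M. \<delta> * (real d) ^ 3 \<le> \<bar>\<Sum>i\<in>bip d. x (i, i)\<bar>}"
  have B6: "B6 \<in> events" "prob B6 \<le> 1 / (\<delta>\<^sup>2 * (real d) ^ 4)"
  proof -
    have a: "0 < \<delta> * (real d) ^ 3" using D \<delta> by simp
    have S: "(\<Sum>k\<in>?S. x k) = (\<Sum>i\<in>bip d. x (i, i))" for x :: "_ \<Rightarrow> real"
      by (subst sum.reindex) (auto simp: inj_on_def)
    have cS: "real (card ?S) = (real d)\<^sup>2"
      by (subst card_image) (auto simp: inj_on_def card_cartesian_product power2_eq_square)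
    have i: "integrable std_gauss (\<lambda>x. x)" "integrable std_gauss (\<lambda>x. x * x)" "(\<integral>x. x * x \<partial>std_gauss) = 1"
      using integrable_std_gauss_power[of 1] integrable_std_gauss_power[of 2] std_gauss_moments(2)
      by (simp_all add: power2_eq_square)
    have sub: "?S \<subseteq> ?K" by auto
    note ch = gauss_sum_chebyshev[where K = ?K and S = ?S and f = "\<lambda>x. x", OF _ sub _ i(1) std_gauss_moments(1) i(2,3) a]
    show "B6 \<in> events"
      using ch(2) unfolding B6_def gauss_coords_eq S by simp
    have "prob B6 \<le> (real d)\<^sup>2 / (\<delta> * (real d) ^ 3)\<^sup>2"
      using ch(1) unfolding B6_def gauss_coords_eq S cS by simp
    also have "\<dots> = 1 / (\<delta>\<^sup>2 * (real d) ^ 4)"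
      using D \<delta> by (simp add: field_simps power2_eq_square power3_eq_cube power4_eq_xxxx)
    finally show "prob B6 \<le> 1 / (\<delta>\<^sup>2 * (real d) ^ 4)" .
  qed
  let ?far = "{x \<in> space ?M. direction d x \<in> far_directions d (1 / 4 - 2 * \<delta>)}"
  let ?E = "E H1 \<inter> (E H2 \<inter> (E H3 \<inter> (E4 \<inter> ((space ?M - B5) \<inter> (space ?M - B6)))))"
  have "?E \<subseteq> ?far"
  proof
    fix x assume x: "x \<in> ?E"
    have "direction d x \<in> far_directions d (1 / 4 - 2 * \<delta>)"
    proof (rule far_if_regular[OF d \<delta>])
      fix v assume v: "cinner (bip d) v v = 1"
      show "Re (qform (bip d) (herm_of d x) v) \<le> (2 + \<delta>) * real d"
        using x v by (auto simp: E_def H1_def hs_inner_outer)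
      show "- Re (qform (bip d) (herm_of d x) v) \<le> (2 + \<delta>) * real d"
        using x v by (auto simp: E_def H2_def hs_inner_uminus_left hs_inner_outer)
      show "- Re (qform (bip d) (ptrans (herm_of d x)) v) \<le> (2 + \<delta>) * real d"
        using x v by (auto simp: E_def H3_def hs_inner_uminus_left hs_inner_ptrans hs_inner_outer)
    next
      fix y z assume "cinner {..<d} y y = 1" "cinner {..<d} z z = 1"
      moreover have "x \<in> E4" using x by blast
      ultimately show "Re (qform (bip d) (herm_of d x) (kron y z)) \<le> \<delta> * real d"
        unfolding E4_def hs_inner_outer by auto
    next
      show "\<bar>\<Sum>i\<in>bip d. x (i, i)\<bar> < \<delta> * (real d) ^ 3" using x by (auto simp: B6_def not_le)
      show "\<bar>(\<Sum>k\<in>?K. (x k)\<^sup>2) - (real d) ^ 4\<bar> < \<delta> * (real d) ^ 4" using x by (auto simp: B5_def not_le)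
    qed
    then show "x \<in> ?far" using x by (simp add: E_def)
  qed
  then have "prob ?E \<le> prob ?far" by (intro finite_measure_mono sets_far_directions[OF d])
  moreover have "1 - prob ?E \<le> ?b + (?b + (?b + (1024 / (\<delta> ^ 4 * (real d) ^ 3) + (?b + 1 / (\<delta>\<^sup>2 * (real d) ^ 4)))))"
    using E1 E2 E3 E4 B5 B6
    by (intro order_trans[OF compl_prob_Int_le] add_mono) (auto simp: prob_compl)
  ultimately show ?thesis unfolding sphere_measure_def by simp
qed

lemma sphere_measure_far_tendsto:
  assumes "0 < \<epsilon>"
  shows "(\<lambda>d. sphere_measure d (far_directions d (1 / 4 - \<epsilon>))) \<longlonglongrightarrow> 1"
proof -
  \<comment> \<open>The estimate loses 2 \<delta>, hence \<epsilon> / 2; the cap 1/4 is the range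
    assumed by \<open>sphere_measure_far_ge\<close>.\<close>
  define \<delta> where "\<delta> = min (\<epsilon> / 2) (1 / 4)"
  have \<delta>: "0 < \<delta>" "\<delta> \<le> 1 / 4" "2 * \<delta> \<le> \<epsilon>" using assms by (auto simp: \<delta>_def)
  define b where "b = (\<lambda>d. 8 / (\<delta>\<^sup>2 * (real d)\<^sup>2) + 1024 / (\<delta> ^ 4 * (real d) ^ 3) + 1 / (\<delta>\<^sup>2 * (real d) ^ 4))"
  have lim: "(\<lambda>d. 1 - b d) \<longlonglongrightarrow> 1" unfolding b_def using \<delta>(1) by real_asymp
  have e1: "eventually (\<lambda>d. 1 - b d \<le> sphere_measure d (far_directions d (1 / 4 - \<epsilon>))) sequentially"
  proof (rule eventually_mono)
    have "filterlim (\<lambda>d. \<delta>\<^sup>2 * real d) at_top sequentially" using \<delta>(1) by real_asymp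
    then have "eventually (\<lambda>d. 32 \<le> \<delta>\<^sup>2 * real d) sequentially" by (simp add: filterlim_at_top)
    then show "eventually (\<lambda>d. 0 < d \<and> 32 \<le> \<delta>\<^sup>2 * real d) sequentially"
      using eventually_gt_at_top[of "0::nat"] by eventually_elim simp
  next
    fix d :: nat assume d: "0 < d \<and> 32 \<le> \<delta>\<^sup>2 * real d"
    interpret prob_space "gauss_coords d" unfolding gauss_coords_eq by (rule gauss_on.prob_space_axioms)
    have "1 - b d \<le> sphere_measure d (far_directions d (1 / 4 - 2 * \<delta>))"
      unfolding b_def using d by (intro sphere_measure_far_ge \<delta>) auto
    also have "\<dots> \<le> sphere_measure d (far_directions d (1 / 4 - \<epsilon>))"
      unfolding sphere_measure_def
    proof (rule finite_measure_mono)
      show "{x \<in> space (gauss_coords d). direction d x \<in> far_directions d (1 / 4 - 2 * \<delta>)}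
        \<subseteq> {x \<in> space (gauss_coords d). direction d x \<in> far_directions d (1 / 4 - \<epsilon>)}"
        using \<delta>(3) by (force simp: far_directions_def)
    qed (use sets_far_directions d in blast)
    finally show "1 - b d \<le> sphere_measure d (far_directions d (1 / 4 - \<epsilon>))" .
  qed
  have e2: "eventually (\<lambda>d. sphere_measure d (far_directions d (1 / 4 - \<epsilon>)) \<le> 1) sequentially"
  proof (rule always_eventually, rule allI)
    fix d
    interpret prob_space "gauss_coords d" unfolding gauss_coords_eq by (rule gauss_on.prob_space_axioms)
    show "sphere_measure d (far_directions d (1 / 4 - \<epsilon>)) \<le> 1" unfolding sphere_measure_def by simp
  qed
  show ?thesis by (rule tendsto_sandwich[OF e1 e2 lim tendsto_const])
qed

lemma PPT_nonempty:
  assumes "0 < d"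
  shows "PPT d \<noteq> {}"
proof -
  have *: "psd_on (bip d) (\<lambda>_ _. 0)" by (auto simp: psd_on_def ops_on_def)
  have h: "hermitian_on (bip d) (\<lambda>_ _. 0)" by (auto simp: hermitian_on_def madj_def ops_on_def)
  have "mtrace (bip d) (\<lambda>_ _. 0) = 0" by (simp add: mtrace_def)
  \<comment> \<open>The perturbation 0 with M = 1 gives the maximally mixed state.\<close>
  from perturbed_identity_PPT(1)[OF assms h this, of 1] show ?thesis
    by (auto simp: qform_def ptrans_def)
qed

lemma PPT_maximiser:
  assumes "0 < d"
  obtains \<rho> where "\<rho> \<in> PPT d" "\<And>\<tau>. \<tau> \<in> PPT d \<Longrightarrow> hs_inner d \<tau> u \<le> hs_inner d \<rho> u"
proof -
  have "continuous_on (PPT d) (\<lambda>\<tau>. hs_inner d \<tau> u)"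
    unfolding hs_inner_def mtrace_mmul
    by (intro continuous_on_Re continuous_on_sum continuous_on_mult continuous_on_const
        continuous_on_coord[OF continuous_on_coord[OF continuous_on_id]])
  from continuous_attains_sup[OF compact_PPT PPT_nonempty[OF assms] this] show thesis
    using that by blast
qed

theorem theorem1:
  shows "(\<forall>\<epsilon>>0. \<exists>d0. \<forall>d\<ge>d0. \<exists>\<rho>\<in>PPT d. dist_SEP d \<rho> \<ge> 1/4 - \<epsilon>) \<and>
         (\<forall>\<epsilon>>0. (\<lambda>d. sphere_measure d
             {u \<in> sphere_S d. \<forall>\<rho>\<in>PPT d.
                (\<forall>\<tau>\<in>PPT d. hs_inner d \<tau> u \<le> hs_inner d \<rho> u) \<longrightarrow>
                dist_SEP d \<rho> \<ge> 1/4 - \<epsilon>}) \<longlonglongrightarrow> 1)"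
proof (intro conjI allI impI)
  fix \<epsilon> :: real assume \<epsilon>: "0 < \<epsilon>"
  show "(\<lambda>d. sphere_measure d {u \<in> sphere_S d. \<forall>\<rho>\<in>PPT d.
      (\<forall>\<tau>\<in>PPT d. hs_inner d \<tau> u \<le> hs_inner d \<rho> u) \<longrightarrow> dist_SEP d \<rho> \<ge> 1/4 - \<epsilon>}) \<longlonglongrightarrow> 1"
    using sphere_measure_far_tendsto[OF \<epsilon>] unfolding far_directions_def .
  \<comment> \<open>The existence claim is extracted from the measure claim. A measure tending to 1
    is eventually positive, so a good direction \<open>u\<close> exists; a maximiser for
    \<open>u\<close>, available by compactness, is the required state.\<close>
  have "eventually (\<lambda>d. 0 < sphere_measure d (far_directions d (1 / 4 - \<epsilon>))) sequentially"
    by (rule order_tendstoD(1)[OF sphere_measure_far_tendsto[OF \<epsilon>]]) simp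
  then have "eventually (\<lambda>d. 0 < d \<and> 0 < sphere_measure d (far_directions d (1 / 4 - \<epsilon>))) sequentially"
    using eventually_gt_at_top[of "0::nat"] by eventually_elim simp
  then obtain d0 where d0: "\<And>d. d0 \<le> d \<Longrightarrow> 0 < d \<and> 0 < sphere_measure d (far_directions d (1 / 4 - \<epsilon>))"
    unfolding eventually_sequentially by blast
  have "\<exists>\<rho>\<in>PPT d. 1 / 4 - \<epsilon> \<le> dist_SEP d \<rho>" if "d0 \<le> d" for d
  proof -
    have d: "0 < d" and pos: "0 < sphere_measure d (far_directions d (1 / 4 - \<epsilon>))" using d0[OF that] by auto
    have "{x \<in> space (gauss_coords d). direction d x \<in> far_directions d (1 / 4 - \<epsilon>)} \<noteq> {}"
      using pos unfolding sphere_measure_def by (metis measure_empty order_less_irrefl)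
    then obtain u where u: "u \<in> far_directions d (1 / 4 - \<epsilon>)" by blast
    obtain \<rho> where "\<rho> \<in> PPT d" "\<And>\<tau>. \<tau> \<in> PPT d \<Longrightarrow> hs_inner d \<tau> u \<le> hs_inner d \<rho> u"
      using PPT_maximiser[OF d] by blast
    then show ?thesis using u unfolding far_directions_def by blast
  qed
  then show "\<exists>d0. \<forall>d\<ge>d0. \<exists>\<rho>\<in>PPT d. dist_SEP d \<rho> \<ge> 1/4 - \<epsilon>" by blast
qed

end
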